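(* Let $f\in\mathcal P_{n,d}$ and $\alpha>0$. Then, for any $1\le j\le n-1$, $$V_j([f\le\alpha])=\alpha^{j/d}\,\frac{\beta_{j,n}}{\Gamma(1+j/d)}\int_{G(j,n)}\int_E \exp\big(-\Pi_E f(y)\big)\,dy\,d\nu_j(E)$$ and $$\widetilde V_j([f\le\alpha])=\alpha^{j/d}\,\frac{\sigma_{j,n}}{\Gamma(1+j/d)}\int_{G(j,n)}\int_E \exp\big(-\mathscr R_E f(y)\big)\,dy\,d\nu_j(E),$$ where $\beta_{j,n}=\binom nj\frac{\kappa_n}{\kappa_j\kappa_{n-j}}$ and $\sigma_{j,n}=\frac{\kappa_n}{\kappa_j}$.
   Context: Fix natural numbers $n\ge2$ and $d\ge2$ with $d$ even. $\mathcal P_{n,d}$ is the set of convex polynomials $f:\mathbb R^n\to\mathbb R$ that are positively $d$-homogeneous ($f(\lambda x)=\lambda^d f(x)$ for all $\lambda>0$, $x\in\mathbb R^n$) and satisfy $f(x)>0$ for all $x\ne0$. $[f\le\alpha]:=\{x\in\mathbb R^n: f(x)\le\alpha\}$. $B^m$ is the Euclidean unit ball of $\mathbb R^m$ and $\kappa_m$ its volume. $G(j,n)$ is the Grassmannian of $j$-dimensional linear subspaces of $\mathbb R^n$ and $\nu_j$ its rotation-invariant (Haar) probability measure; $dy$ is $j$-dimensional Lebesgue measure on $E\in G(j,n)$. For $E\in G(j,n)$ and $y\in E$: $\Pi_E f(y):=\inf_{z\in E^\perp}f(y+z)$ and $\mathscr R_E f(y):=f(y)$ (i.e. $\mathscr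 R_E f=f|_E$). The intrinsic volumes $V_j(K)$ of a convex body $K\subset\mathbb R^n$ are defined by the Steiner formula $\mathrm{vol}_n(K+\varepsilon B^n)=\sum_{j=0}^n\kappa_{n-j}V_j(K)\varepsilon^{n-j}$, $\varepsilon\geq 0$. The $j$-th dual volume of a convex body $K$ containing the origin in its interior is $\widetilde V_j(K):=\frac1n\int_{\mathbb S^{n-1}}\rho_K(u)^j\,du$, where $\rho_K(u):=\max\{\lambda>0:\lambda u\in K\}$ and $du$ is the surface measure on the unit sphere. *)

theory Defs
  imports "HOL-Probability.Probability_Measure" "HOL-Analysis.Analysis"
begin

definition pos_hom_convex_polynomials :: "nat \<Rightarrow> (real ^ 'n \<Rightarrow> real) set" where
  "pos_hom_convex_polynomials d =
     {f. real_polynomial_function f \<and> convex_on UNIV f \<and>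
         (\<forall>l>0. \<forall>x. f (l *\<^sub>R x) = l ^ d * f x) \<and>
         (\<forall>x. x \<noteq> 0 \<longrightarrow> f x > 0)}"

text \<open>The coefficients in the Steiner formula are determined for indices at most the
  dimension, which is the only range in which this definition is meaningful.\<close>

definition intrinsic_volume :: "nat \<Rightarrow> (real ^ 'n) set \<Rightarrow> real" where
  "intrinsic_volume j K =
     (THE v. \<exists>V :: nat \<Rightarrow> real. V j = v \<and>
        (\<forall>\<epsilon>\<ge>0. measure lebesgue {x + \<epsilon> *\<^sub>R b | x b. x \<in> K \<and> b \<in> cball 0 1} =
           (\<Sum>i\<le>CARD('n). unit_ball_vol (real (CARD('n) - i)) * V i * \<epsilon> ^ (CARD('n) - i))))"

text \<open>Surface measure on the unit sphere: a Borel set \<open>A\<close> has measure \<open>n\<close> times the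
  Lebesgue measure of \<open>{t u | 0 < t \<le> 1, u \<in> A}\<close>, the preimage of \<open>A\<close> under
  \<open>sgn x = x / norm x\<close> in the punctured unit ball.\<close>

definition sphere_measure :: "(real ^ 'n) measure" where
  "sphere_measure =
     scale_measure (of_nat CARD('n))
       (distr (restrict_space lborel (cball 0 1 - {0})) (restrict_space borel (sphere 0 1)) sgn)"

definition radial_function :: "(real ^ 'n) set \<Rightarrow> real ^ 'n \<Rightarrow> real" where
  "radial_function K u = (GREATEST l. l > 0 \<and> l *\<^sub>R u \<in> K)"

definition dual_volume :: "nat \<Rightarrow> (real ^ 'n) set \<Rightarrow> real" where
  "dual_volume j K = 1 / real CARD('n) * (\<integral>u. radial_function K u ^ j \<partial>sphere_measure)"

definition grassmannian :: "nat \<Rightarrow> (real ^ 'n) set set" where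
  "grassmannian j = {E. subspace E \<and> dim E = j}"

text \<open>The topology of the Grassmannian is the one making the embedding that sends a subspace
  to the matrix of its orthogonal projection a homeomorphism onto its image, so its
  Borel sets are the preimages of Borel sets of matrices.\<close>

definition grassmannian_borel :: "nat \<Rightarrow> (real ^ 'n) set measure" where
  "grassmannian_borel j =
     vimage_algebra (grassmannian j) (\<lambda>E. matrix (closest_point E)) (borel :: (real ^ 'n ^ 'n) measure)"

definition is_grassmannian_haar :: "nat \<Rightarrow> (real ^ 'n) set measure \<Rightarrow> bool" where
  "is_grassmannian_haar j \<nu> \<longleftrightarrow>
     sets \<nu> = sets (grassmannian_borel j) \<and> prob_space \<nu> \<and>
     (\<forall>R. rotation_matrix R \<longrightarrow>
        (\<forall>A\<in>sets \<nu>. emeasure \<nu> ((\<lambda>E. (\<lambda>x. R *v x) ` E) ` A) = emeasure \<nu> A))"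

definition orthonormal_basis_of :: "(real ^ 'n) set \<Rightarrow> (real ^ 'n) set \<Rightarrow> bool" where
  "orthonormal_basis_of E B \<longleftrightarrow>
     pairwise orthogonal B \<and> (\<forall>b\<in>B. norm b = 1) \<and> span B = E"

text \<open>Lebesgue measure on a linear subspace, with the subspace itself as underlying space: the
  image of the product Lebesgue measure under coordinates in an orthonormal basis, as
  for \<open>lborel\<close>. By orthogonal invariance it does not depend on the chosen basis.\<close>

definition subspace_lborel :: "(real ^ 'n) set \<Rightarrow> (real ^ 'n) measure" where
  "subspace_lborel E =
     (let B = (SOME B. orthonormal_basis_of E B)
      in distr (\<Pi>\<^sub>M b\<in>B. lborel) (restrict_space borel E) (\<lambda>c. \<Sum>b\<in>B. c b *\<^sub>R b))"

definition inf_projection :: "(real ^ 'n) set \<Rightarrow> (real ^ 'n \<Rightarrow> real) \<Rightarrow> real ^ 'n \<Rightarrow> real" where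
  "inf_projection E f y = (INF z\<in>orthogonal_comp E. f (y + z))"

end

theory Submission
  imports Defs "HOL-Probability.Infinite_Product_Measure"
begin

text \<open>Both formulas follow from integral geometry, since for a positive function \<open>h\<close> on \<open>E\<close> that is
  homogeneous of degree \<open>d\<close>, the integral of \<open>exp (- h)\<close> over \<open>E\<close> is \<open>Gamma (1 + j / d)\<close> times the
  volume of the sublevel set \<open>h \<le> 1\<close>, and the sublevel sets of the infimal projection of \<open>f\<close> are the
  projections of the sublevel sets of \<open>f\<close>.

  For the Steiner formula and Kubota's formula, the directional derivatives of the distance function of a
  convex body \<open>L\<close> compute how the volumes of the parallel bodies of \<open>L\<close> grow when a segment
  \<open>[0, g]\<close> is added. As the gradient of the distance function has norm \<open>1\<close>, averaging over \<open>g\<close> in the unit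
  ball shows that \<open>c (vol (L + \<epsilon>B) - vol L)\<close> is the integral over \<open>0 \<le> t \<le> \<epsilon>\<close> of the mean of
  \<open>vol (L + tB + [0, g]) - vol (L + tB)\<close>. Iterating this differential equation, the \<open>k\<close>-th derivative of
  \<open>vol (L + \<epsilon>B)\<close> is, up to a constant, the mean of a \<open>k\<close>-fold difference with respect to random segments.
  For given segments that difference is a multiple of the volume of the projection of the body onto the
  orthogonal complement of the segments. It vanishes for \<open>k > n\<close>, so the volume of the parallel body is a
  polynomial in \<open>\<epsilon>\<close>, and averaging over rotations turns its coefficients into means of projection volumes
  over the Grassmannian. The mean over the rotations comes from the Gram-Schmidt process applied to a random
  matrix; comparing with it shows that the invariant measure on the Grassmannian is unique.

  For dual volumes, both sides are means over the rotations of the function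
  \<open>(norm x ^ d / f x) powr (j / d)\<close>, which is homogeneous of degree \<open>0\<close>.\<close>

section \<open>Orthogonal invariance of Lebesgue measure\<close>

text \<open>Three choices shape the argument. Random segments are used because adding a segment
  changes the volume of a convex body by an amount exactly linear in the length: derivatives along a
  segment need no limit on the side of the volumes, and a body enters only through its distance
  function. No constant is computed on the way. The factor \<open>grad_const\<close> and the law of
  the segments occur alike for a body and for the unit ball, so both cancel, and the binomial
  coefficient in \<beta> comes from expanding \<open>(1 + \<epsilon>) ^ n\<close> for the ball.
  Finally, \<nu> is an arbitrary measure with the invariance property, and its sigma-algebra is
  accessible only through projection matrices. A function of a subspace is therefore extended to a
  Borel function of an arbitrary matrix; for this, integrals over \<open>E\<close> become integrals
  over the whole space by thickening \<open>E\<close> with the unit ball of its complement, at the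
  cost of a factor that depends on the dimension alone.\<close>

lemma unit_ball_vol_neq_0 [simp]: "unit_ball_vol (real n) \<noteq> 0"
  using unit_ball_vol_pos[of "real n"] by (simp del: unit_ball_vol_pos)

lemma borel_measurable_linear:
  fixes f :: "'a::euclidean_space \<Rightarrow> 'b::euclidean_space"
  assumes "linear f"
  shows "f \<in> borel_measurable borel"
  using assms by (intro borel_measurable_continuous_onI linear_continuous_on) (simp add: linear_conv_bounded_linear)

lemma nn_integral_lborel_translate:
  fixes g :: "'a::euclidean_space \<Rightarrow> ennreal"
  assumes [measurable]: "g \<in> borel_measurable borel"
  shows "(\<integral>\<^sup>+y. g (c + y) \<partial>lborel) = (\<integral>\<^sup>+y. g y \<partial>lborel)"
proof -
  have "(\<integral>\<^sup>+y. g y \<partial>lborel) = (\<integral>\<^sup>+y. g y \<partial>distr lborel borel ((+) c))"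
    by (simp add: lborel_distr_plus)
  also have "\<dots> = (\<integral>\<^sup>+y. g (c + y) \<partial>lborel)"
    by (subst nn_integral_distr) auto
  finally show ?thesis ..
qed

lemma nn_integral_lborel_reflect:
  fixes g :: "'a::euclidean_space \<Rightarrow> ennreal"
  assumes [measurable]: "g \<in> borel_measurable borel"
  shows "(\<integral>\<^sup>+y. g (c - y) \<partial>lborel) = (\<integral>\<^sup>+y. g y \<partial>lborel)"
proof -
  have "(\<integral>\<^sup>+y. g y \<partial>lborel) = (\<integral>\<^sup>+y. g y \<partial>density (distr lborel borel (\<lambda>x. c + (-1) *\<^sub>R x)) (\<lambda>_. \<bar>-1::real\<bar> ^ DIM('a)))"
    by (subst lborel_affine[of "-1" c]) auto
  also have "\<dots> = (\<integral>\<^sup>+y. g (c - y) \<partial>lborel)"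
    by (subst nn_integral_density) (auto simp: nn_integral_distr)
  finally show ?thesis ..
qed

text \<open>Uniqueness of translation-invariant measures: both sides of the claim are compared with
  the product of the measures of \<open>A\<close> and of the unit ball, which the isometry preserves.\<close>

lemma distr_lborel_orthogonal_transformation:
  fixes f :: "'a::euclidean_space \<Rightarrow> 'a"
  assumes f: "orthogonal_transformation f"
  shows "distr lborel borel f = lborel"
proof -
  have lin: "linear f" and norm: "\<And>x. norm (f x) = norm x"
    using f by (auto simp: orthogonal_transformation)
  have [measurable]: "f \<in> borel_measurable borel"
    by (rule borel_measurable_linear[OF lin])
  obtain g where g: "\<And>y. f (g y) = y"
    using orthogonal_transformation_surj[OF f] by (metis surjD)
  define C where "C = cball (0::'a) 1"
  have [measurable]: "C \<in> sets borel" by (simp add: C_def)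
  have fC: "f z \<in> C \<longleftrightarrow> z \<in> C" for z by (simp add: C_def norm)
  have "emeasure (distr lborel borel f) A = emeasure lborel A" if A[measurable]: "A \<in> sets borel" for A
  proof -
    have "emeasure (distr lborel borel f) A * emeasure lborel C
        = (\<integral>\<^sup>+z. indicator A (f z) \<partial>lborel) * emeasure lborel C"
      by (subst nn_integral_indicator[symmetric], simp)
         (simp add: nn_integral_distr del: nn_integral_indicator)
    also have "\<dots> = (\<integral>\<^sup>+z. indicator A (f z) * emeasure lborel C \<partial>lborel)"
      by (subst nn_integral_multc) auto
    also have "\<dots> = (\<integral>\<^sup>+z. indicator A (f z) * (\<integral>\<^sup>+y. indicator C (f z + y) \<partial>lborel) \<partial>lborel)"
      by (subst nn_integral_lborel_translate) auto
    also have "\<dots> = (\<integral>\<^sup>+z. (\<integral>\<^sup>+y. indicator A (f z) * indicator C (f z + y) \<partial>lborel) \<partial>lborel)"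
      by (subst nn_integral_cmult) auto
    also have "\<dots> = (\<integral>\<^sup>+y. (\<integral>\<^sup>+z. indicator A (f z) * indicator C (f z + y) \<partial>lborel) \<partial>lborel)"
      by (rule lborel_pair.Fubini') measurable
    \<comment> \<open>For fixed \<open>y\<close>, moving \<open>z\<close> by \<open>- g y\<close>
      moves \<open>f z\<close> by \<open>- y\<close>. The translation thus passes from
      \<open>C\<close> to \<open>A\<close>; this is where linearity of \<open>f\<close> is
      used.\<close>
    also have "\<dots> = (\<integral>\<^sup>+y. (\<integral>\<^sup>+z. indicator A (f z - y) * indicator C (f z) \<partial>lborel) \<partial>lborel)"
    proof (rule nn_integral_cong)
      fix y
      have "(\<integral>\<^sup>+z. indicator A (f z) * indicator C (f z + y) \<partial>lborel)
          = (\<integral>\<^sup>+z. indicator A (f (- g y + z)) * indicator C (f (- g y + z) + y) \<partial>lborel)"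
        by (rule nn_integral_lborel_translate[symmetric]) measurable
      moreover have "f (- g y + z) = f z - y" for z
        using lin g[of y] by (simp add: linear_add linear_neg linear_diff)
      ultimately show "(\<integral>\<^sup>+z. indicator A (f z) * indicator C (f z + y) \<partial>lborel)
          = (\<integral>\<^sup>+z. indicator A (f z - y) * indicator C (f z) \<partial>lborel)" by simp
    qed
    also have "\<dots> = (\<integral>\<^sup>+z. (\<integral>\<^sup>+y. indicator A (f z - y) * indicator C (f z) \<partial>lborel) \<partial>lborel)"
      by (rule lborel_pair.Fubini') measurable
    also have "\<dots> = (\<integral>\<^sup>+z. (\<integral>\<^sup>+y. indicator A (f z - y) \<partial>lborel) * indicator C (f z) \<partial>lborel)"
      by (subst nn_integral_multc) auto
    also have "\<dots> = (\<integral>\<^sup>+z. emeasure lborel A * indicator C z \<partial>lborel)"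
      by (subst nn_integral_lborel_reflect) (auto simp: fC indicator_def)
    also have "\<dots> = emeasure lborel A * emeasure lborel C"
      by (subst nn_integral_cmult) auto
    finally have *: "emeasure (distr lborel borel f) A * emeasure lborel C = emeasure lborel A * emeasure lborel C" .
    have "emeasure lborel C = ennreal (unit_ball_vol DIM('a))"
      by (simp add: C_def emeasure_cball)
    moreover have "unit_ball_vol (real DIM('a)) > 0" by simp
    ultimately have "emeasure lborel C \<noteq> 0" "emeasure lborel C \<noteq> top" by auto
    with * show ?thesis
      by (metis ennreal_mult_cancel_left mult.commute)
  qed
  then show ?thesis by (intro measure_eqI) auto
qed

lemma vol_orthogonal_image:
  fixes f :: "'a::euclidean_space \<Rightarrow> 'a"
  assumes f: "orthogonal_transformation f" and A: "A \<in> sets borel"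
  shows "emeasure lborel (f ` A) = emeasure lborel A"
proof -
  have inj: "inj f" and surj: "surj f"
    using orthogonal_transformation_inj[OF f] orthogonal_transformation_surj[OF f] by simp_all
  define g where "g = inv f"
  have g: "orthogonal_transformation g" unfolding g_def using f by (rule orthogonal_transformation_inv)
  then have [measurable]: "g \<in> borel_measurable borel"
    by (intro borel_measurable_linear) (simp add: orthogonal_transformation)
  have "emeasure lborel A = emeasure (distr lborel borel g) A"
    by (simp add: distr_lborel_orthogonal_transformation[OF g])
  also have "\<dots> = emeasure lborel (g -` A)" using A by (subst emeasure_distr) auto
  also have "g -` A = f ` A"
  proof (intro equalityI subsetI)
    fix x assume "x \<in> g -` A"
    then show "x \<in> f ` A" using surj_f_inv_f[OF surj, of x] by (auto simp: g_def image_iff intro!: bexI[of _ "inv f x"])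
  qed (auto simp: g_def inv_f_f[OF inj])
  finally show ?thesis ..
qed

text \<open>The random segments need a law that is invariant under orthogonal maps and has bounded
  support; the uniform law on the unit ball inherits its invariance directly from Lebesgue
  measure.\<close>

abbreviation ball_measure :: "'a::euclidean_space measure" where
  "ball_measure \<equiv> uniform_measure lborel (cball 0 1)"

lemma emeasure_unit_cball:
  "emeasure lborel (cball (0::'a::euclidean_space) 1) = ennreal (unit_ball_vol DIM('a))"
  by (simp add: emeasure_cball)

lemma prob_space_ball_measure: "prob_space (ball_measure :: 'a::euclidean_space measure)"
  by (rule prob_space_uniform_measure) (simp_all add: emeasure_unit_cball)

interpretation ball_measure: prob_space "ball_measure :: 'a::euclidean_space measure"
  by (rule prob_space_ball_measure)

lemma AE_ball_measure: "AE g in (ball_measure :: 'a::euclidean_space measure). norm g \<le> 1"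
  by (rule AE_uniform_measureI) auto

lemma distr_ball_measure:
  fixes f :: "'a::euclidean_space \<Rightarrow> 'a"
  assumes f: "orthogonal_transformation f"
  shows "distr ball_measure borel f = ball_measure"
proof (rule measure_eqI)
  have norm: "\<And>x. norm (f x) = norm x" using f by (auto simp: orthogonal_transformation)
  have [measurable]: "f \<in> borel_measurable borel"
    using f by (intro borel_measurable_linear) (simp add: orthogonal_transformation)
  fix A assume "A \<in> sets (distr ball_measure borel f)"
  then have A[measurable]: "A \<in> sets borel" by simp
  have "emeasure lborel (cball 0 1 \<inter> f -` A) = emeasure lborel (f -` (cball 0 1 \<inter> A))"
    by (rule arg_cong[where f="emeasure lborel"]) (auto simp: norm)
  also have "\<dots> = emeasure (distr lborel borel f) (cball 0 1 \<inter> A)"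
    by (subst emeasure_distr) auto
  finally have *: "emeasure lborel (cball 0 1 \<inter> f -` A) = emeasure lborel (cball 0 1 \<inter> A)"
    by (simp add: distr_lborel_orthogonal_transformation[OF f])
  have "f -` A \<in> sets borel" using measurable_sets[OF _ A, of f borel] by simp
  with * show "emeasure (distr ball_measure borel f) A = emeasure ball_measure A"
    by (simp add: emeasure_distr)
qed simp

lemma integrable_ball_measure_max_inner:
  "integrable ball_measure (\<lambda>g. max 0 (x \<bullet> g :: real))" for x :: "'a::euclidean_space"
proof (rule ball_measure.integrable_const_bound[where B="norm x"])
  show "AE g in ball_measure. norm (max 0 (x \<bullet> g)) \<le> norm x"
    using AE_ball_measure
  proof eventually_elim
    case (elim g)
    have "\<bar>x \<bullet> g\<bar> \<le> norm x * norm g" by (rule Cauchy_Schwarz_ineq2)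
    also have "\<dots> \<le> norm x" using elim by (simp add: mult_left_le)
    finally show ?case by simp
  qed
qed measurable

text \<open>The mean is invariant under orthogonal maps and positively homogeneous in
  \<open>x\<close>, hence a multiple of the norm. Only the existence and the sign of
  \<open>c\<close> matter later.\<close>

lemma mean_positive_part:
  obtains c where "c > 0" "\<And>x::real^'n. (\<integral>g. max 0 (x \<bullet> g) \<partial>ball_measure) = c * norm x"
proof -
  define e :: "real^'n" where "e = axis undefined 1"
  have ne: "norm e = 1" by (simp add: e_def)
  define c where "c = (\<integral>g. max 0 (e \<bullet> g) \<partial>ball_measure)"
  have eq: "(\<integral>g. max 0 (x \<bullet> g) \<partial>ball_measure) = c * norm x" for x :: "real^'n"
  proof -
    obtain f where f: "orthogonal_transformation f" "f (norm x *\<^sub>R e) = x"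
      using orthogonal_transformation_exists[of "norm x *\<^sub>R e" x] ne by auto
    have [measurable]: "f \<in> borel_measurable borel"
      using f by (intro borel_measurable_linear) (simp add: orthogonal_transformation)
    have "(\<integral>g. max 0 (x \<bullet> g) \<partial>ball_measure) = (\<integral>g. max 0 (x \<bullet> g) \<partial>distr ball_measure borel f)"
      by (simp add: distr_ball_measure[OF f(1)])
    also have "\<dots> = (\<integral>g. max 0 (f (norm x *\<^sub>R e) \<bullet> f g) \<partial>ball_measure)"
      by (subst integral_distr) (auto simp: f(2))
    also have "(\<lambda>g. max 0 (f (norm x *\<^sub>R e) \<bullet> f g)) = (\<lambda>g. norm x * max 0 (e \<bullet> g))"
      using f(1) by (auto simp: orthogonal_transformation_def max_def mult_le_0_iff zero_le_mult_iff)
    finally show ?thesis by (simp add: c_def mult.commute)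
  qed
  have "c \<noteq> 0"
  proof
    assume "c = 0"
    then have "AE g in ball_measure. max 0 (e \<bullet> g) = 0"
      unfolding c_def by (subst (asm) integral_nonneg_eq_0_iff_AE[OF integrable_ball_measure_max_inner]) auto
    then have "AE g in lborel. g \<in> cball 0 1 \<longrightarrow> max 0 (e \<bullet> g) = 0"
      by (subst (asm) AE_uniform_measure) (simp_all add: emeasure_unit_cball)
    \<comment> \<open>The ball with centre \<open>e / 2\<close> and radius \<open>1 / 2\<close> lies
      both in the unit ball and in the open half-space where the integrand is positive, so it would
      have to be a null set.\<close>
    then have "AE g in lborel. g \<notin> ball (e /\<^sub>R 2) (1/2)"
    proof eventually_elim
      case (elim g)
      show ?case
      proof
        assume "g \<in> ball (e /\<^sub>R 2) (1/2)"
        then have d: "norm (e /\<^sub>R 2 - g) < 1/2" by (simp add: dist_norm)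
        have "norm g \<le> norm (e /\<^sub>R 2) + norm (g - e /\<^sub>R 2)" by (metis add.commute diff_add_cancel norm_triangle_ineq)
        with d have g1: "norm g \<le> 1" by (simp add: ne norm_minus_commute)
        have "\<bar>e \<bullet> (e /\<^sub>R 2 - g)\<bar> < 1/2"
          using Cauchy_Schwarz_ineq2[of e "e /\<^sub>R 2 - g"] d by (simp add: ne)
        then have "e \<bullet> (e /\<^sub>R 2 - g) < 1/2" by (rule abs_less_iff[THEN iffD1, THEN conjunct1])
        moreover have "e \<bullet> (e /\<^sub>R 2 - g) = 1/2 - e \<bullet> g"
          using ne by (simp add: inner_diff_right dot_square_norm)
        ultimately have "e \<bullet> g > 0" by linarith
        with g1 show False using elim by simp
      qed
    qed
    then have "emeasure lborel (ball (e /\<^sub>R 2) (1/2)) = 0"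
      using AE_iff_measurable[of "ball (e /\<^sub>R 2) (1/2)" lborel "\<lambda>g. g \<notin> ball (e /\<^sub>R 2) (1/2)"] by (simp del: mem_ball)
    then show False by (simp add: emeasure_ball)
  qed
  moreover have "c \<ge> 0" unfolding c_def by (intro Bochner_Integration.integral_nonneg) auto
  ultimately have "c > 0" by simp
  then show thesis using eq that by blast
qed

section \<open>Adding segments and balls to convex bodies\<close>

abbreviation vol :: "'a::euclidean_space set \<Rightarrow> real" where
  "vol \<equiv> measure lborel"

lemma compact_set_plus:
  fixes A B :: "'a::real_normed_vector set"
  assumes "compact A" "compact B"
  shows "compact (A + B)"
proof -
  have "A + B = {x + y | x y. x \<in> A \<and> y \<in> B}" by (auto simp: set_plus_def)
  then show ?thesis using compact_sums[OF assms] by simp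
qed

lemma in_segment_0:
  fixes v :: "'a::real_vector"
  shows "x \<in> closed_segment 0 v \<longleftrightarrow> (\<exists>s. 0 \<le> s \<and> s \<le> 1 \<and> x = s *\<^sub>R v)"
  by (auto simp: in_segment)

lemma in_plus_segment:
  fixes v :: "'a::real_vector"
  shows "x \<in> A + closed_segment 0 v \<longleftrightarrow> (\<exists>a\<in>A. \<exists>s. 0 \<le> s \<and> s \<le> 1 \<and> x = a + s *\<^sub>R v)"
  by (simp only: set_plus_def mem_Collect_eq Bex_def in_segment_0) blast

lemma in_plus_cball:
  fixes M :: "'a::euclidean_space set"
  assumes M: "closed M" "M \<noteq> {}"
  shows "x \<in> M + cball 0 t \<longleftrightarrow> infdist x M \<le> t"
proof
  assume "x \<in> M + cball 0 t"
  then obtain a b where "a \<in> M" "norm b \<le> t" "x = a + b" by (auto simp: set_plus_def)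
  then show "infdist x M \<le> t" using infdist_le2[of a M x t] by (simp add: dist_norm)
next
  assume *: "infdist x M \<le> t"
  obtain a where a: "a \<in> M" "infdist x M = dist x a" using infdist_attains_inf[OF M] by blast
  then have "x = a + (x - a)" "x - a \<in> cball 0 t" using * by (simp_all add: dist_norm norm_minus_commute)
  with a(1) show "x \<in> M + cball 0 t" by (metis set_plus_intro)
qed

lemma emeasure_lborel_translate:
  fixes A :: "'a::euclidean_space set"
  assumes "A \<in> sets borel"
  shows "emeasure lborel ((+) c ` A) = emeasure lborel A"
proof -
  have "(+) c ` A = (+) (- c) -` A" by (force simp: image_iff)
  then have "emeasure lborel ((+) c ` A) = emeasure (distr lborel borel ((+) (-c))) A"
    using assms by (simp add: emeasure_distr)
  then show ?thesis by (simp add: lborel_distr_plus)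
qed

lemma vol_translate:
  fixes A :: "'a::euclidean_space set"
  assumes "A \<in> sets borel"
  shows "vol ((+) c ` A) = vol A"
  by (simp add: measure_def emeasure_lborel_translate[OF assms])

lemma vol_mono: "A \<subseteq> B \<Longrightarrow> compact A \<Longrightarrow> compact B \<Longrightarrow> vol A \<le> vol B"
  by (intro measure_mono_fmeasurable fmeasurable_compact) (auto dest: compact_imp_closed)

text \<open>The two translated pieces of the longer sum meet in a translate of \<open>A\<close>, by convexity.\<close>

lemma vol_plus_segment_add:
  fixes A :: "'a::euclidean_space set"
  assumes A: "compact A" "convex A" and s: "0 \<le> s" and r: "0 \<le> r"
  shows "vol (A + closed_segment 0 ((s + r) *\<^sub>R v)) =
    vol (A + closed_segment 0 (s *\<^sub>R v)) + vol (A + closed_segment 0 (r *\<^sub>R v)) - vol A"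
proof -
  let ?S = "\<lambda>s. A + closed_segment 0 (s *\<^sub>R v)"
  have mem: "x \<in> ?S s \<longleftrightarrow> (\<exists>a\<in>A. \<exists>t. 0 \<le> t \<and> t \<le> s \<and> x = a + t *\<^sub>R v)" if "0 \<le> s" for s x
  proof
    assume "x \<in> ?S s"
    then obtain a t where "a \<in> A" "0 \<le> t" "t \<le> 1" "x = a + (t * s) *\<^sub>R v" unfolding in_plus_segment by auto
    with that show "\<exists>a\<in>A. \<exists>t. 0 \<le> t \<and> t \<le> s \<and> x = a + t *\<^sub>R v"
      by (intro bexI[of _ a] exI[of _ "t * s"]) (auto simp: mult_left_le_one_le)
  next
    assume "\<exists>a\<in>A. \<exists>t. 0 \<le> t \<and> t \<le> s \<and> x = a + t *\<^sub>R v"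
    then obtain a t where *: "a \<in> A" "0 \<le> t" "t \<le> s" "x = a + t *\<^sub>R v" by auto
    show "x \<in> ?S s" unfolding in_plus_segment using *
      by (intro bexI[of _ a] exI[of _ "t / s"]) (auto simp: divide_le_eq_1)
  qed
  have comp: "compact (?S s)" for s using A by (intro compact_set_plus) auto
  have Un: "?S (s + r) = ?S s \<union> (+) (s *\<^sub>R v) ` ?S r"
  proof (intro equalityI subsetI)
    fix x assume "x \<in> ?S (s + r)"
    then obtain a t where *: "a \<in> A" "0 \<le> t" "t \<le> s + r" "x = a + t *\<^sub>R v" using mem[of "s + r"] s r by auto
    show "x \<in> ?S s \<union> (+) (s *\<^sub>R v) ` ?S r"
    proof (cases "t \<le> s")
      case True then show ?thesis using * mem[OF s] by blast
    next
      case False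
      then have "a + (t - s) *\<^sub>R v \<in> ?S r"
        using * by (intro mem[OF r, THEN iffD2] bexI[of _ a] exI[of _ "t - s"]) auto
      moreover have "x = s *\<^sub>R v + (a + (t - s) *\<^sub>R v)" using * by (simp add: algebra_simps)
      ultimately show ?thesis by blast
    qed
  next
    fix x assume "x \<in> ?S s \<union> (+) (s *\<^sub>R v) ` ?S r"
    then show "x \<in> ?S (s + r)"
    proof
      assume "x \<in> ?S s"
      then obtain a t where "a \<in> A" "0 \<le> t" "t \<le> s" "x = a + t *\<^sub>R v" using mem[OF s] by auto
      then show ?thesis using mem[of "s + r"] s r by (intro mem[THEN iffD2]) (auto intro!: bexI[of _ a] exI[of _ t])
    next
      assume "x \<in> (+) (s *\<^sub>R v) ` ?S r"
      then obtain a t where "a \<in> A" "0 \<le> t" "t \<le> r" "x = s *\<^sub>R v + (a + t *\<^sub>R v)" using mem[OF r] by auto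
      then show ?thesis using s r
        by (intro mem[THEN iffD2]) (auto intro!: bexI[of _ a] exI[of _ "s + t"] simp: algebra_simps)
    qed
  qed
  \<comment> \<open>A common point, moved back by \<open>s *\<^sub>R v\<close>, lies on a line in
    the direction \<open>v\<close> between a point of \<open>A\<close> ahead of it and one behind
    it.\<close>
  have Int: "?S s \<inter> (+) (s *\<^sub>R v) ` ?S r = (+) (s *\<^sub>R v) ` A"
  proof (intro equalityI subsetI)
    fix x assume "x \<in> ?S s \<inter> (+) (s *\<^sub>R v) ` ?S r"
    then obtain a t b q where *: "a \<in> A" "0 \<le> t" "t \<le> s" "x = a + t *\<^sub>R v"
      "b \<in> A" "0 \<le> q" "q \<le> r" "x = s *\<^sub>R v + (b + q *\<^sub>R v)" using mem[OF r] mem[OF s] by auto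
    define z where "z = x - s *\<^sub>R v"
    have za: "a = z + (s - t) *\<^sub>R v"
      unfolding z_def *(4) by (simp add: algebra_simps)
    have zb: "b = z - q *\<^sub>R v"
      unfolding z_def *(8) by (simp add: algebra_simps)
    have "z \<in> A"
    proof (cases "q + (s - t) = 0")
      case True
      then have "s - t = 0" using *(3,6) by linarith
      then show ?thesis using za *(1) by simp
    next
      case False
      then have pos: "q + (s - t) > 0" using *(3,6) by linarith
      \<comment> \<open>The weight for which the displacements \<open>s - t\<close> of
        \<open>a\<close> and \<open>- q\<close> of \<open>b\<close> from \<open>z\<close>
        cancel.\<close>
      define l where "l = q / (q + (s - t))"
      have l: "0 \<le> l" "l \<le> 1" using pos *(3,6) by (auto simp: l_def)
      have "l *\<^sub>R a + (1 - l) *\<^sub>R b = z + (l * (s - t) - (1 - l) * q) *\<^sub>R v"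
        unfolding za zb by (simp add: algebra_simps)
      also have "l * (s - t) - (1 - l) * q = 0" using pos by (simp add: l_def field_simps)
      finally have "l *\<^sub>R a + (1 - l) *\<^sub>R b = z" by simp
      moreover have "l *\<^sub>R a + (1 - l) *\<^sub>R b \<in> A" using A(2) *(1,5) l by (intro convexD) auto
      ultimately show ?thesis by simp
    qed
    then show "x \<in> (+) (s *\<^sub>R v) ` A" by (auto simp: z_def image_iff intro!: bexI[of _ z])
  next
    fix x assume "x \<in> (+) (s *\<^sub>R v) ` A"
    then obtain a where a: "a \<in> A" "x = s *\<^sub>R v + a" by auto
    have "x \<in> ?S s" using a s by (intro mem[THEN iffD2]) (auto intro!: bexI[of _ a] exI[of _ s])
    moreover have "a \<in> ?S r" using a r by (intro mem[THEN iffD2]) (auto intro!: bexI[of _ a] exI[of _ 0])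
    ultimately show "x \<in> ?S s \<inter> (+) (s *\<^sub>R v) ` ?S r" using a by blast
  qed
  have "vol (?S (s + r)) = vol (?S s) + vol ((+) (s *\<^sub>R v) ` ?S r) - vol ((+) (s *\<^sub>R v) ` A)"
    unfolding Un Int[symmetric]
    by (rule measure_Un3; intro fmeasurable_compact comp compact_translation)
  then show ?thesis
    unfolding vol_translate[OF borel_compact[OF comp]] vol_translate[OF borel_compact[OF A(1)]] .
qed

text \<open>Exact linearity is what makes the later differentiation work: the increment for
  \<open>g\<close> is \<open>N\<close> times the increment for \<open>g / N\<close>, for every
  \<open>N\<close>, so a one-sided derivative recovers the finite increment.\<close>

lemma vol_plus_segment_scale:
  fixes A :: "'a::euclidean_space set"
  assumes A: "compact A" "convex A"
  shows "vol (A + closed_segment 0 (real N *\<^sub>R v)) - vol A = real N * (vol (A + closed_segment 0 v) - vol A)"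
proof (induction N)
  case 0
  have "A + {0} = A" by (metis add.right_neutral set_zero)
  then show ?case by (simp only: of_nat_0 scaleR_zero_left closed_segment_idem diff_self mult_zero_left)
next
  case (Suc N)
  have eq: "real (Suc N) = real N + 1" by simp
  have "vol (A + closed_segment 0 ((real N + 1) *\<^sub>R v)) =
      vol (A + closed_segment 0 (real N *\<^sub>R v)) + vol (A + closed_segment 0 v) - vol A"
    using vol_plus_segment_add[OF A of_nat_0_le_iff zero_le_one, of N v] unfolding scaleR_one .
  then show ?case unfolding eq distrib_right mult_1_left Suc[symmetric] by linarith
qed

text \<open>Layer-cake formula: a point at distance \<open>s\<close> from \<open>M\<close> belongs
  to the parallel bodies with \<open>s \<le> t \<le> \<epsilon>\<close>, an interval of length
  \<open>\<epsilon> - s\<close>. Volumes are thereby traded for the distance function, which can be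
  differentiated pointwise when \<open>M\<close> is enlarged by a segment.\<close>

lemma integral_vol_parallel:
  fixes M :: "'a::euclidean_space set"
  assumes M: "compact M" "M \<noteq> {}" and \<epsilon>: "\<epsilon> \<ge> 0"
  shows "(\<integral>t. vol (M + cball 0 t) \<partial>density lborel (indicator {0..\<epsilon>})) = (\<integral>x. max 0 (\<epsilon> - infdist x M) \<partial>lborel)"
proof -
  have cl: "closed M" using M compact_imp_closed by blast
  have cball: "M + cball 0 t = {x. infdist x M \<le> t}" for t using in_plus_cball[OF cl M(2)] by auto
  have [measurable]: "(\<lambda>x. infdist x M) \<in> borel_measurable borel"
    by (intro borel_measurable_continuous_onI continuous_intros)
  have comp: "compact {x. infdist x M \<le> t}" for t
    using compact_set_plus[OF M(1) compact_cball] unfolding cball[symmetric] .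
  have em: "ennreal (vol {x. infdist x M \<le> t}) = (\<integral>\<^sup>+x. indicator {x. infdist x M \<le> t} x \<partial>lborel)" for t
  proof -
    have "{x. infdist x M \<le> t} \<in> fmeasurable lborel" by (rule fmeasurable_compact[OF comp])
    then show ?thesis by (simp add: emeasure_eq_measure2)
  qed
  have m: "(\<lambda>t. vol {x. infdist x M \<le> t}) \<in> borel_measurable borel"
  proof -
    have "mono (\<lambda>t. vol {x. infdist x M \<le> t})"
    proof (rule monoI)
      fix s t :: real assume "s \<le> t"
      then show "vol {x. infdist x M \<le> s} \<le> vol {x. infdist x M \<le> t}"
        by (intro vol_mono comp) auto
    qed
    then show ?thesis by (rule borel_measurable_mono)
  qed
  have "(\<integral>t. vol (M + cball 0 t) \<partial>density lborel (indicator {0..\<epsilon>}))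
    = enn2real (\<integral>\<^sup>+t. ennreal (vol (M + cball 0 t)) \<partial>density lborel (indicator {0..\<epsilon>}))"
    using m unfolding cball by (subst integral_eq_nn_integral) auto
  also have "(\<integral>\<^sup>+t. ennreal (vol (M + cball 0 t)) \<partial>density lborel (indicator {0..\<epsilon>}))
    = (\<integral>\<^sup>+t. indicator {0..\<epsilon>} t * ennreal (vol {x. infdist x M \<le> t}) \<partial>lborel)"
    using m unfolding cball by (subst nn_integral_density) (auto simp: cball)
  also have "\<dots> = (\<integral>\<^sup>+t. \<integral>\<^sup>+x. indicator {0..\<epsilon>} t * indicator {x. infdist x M \<le> t} x \<partial>lborel \<partial>lborel)"
    unfolding em by (subst nn_integral_cmult) auto
  also have "\<dots> = (\<integral>\<^sup>+t. \<integral>\<^sup>+x. (if 0 \<le> t \<and> t \<le> \<epsilon> \<and> infdist x M \<le> t then 1 else 0) \<partial>lborel \<partial>lborel)"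
    by (intro nn_integral_cong) (auto simp: indicator_def)
  also have "\<dots> = (\<integral>\<^sup>+x. \<integral>\<^sup>+t. (if 0 \<le> t \<and> t \<le> \<epsilon> \<and> infdist x M \<le> t then 1 else 0) \<partial>lborel \<partial>lborel)"
    by (rule lborel_pair.Fubini') measurable
  also have "\<dots> = (\<integral>\<^sup>+x. ennreal (max 0 (\<epsilon> - infdist x M)) \<partial>lborel)"
  proof (rule nn_integral_cong)
    fix x
    have "(\<integral>\<^sup>+t. (if 0 \<le> t \<and> t \<le> \<epsilon> \<and> infdist x M \<le> t then 1 else 0) \<partial>lborel) = (\<integral>\<^sup>+t. indicator {infdist x M..\<epsilon>} t \<partial>lborel)"
      using infdist_nonneg[of x M] by (intro nn_integral_cong) (auto simp: indicator_def)
    also have "\<dots> = ennreal (max 0 (\<epsilon> - infdist x M))"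
      by (auto simp: max_def)
    finally show "(\<integral>\<^sup>+t. (if 0 \<le> t \<and> t \<le> \<epsilon> \<and> infdist x M \<le> t then 1 else 0) \<partial>lborel) = ennreal (max 0 (\<epsilon> - infdist x M))" .
  qed
  finally show ?thesis by (subst integral_eq_nn_integral) auto
qed

lemma integrable_parallel_height:
  fixes M :: "'a::euclidean_space set"
  assumes M: "compact M" "M \<noteq> {}" and \<epsilon>: "\<epsilon> \<ge> 0"
  shows "integrable lborel (\<lambda>x. max 0 (\<epsilon> - infdist x M))"
proof -
  have [measurable]: "(\<lambda>x. infdist x M) \<in> borel_measurable borel"
    by (intro borel_measurable_continuous_onI continuous_intros)
  have cl: "closed M" using M compact_imp_closed by blast
  show ?thesis
  proof (rule Bochner_Integration.integrable_bound[where f="\<lambda>x. \<epsilon> * indicator (M + cball 0 \<epsilon>) x"])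
    have "M + cball 0 \<epsilon> \<in> fmeasurable lborel" using M(1) by (intro fmeasurable_compact compact_set_plus compact_cball)
    then show "integrable lborel (\<lambda>x. \<epsilon> * indicator (M + cball 0 \<epsilon>) x)"
      by (intro integrable_mult_right integrable_real_indicator) (auto simp: fmeasurable_def)
    show "AE x in lborel. norm (max 0 (\<epsilon> - infdist x M)) \<le> norm (\<epsilon> * indicator (M + cball 0 \<epsilon>) x)"
      using \<epsilon> infdist_nonneg[of _ M] by (auto simp: indicator_def in_plus_cball[OF cl M(2)] intro!: AE_I2)
  qed measurable
qed

section \<open>Cauchy's surface area formula\<close>

text \<open>Together with the next lemma: the distance from \<open>x\<close> to
  \<open>L + closed_segment 0 v\<close> is the minimum over \<open>0 \<le> s \<le> 1\<close> of the
  distance from \<open>x - s *\<^sub>R v\<close> to \<open>L\<close>.\<close>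

lemma infdist_plus_segment_le:
  fixes L :: "'a::euclidean_space set"
  assumes L: "L \<noteq> {}" and s: "0 \<le> s" "s \<le> 1"
  shows "infdist x (L + closed_segment 0 v) \<le> infdist (x - s *\<^sub>R v) L"
  unfolding infdist_notempty[OF L]
proof (rule cINF_greatest[OF L])
  fix a assume "a \<in> L"
  then have "a + s *\<^sub>R v \<in> L + closed_segment 0 v"
    unfolding in_plus_segment using s by blast
  then have "infdist x (L + closed_segment 0 v) \<le> dist x (a + s *\<^sub>R v)" by (rule infdist_le)
  also have "\<dots> = dist (x - s *\<^sub>R v) a" by (simp add: dist_norm algebra_simps)
  finally show "infdist x (L + closed_segment 0 v) \<le> dist (x - s *\<^sub>R v) a" .
qed

lemma infdist_plus_segment_attained:
  fixes L :: "'a::euclidean_space set"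
  assumes L: "compact L" "L \<noteq> {}"
  obtains s where "0 \<le> s" "s \<le> 1" "infdist (x - s *\<^sub>R v) L \<le> infdist x (L + closed_segment 0 v)"
proof -
  have "closed (L + closed_segment 0 v)" by (intro compact_imp_closed compact_set_plus L compact_segment)
  moreover have "L + closed_segment 0 v \<noteq> {}"
    using L(2) unfolding set_plus_def by blast
  ultimately obtain y where y: "y \<in> L + closed_segment 0 v" "infdist x (L + closed_segment 0 v) = dist x y"
    using infdist_attains_inf by blast
  then obtain a s where as: "a \<in> L" "0 \<le> s" "s \<le> 1" "y = a + s *\<^sub>R v" unfolding in_plus_segment by blast
  have "infdist (x - s *\<^sub>R v) L \<le> dist (x - s *\<^sub>R v) a" using as(1) by (rule infdist_le)
  also have "\<dots> = dist x y" using as(4) by (simp add: dist_norm algebra_simps)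
  finally show thesis using that as y(2) by simp
qed

text \<open>The square root lies below its tangents: \<open>norm (w - v)\<close> is the root of
  \<open>(norm w)\<^sup>2 + 2 * norm w * c\<close>, which is at most
  \<open>norm w + c\<close>.\<close>

lemma norm_diff_upper:
  fixes w v :: "'a::real_inner"
  assumes "w \<noteq> 0"
  shows "norm (w - v) \<le> norm w - (w \<bullet> v) / norm w + (norm v)\<^sup>2 / (2 * norm w)"
proof (rule power2_le_imp_le)
  define c where "c = - (w \<bullet> v) / norm w + (norm v)\<^sup>2 / (2 * norm w)"
  have p: "norm w > 0" using assms by simp
  have e: "(norm (w - v))\<^sup>2 = (norm w)\<^sup>2 + 2 * norm w * c"
    using p by (simp add: c_def power2_norm_eq_inner inner_diff inner_commute field_simps)
  \<comment> \<open>Comparing squares requires \<open>0 \<le> norm w + c\<close>. This is the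
    average of \<open>norm w\<close> and \<open>norm w + 2 * c\<close>, and the latter is
    nonnegative because its product with \<open>norm w\<close> is a square.\<close>
  have "0 \<le> (norm w)\<^sup>2 + 2 * norm w * c" using e[symmetric] by simp
  then have "0 \<le> norm w * (norm w + 2 * c)" by (simp add: power2_eq_square algebra_simps)
  then have "0 \<le> norm w + 2 * c" using p by (simp add: zero_le_mult_iff)
  then have "0 \<le> norm w + c" using p by linarith
  then show "0 \<le> norm w - (w \<bullet> v) / norm w + (norm v)\<^sup>2 / (2 * norm w)" by (simp add: c_def)
  have "(norm (w - v))\<^sup>2 \<le> (norm w + c)\<^sup>2" using e by (simp add: power2_sum)
  then show "(norm (w - v))\<^sup>2 \<le> (norm w - (w \<bullet> v) / norm w + (norm v)\<^sup>2 / (2 * norm w))\<^sup>2"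
    by (simp add: c_def algebra_simps)
qed

text \<open>Off a closed set \<open>L\<close> this is a unit vector. On \<open>L\<close> the value
  is \<open>0\<close> by the convention for division, and the integrals below use it only where
  \<open>infdist x L > 0\<close>.\<close>

definition dist_grad :: "'a::euclidean_space set \<Rightarrow> 'a \<Rightarrow> 'a" where
  "dist_grad L x = (x - closest_point L x) /\<^sub>R infdist x L"

lemma infdist_closest_point:
  fixes L :: "'a::euclidean_space set"
  assumes "closed L" "L \<noteq> {}"
  shows "infdist x L = norm (x - closest_point L x)"
  using setdist_closest_point[OF assms, of x] assms by (simp add: infdist_eq_setdist dist_norm)

text \<open>The distance function is squeezed between the distance to a supporting half-space and
  the distance to the nearest point; both have the gradient \<open>dist_grad\<close>.\<close>

lemma infdist_plus_segment_decrease: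
  fixes L :: "'a::euclidean_space set"
  assumes L: "compact L" "convex L" "L \<noteq> {}" and x: "infdist x L > 0"
  shows "infdist x L - infdist x (L + closed_segment 0 v) \<le> max 0 (dist_grad L x \<bullet> v)"
    and "infdist x L - infdist x (L + closed_segment 0 v)
           \<ge> max 0 (dist_grad L x \<bullet> v - (norm v)\<^sup>2 / (2 * infdist x L))"
proof -
  have cl: "closed L" using L compact_imp_closed by blast
  define p where "p = closest_point L x"
  define w where "w = x - p"
  have p: "p \<in> L" unfolding p_def by (rule closest_point_in_set[OF cl L(3)])
  have d: "infdist x L = norm w" unfolding w_def p_def by (rule infdist_closest_point[OF cl L(3)])
  have w0: "w \<noteq> 0" "norm w > 0" using x d by auto
  have u: "dist_grad L x = w /\<^sub>R norm w" by (simp add: dist_grad_def d w_def p_def[symmetric])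
  obtain s where s: "0 \<le> s" "s \<le> 1" "infdist (x - s *\<^sub>R v) L \<le> infdist x (L + closed_segment 0 v)"
    using infdist_plus_segment_attained[OF L(1,3)] .
  obtain a where a: "a \<in> L" "infdist (x - s *\<^sub>R v) L = dist (x - s *\<^sub>R v) a"
    using infdist_attains_inf[OF cl L(3)] by blast
  have "w \<bullet> (a - p) \<le> 0" unfolding w_def p_def by (rule closest_point_dot[OF L(2) cl a(1)])
  moreover have "w \<bullet> (x - s *\<^sub>R v - a) \<le> norm w * norm (x - s *\<^sub>R v - a)" by (rule norm_cauchy_schwarz)
  moreover have "w \<bullet> (x - s *\<^sub>R v - a) = w \<bullet> w - s * (w \<bullet> v) - w \<bullet> (a - p)"
    by (simp add: w_def inner_diff_right)
  ultimately have "norm w * norm w - s * (w \<bullet> v) \<le> norm w * infdist (x - s *\<^sub>R v) L"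
    by (simp add: a(2) dist_norm dot_square_norm power2_eq_square)
  then have "norm w * (norm w - infdist (x - s *\<^sub>R v) L) \<le> s * (w \<bullet> v)" by (simp add: algebra_simps)
  then have "norm w - infdist (x - s *\<^sub>R v) L \<le> s * (w \<bullet> v) / norm w"
    using w0 by (simp add: pos_le_divide_eq mult.commute)
  also have "\<dots> = s * (dist_grad L x \<bullet> v)" by (simp add: u divide_inverse)
  also have "\<dots> \<le> s * max 0 (dist_grad L x \<bullet> v)" using s by (intro mult_left_mono) auto
  also have "\<dots> \<le> max 0 (dist_grad L x \<bullet> v)" using s by (intro mult_left_le_one_le) auto
  finally show "infdist x L - infdist x (L + closed_segment 0 v) \<le> max 0 (dist_grad L x \<bullet> v)"
    using s(3) d by linarith
  \<comment> \<open>For the lower bound on the decrease only the shifts \<open>s = 0\<close> and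
    \<open>s = 1\<close> are tried, the latter with the nearest point \<open>p\<close> as competitor
    in \<open>L\<close>; they give the two entries of the maximum.\<close>
  have "infdist x (L + closed_segment 0 v) \<le> infdist x L"
    using infdist_plus_segment_le[OF L(3), of 0 x v] by simp
  moreover have "infdist x (L + closed_segment 0 v) \<le> norm (w - v)"
  proof -
    have "infdist x (L + closed_segment 0 v) \<le> infdist (x - v) L"
      using infdist_plus_segment_le[OF L(3), of 1 x v] by simp
    also have "\<dots> \<le> dist (x - v) p" using p by (rule infdist_le)
    also have "\<dots> = norm (w - v)" by (simp add: dist_norm w_def algebra_simps)
    finally show ?thesis .
  qed
  moreover have "norm (w - v) \<le> norm w - dist_grad L x \<bullet> v + (norm v)\<^sup>2 / (2 * infdist x L)"
  proof -
    have "dist_grad L x \<bullet> v = (w \<bullet> v) / norm w" by (simp add: u divide_inverse)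
    then show ?thesis unfolding d using norm_diff_upper[OF w0(1), of v] by (simp only:)
  qed
  ultimately show "infdist x L - infdist x (L + closed_segment 0 v)
           \<ge> max 0 (dist_grad L x \<bullet> v - (norm v)\<^sup>2 / (2 * infdist x L))"
    using d by (simp add: max_def)
qed

text \<open>A segment can only decrease the distance, so the one-sided limit exists also where
  \<open>infdist x L = \<epsilon>\<close> and the truncation at \<open>0\<close> has a kink. This is
  why the outer boundary belongs to the shell in the limit. On \<open>L\<close> the distance stays
  \<open>0\<close>, and beyond distance \<epsilon> both heights eventually vanish.\<close>

lemma tendsto_scaled_parallel_height:
  fixes L :: "'a::euclidean_space set"
  assumes L: "compact L" "convex L" "L \<noteq> {}"
  shows "(\<lambda>N. real (Suc N) * (max 0 (\<epsilon> - infdist x (L + closed_segment 0 (g /\<^sub>R real (Suc N)))) - max 0 (\<epsilon> - infdist x L)))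
    \<longlonglongrightarrow> (if 0 < infdist x L \<and> infdist x L \<le> \<epsilon> then max 0 (dist_grad L x \<bullet> g) else 0)"
    (is "?h \<longlonglongrightarrow> ?l")
proof -
  let ?m = "\<lambda>N. infdist x (L + closed_segment 0 (g /\<^sub>R real (Suc N)))"
  have le: "?m N \<le> infdist x L" for N
    using infdist_plus_segment_le[OF L(3), of 0 x] by simp
  consider "infdist x L = 0" | "infdist x L > \<epsilon>" "infdist x L > 0" | "0 < infdist x L" "infdist x L \<le> \<epsilon>"
    using infdist_nonneg[of x L] by linarith
  then show ?thesis
  proof cases
    case 1
    then have "?m N = 0" for N using le[of N] infdist_nonneg by (metis order_antisym)
    with 1 show ?thesis by simp
  next
    case 2
    have lim: "(\<lambda>N. norm g / real (Suc N)) \<longlonglongrightarrow> 0"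
      by (rule LIMSEQ_Suc) (rule lim_const_over_n)
    have "\<forall>\<^sub>F N in sequentially. norm g / real (Suc N) < infdist x L - \<epsilon>"
      using order_tendstoD(2)[OF lim] 2 by auto
    then have "\<forall>\<^sub>F N in sequentially. ?h N = 0"
    proof eventually_elim
      case (elim N)
      obtain s where s: "0 \<le> s" "s \<le> 1" "infdist (x - s *\<^sub>R (g /\<^sub>R real (Suc N))) L \<le> ?m N"
        using infdist_plus_segment_attained[OF L(1,3)] .
      have "infdist x L \<le> infdist (x - s *\<^sub>R (g /\<^sub>R real (Suc N))) L + dist x (x - s *\<^sub>R (g /\<^sub>R real (Suc N)))"
        by (rule infdist_triangle)
      also have "dist x (x - s *\<^sub>R (g /\<^sub>R real (Suc N))) = s * (norm g / real (Suc N))"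
        using s by (simp add: dist_norm divide_inverse)
      also have "\<dots> \<le> norm g / real (Suc N)" using s by (intro mult_left_le_one_le) auto
      finally have "?m N > \<epsilon>" using elim s(3) by linarith
      with 2 show ?case by simp
    qed
    with 2 show ?thesis by (simp add: tendsto_eventually)
  next
    case 3
    define \<delta> where "\<delta> = infdist x L"
    have \<delta>: "\<delta> > 0" using 3 by (simp add: \<delta>_def)
    have h: "?h N = real (Suc N) * (\<delta> - ?m N)" for N
      using 3 le[of N] by (simp add: \<delta>_def max_def)
    have scale: "real (Suc N) * max 0 z = max 0 (real (Suc N) * z)" for N z
      by (simp add: max_def mult_le_0_iff zero_le_mult_iff)
    have inner: "real (Suc N) * (dist_grad L x \<bullet> (g /\<^sub>R real (Suc N))) = dist_grad L x \<bullet> g" for N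
      by (simp del: of_nat_Suc)
    have quad: "real (Suc N) * ((norm (g /\<^sub>R real (Suc N)))\<^sup>2 / (2 * \<delta>)) = ((norm g)\<^sup>2 / (2 * \<delta>)) / real (Suc N)" for N
      using \<delta> by (simp add: field_simps power2_eq_square del: of_nat_Suc)
    have up: "?h N \<le> max 0 (dist_grad L x \<bullet> g)" for N
    proof -
      have "?h N \<le> real (Suc N) * max 0 (dist_grad L x \<bullet> (g /\<^sub>R real (Suc N)))"
        unfolding h \<delta>_def by (intro mult_left_mono infdist_plus_segment_decrease L 3) auto
      then show ?thesis unfolding scale inner .
    qed
    have lo: "?h N \<ge> max 0 (dist_grad L x \<bullet> g - ((norm g)\<^sup>2 / (2 * \<delta>)) / real (Suc N))" for N
    proof -
      have "?h N \<ge> real (Suc N) * max 0 (dist_grad L x \<bullet> (g /\<^sub>R real (Suc N)) - (norm (g /\<^sub>R real (Suc N)))\<^sup>2 / (2 * \<delta>))"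
        unfolding h \<delta>_def by (intro mult_left_mono infdist_plus_segment_decrease L 3) auto
      then show ?thesis unfolding scale right_diff_distrib inner quad .
    qed
    have "(\<lambda>N. max 0 (dist_grad L x \<bullet> g - ((norm g)\<^sup>2 / (2 * \<delta>)) / real (Suc N))) \<longlonglongrightarrow> max 0 (dist_grad L x \<bullet> g - 0)"
      by (intro tendsto_intros LIMSEQ_Suc[OF lim_const_over_n])
    then have "?h \<longlonglongrightarrow> max 0 (dist_grad L x \<bullet> g)"
      using up lo by (intro tendsto_sandwich[of "\<lambda>N. max 0 (dist_grad L x \<bullet> g - ((norm g)\<^sup>2 / (2 * \<delta>)) / real (Suc N))" ?h sequentially "\<lambda>_. max 0 (dist_grad L x \<bullet> g)"]) auto
    then show ?thesis using 3 by simp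
  qed
qed

lemma borel_measurable_infdist [measurable]:
  "(\<lambda>x::'a::euclidean_space. infdist x L) \<in> borel_measurable borel"
  by (intro borel_measurable_continuous_onI continuous_intros)

lemma borel_measurable_dist_grad:
  fixes L :: "'a::euclidean_space set"
  assumes L: "compact L" "convex L" "L \<noteq> {}"
  shows "dist_grad L \<in> borel_measurable borel"
proof -
  have [measurable]: "closest_point L \<in> borel_measurable borel"
    using L by (intro borel_measurable_continuous_onI continuous_on_closest_point compact_imp_closed)
  show ?thesis unfolding dist_grad_def[abs_def] by measurable
qed

lemma finite_measure_density_Icc: "finite_measure (density lborel (indicator {a..b::real}))"
proof (rule finite_measureI)
  have "emeasure lborel {a..b} \<noteq> top" by (cases "a \<le> b") auto
  then show "emeasure (density lborel (indicator {a..b})) (space (density lborel (indicator {a..b}))) \<noteq> \<infinity>"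
    by (simp add: emeasure_density)
qed

text \<open>The integral of the difference quotient \<open>?h N\<close> does not depend on
  \<open>N\<close>, by linearity of the growth under segments. Dominated convergence therefore
  identifies this constant with the integral of the pointwise limit.\<close>

lemma integral_segment_growth:
  fixes L :: "'a::euclidean_space set"
  assumes L: "compact L" "convex L" "L \<noteq> {}" and \<epsilon>: "\<epsilon> \<ge> 0"
  shows "(\<integral>t. vol (L + cball 0 t + closed_segment 0 g) - vol (L + cball 0 t) \<partial>density lborel (indicator {0..\<epsilon>}))
     = (\<integral>x. (if 0 < infdist x L \<and> infdist x L \<le> \<epsilon> then max 0 (dist_grad L x \<bullet> g) else 0) \<partial>lborel)"
    and "integrable lborel (\<lambda>x. if 0 < infdist x L \<and> infdist x L \<le> \<epsilon> then max 0 (dist_grad L x \<bullet> g) else 0)"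
proof -
  let ?lam = "density lborel (indicator {0..\<epsilon>}) :: real measure"
  define I where "I = (\<integral>t. vol (L + cball 0 t + closed_segment 0 g) - vol (L + cball 0 t) \<partial>?lam)"
  let ?l = "\<lambda>x. if 0 < infdist x L \<and> infdist x L \<le> \<epsilon> then max 0 (dist_grad L x \<bullet> g) else 0"
  let ?h = "\<lambda>N x. real (Suc N) * (max 0 (\<epsilon> - infdist x (L + closed_segment 0 (g /\<^sub>R real (Suc N)))) - max 0 (\<epsilon> - infdist x L))"
  note [measurable] = borel_measurable_dist_grad[OF L]
  have cl: "closed L" using L compact_imp_closed by blast
  have ne: "L + closed_segment 0 v \<noteq> {}" for v
    using L(3) unfolding set_plus_def by blast
  have compL: "compact (L + closed_segment 0 v)" for v
    by (intro compact_set_plus L compact_segment)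
  have comp: "compact (L + cball 0 t)" for t by (intro compact_set_plus L compact_cball)
  have conv: "convex (L + cball 0 t)" for t by (intro convex_set_plus L convex_cball)
  have comm: "L + cball 0 t + closed_segment 0 v = L + closed_segment 0 v + cball 0 t" for t v
    by (simp only: add.assoc add.commute[of "cball 0 t"])
  have int_mono: "integrable ?lam (\<lambda>t. vol (M + cball 0 t))" if M: "compact M" for M :: "'a set"
  proof -
    have cM: "compact (M + cball 0 t)" for t by (intro compact_set_plus M compact_cball)
    have sub: "M + cball 0 s \<subseteq> M + cball 0 t" if "s \<le> t" for s t
      using that by (intro set_plus_mono2 subset_refl cball_subset_cball_iff[THEN iffD2]) auto
    have "mono (\<lambda>t. vol (M + cball 0 t))"
      by (intro monoI vol_mono sub cM)
    then have [measurable]: "(\<lambda>t. vol (M + cball 0 t)) \<in> borel_measurable borel" by (rule borel_measurable_mono)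
    interpret finite_measure ?lam by (rule finite_measure_density_Icc)
    show ?thesis
    proof (rule integrable_const_bound[where B="vol (M + cball 0 \<epsilon>)"])
      have "AE t in lborel. t \<in> {0..\<epsilon>} \<longrightarrow> vol (M + cball 0 t) \<le> vol (M + cball 0 \<epsilon>)"
        by (intro AE_I2) (auto intro!: vol_mono[OF sub] cM)
      then show "AE t in ?lam. norm (vol (M + cball 0 t)) \<le> vol (M + cball 0 \<epsilon>)"
        by (subst AE_density) (auto simp: indicator_def elim!: eventually_mono)
    qed measurable
  qed
  have eqI: "(\<integral>x. ?h N x \<partial>lborel) = I" for N
  proof -
    let ?v = "g /\<^sub>R real (Suc N)"
    have "(\<integral>x. ?h N x \<partial>lborel) = real (Suc N) * ((\<integral>t. vol (L + closed_segment 0 ?v + cball 0 t) \<partial>?lam) - (\<integral>t. vol (L + cball 0 t) \<partial>?lam))"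
      unfolding integral_mult_right_zero
      by (subst Bochner_Integration.integral_diff)
         (simp_all only: integrable_parallel_height compL ne L \<epsilon> integral_vol_parallel not_False_eq_True)
    also have "\<dots> = (\<integral>t. real (Suc N) * (vol (L + cball 0 t + closed_segment 0 ?v) - vol (L + cball 0 t)) \<partial>?lam)"
      unfolding comm by (subst integral_mult_right_zero, subst Bochner_Integration.integral_diff)
         (simp_all only: int_mono compL L)
    also have "\<dots> = I"
      unfolding I_def
    proof (rule Bochner_Integration.integral_cong[OF refl])
      fix t
      have "real (Suc N) *\<^sub>R ?v = g" by simp
      then show "real (Suc N) * (vol (L + cball 0 t + closed_segment 0 ?v) - vol (L + cball 0 t))
         = vol (L + cball 0 t + closed_segment 0 g) - vol (L + cball 0 t)"
        using vol_plus_segment_scale[OF comp conv, of t "Suc N" ?v] by (simp only:)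
    qed
    finally show ?thesis .
  qed
  \<comment> \<open>The distance function is \<open>1\<close>-Lipschitz, so the quotient is at most
    \<open>norm g\<close>, and it vanishes at points that even the full segment cannot bring within
    distance \<epsilon>.\<close>
  let ?w = "\<lambda>x. norm g * indicator (L + cball 0 (\<epsilon> + norm g)) x :: real"
  have w: "integrable lborel ?w"
    using fmeasurable_compact[OF comp, of "\<epsilon> + norm g"]
    by (intro integrable_mult_right integrable_real_indicator) (auto simp: fmeasurable_def)
  have bound: "norm (?h N x) \<le> ?w x" for N x
  proof -
    let ?v = "g /\<^sub>R real (Suc N)"
    let ?m = "infdist x (L + closed_segment 0 ?v)"
    obtain s where s: "0 \<le> s" "s \<le> 1" "infdist (x - s *\<^sub>R ?v) L \<le> ?m"
      using infdist_plus_segment_attained[OF L(1,3)] .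
    have "infdist x L \<le> infdist (x - s *\<^sub>R ?v) L + dist x (x - s *\<^sub>R ?v)"
      by (rule infdist_triangle)
    also have "dist x (x - s *\<^sub>R ?v) = s * (norm g / real (Suc N))"
      using s by (simp add: dist_norm divide_inverse)
    also have "\<dots> \<le> norm g / real (Suc N)" using s by (intro mult_left_le_one_le) auto
    finally have A: "infdist x L - ?m \<le> norm g / real (Suc N)" using s(3) by linarith
    have B: "?m \<le> infdist x L" using infdist_plus_segment_le[OF L(3), of 0 x ?v] by simp
    let ?D = "max 0 (\<epsilon> - ?m) - max 0 (\<epsilon> - infdist x L)"
    have D0: "0 \<le> ?D" and D1: "?D \<le> norm g / real (Suc N)" using A B by (auto simp: max_def)
    have h0: "0 \<le> ?h N x" using D0 by (intro mult_nonneg_nonneg) auto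
    have "?h N x \<le> norm g" using mult_left_mono[OF D1, of "real (Suc N)"] by simp
    moreover have "?h N x = 0" if "x \<notin> L + cball 0 (\<epsilon> + norm g)"
    proof -
      have "infdist x L > \<epsilon> + norm g" using that in_plus_cball[OF cl L(3)] by auto
      moreover have "norm g / real (Suc N) \<le> norm g" by (simp add: divide_le_eq mult_le_cancel_left1)
      ultimately show ?thesis using A B by (simp add: max_def)
    qed
    ultimately show ?thesis using h0 by (cases "x \<in> L + cball 0 (\<epsilon> + norm g)") auto
  qed
  have m1: "?l \<in> borel_measurable lborel" by measurable
  have m2: "?h N \<in> borel_measurable lborel" for N by measurable
  have lim: "AE x in lborel. (\<lambda>N. ?h N x) \<longlonglongrightarrow> ?l x"
    by (intro AE_I2 tendsto_scaled_parallel_height L)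
  have bd: "AE x in lborel. norm (?h N x) \<le> ?w x" for N by (intro AE_I2 bound)
  show "integrable lborel ?l" by (rule integrable_dominated_convergence[OF m1 m2 w lim bd])
  have "(\<lambda>N. \<integral>x. ?h N x \<partial>lborel) \<longlonglongrightarrow> (\<integral>x. ?l x \<partial>lborel)"
    by (rule integral_dominated_convergence[OF m1 m2 w lim bd])
  then show "I = (\<integral>x. ?l x \<partial>lborel)" unfolding eqI by (simp add: LIMSEQ_const_iff)
qed

definition grad_const :: "'n::finite itself \<Rightarrow> real" where
  "grad_const _ = (SOME c. c > 0 \<and> (\<forall>x::real^'n. (\<integral>g. max 0 (x \<bullet> g) \<partial>ball_measure) = c * norm x))"

lemma grad_const:
  "grad_const TYPE('n) > 0" "(\<integral>g. max 0 (x \<bullet> g) \<partial>ball_measure) = grad_const TYPE('n) * norm (x::real^'n)"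
proof -
  have "\<exists>c. c > 0 \<and> (\<forall>x::real^'n. (\<integral>g. max 0 (x \<bullet> g) \<partial>ball_measure) = c * norm x)"
    using mean_positive_part by metis
  from someI_ex[OF this] show "grad_const TYPE('n::finite) > 0"
    "(\<integral>g. max 0 (x \<bullet> g) \<partial>ball_measure) = grad_const TYPE('n) * norm (x::real^'n)"
    unfolding grad_const_def by blast+
qed

text \<open>Cauchy's surface area formula, integrated over the shell between \<open>L\<close> and its
  parallel body.\<close>

lemma vol_shell:
  fixes L :: "(real^'n) set"
  assumes L: "compact L" "convex L" "L \<noteq> {}" and \<epsilon>: "\<epsilon> \<ge> 0"
  shows "grad_const TYPE('n) * (vol (L + cball 0 \<epsilon>) - vol L) =
    (\<integral>g. (\<integral>t. vol (L + cball 0 t + closed_segment 0 g) - vol (L + cball 0 t) \<partial>density lborel (indicator {0..\<epsilon>})) \<partial>ball_measure)"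
proof -
  let ?l = "\<lambda>x g. if 0 < infdist x L \<and> infdist x L \<le> \<epsilon> then max 0 (dist_grad L x \<bullet> g) else 0"
  let ?S = "{x. 0 < infdist x L \<and> infdist x L \<le> \<epsilon>}"
  note [measurable] = borel_measurable_dist_grad[OF L]
  have cl: "closed L" using L compact_imp_closed by blast
  have pair: "pair_sigma_finite (ball_measure :: (real^'n) measure) lborel"
    by (intro pair_sigma_finite.intro ball_measure.sigma_finite_measure_axioms sigma_finite_lborel)
  have [measurable]: "(\<lambda>(g, x). ennreal (?l x g)) \<in> borel_measurable (ball_measure \<Otimes>\<^sub>M lborel)"
    by measurable
  have "(\<integral>g. (\<integral>t. vol (L + cball 0 t + closed_segment 0 g) - vol (L + cball 0 t) \<partial>density lborel (indicator {0..\<epsilon>})) \<partial>ball_measure)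
     = (\<integral>g. (\<integral>x. ?l x g \<partial>lborel) \<partial>ball_measure)"
    by (simp only: integral_segment_growth(1)[OF L \<epsilon>])
  also have "\<dots> = enn2real (\<integral>\<^sup>+g. ennreal (\<integral>x. ?l x g \<partial>lborel) \<partial>ball_measure)"
    by (rule integral_eq_nn_integral) (auto intro!: AE_I2 Bochner_Integration.integral_nonneg)
  also have "(\<integral>\<^sup>+g. ennreal (\<integral>x. ?l x g \<partial>lborel) \<partial>ball_measure) = (\<integral>\<^sup>+g. (\<integral>\<^sup>+x. ennreal (?l x g) \<partial>lborel) \<partial>ball_measure)"
    by (intro nn_integral_cong nn_integral_eq_integral[symmetric] integral_segment_growth(2)[OF L \<epsilon>]) auto
  also have "\<dots> = (\<integral>\<^sup>+x. (\<integral>\<^sup>+g. ennreal (?l x g) \<partial>ball_measure) \<partial>lborel)"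
    by (rule pair_sigma_finite.Fubini'[OF pair, symmetric]) measurable
  also have "\<dots> = (\<integral>\<^sup>+x. ennreal (grad_const TYPE('n)) * indicator ?S x \<partial>lborel)"
  proof (rule nn_integral_cong)
    fix x
    show "(\<integral>\<^sup>+g. ennreal (?l x g) \<partial>ball_measure) = ennreal (grad_const TYPE('n)) * indicator ?S x"
    proof (cases "x \<in> ?S")
      case True
      have "(\<integral>\<^sup>+g. ennreal (?l x g) \<partial>ball_measure) = (\<integral>\<^sup>+g. ennreal (max 0 (dist_grad L x \<bullet> g)) \<partial>ball_measure)"
        using True by simp
      also have "\<dots> = ennreal (\<integral>g. max 0 (dist_grad L x \<bullet> g) \<partial>ball_measure)"
        by (intro nn_integral_eq_integral integrable_ball_measure_max_inner) auto
      also have "\<dots> = ennreal (grad_const TYPE('n) * norm (dist_grad L x))"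
        by (simp add: grad_const(2))
      also have "norm (dist_grad L x) = 1"
        using True infdist_closest_point[OF cl L(3), of x] by (simp add: dist_grad_def)
      finally show ?thesis using True by simp
    next
      case False
      then have "(\<lambda>g. ennreal (?l x g)) = (\<lambda>_. 0)" by auto
      with False show ?thesis by (simp only: nn_integral_const) simp
    qed
  qed
  also have "\<dots> = ennreal (grad_const TYPE('n)) * emeasure lborel ?S"
    by (subst nn_integral_cmult) auto
  also have "?S = (L + cball 0 \<epsilon>) - L"
    using in_plus_cball[OF cl L(3)] in_closed_iff_infdist_zero[OF cl L(3)] infdist_nonneg[of _ L]
    by (auto simp: less_le)
  also have "emeasure lborel ((L + cball 0 \<epsilon>) - L) = ennreal (vol (L + cball 0 \<epsilon>) - vol L)"
  proof -
    have f: "L + cball 0 \<epsilon> \<in> fmeasurable lborel" "L \<in> fmeasurable lborel"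
      by (intro fmeasurable_compact compact_set_plus L compact_cball)+
    have sub: "L \<subseteq> L + cball 0 \<epsilon>"
      using in_plus_cball[OF cl L(3), of _ \<epsilon>] \<epsilon> by (auto simp: subset_iff infdist_zero)
    have "vol ((L + cball 0 \<epsilon>) - L) = vol (L + cball 0 \<epsilon>) - vol L"
      using f sub by (intro measurable_measure_Diff) (auto simp: fmeasurable_def)
    moreover have "(L + cball 0 \<epsilon>) - L \<in> fmeasurable lborel" using f by (intro fmeasurable_Diff) (auto simp: fmeasurable_def)
    ultimately show ?thesis by (simp add: emeasure_eq_measure2)
  qed
  also have "enn2real (ennreal (grad_const TYPE('n)) * ennreal (vol (L + cball 0 \<epsilon>) - vol L))
    = grad_const TYPE('n) * (vol (L + cball 0 \<epsilon>) - vol L)"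
  proof -
    have "vol L \<le> vol (L + cball 0 \<epsilon>)"
      using in_plus_cball[OF cl L(3), of _ \<epsilon>] \<epsilon>
      by (intro vol_mono compact_set_plus L compact_cball) (auto simp: subset_iff infdist_zero)
    then show ?thesis using grad_const(1)[where 'n='n] by (simp add: enn2real_mult)
  qed
  finally show ?thesis ..
qed

section \<open>Iterated segment differences\<close>

text \<open>Unfolded, this is the sum over the subsets \<open>S\<close> of \<open>{..<k}\<close> of
  \<open>(-1) ^ (k - card S)\<close> times the volume of \<open>A\<close> plus the segments indexed
  by \<open>S\<close>. Directions form an infinite sequence, so that prepending a random direction
  is a map from sequences to sequences.\<close>

primrec segment_diff :: "nat \<Rightarrow> 'a::euclidean_space set \<Rightarrow> (nat \<Rightarrow> 'a) \<Rightarrow> real" where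
  "segment_diff 0 A v = vol A"
| "segment_diff (Suc k) A v =
     segment_diff k (A + closed_segment 0 (v 0)) (\<lambda>i. v (Suc i)) - segment_diff k A (\<lambda>i. v (Suc i))"

text \<open>Measurability of volumes of parameter-dependent sums is propagated through closed
  graphs: a closed graph is a Borel set in the product, and the volumes of its sections are then
  measurable. Compactness of \<open>C\<close> provides the convergent subsequence of
  summands.\<close>

lemma closed_graph_plus_image:
  fixes A :: "'p::first_countable_topology \<Rightarrow> 'a::euclidean_space set" and C :: "'c::metric_space set"
  assumes A: "closed {(p, z). z \<in> A p}" and C: "compact C"
    and m: "continuous_on UNIV (\<lambda>(p, c). m p c)"
  shows "closed {(p, z). z \<in> A p + m p ` C}"
  unfolding closed_sequential_limits
proof (intro allI impI)
  fix x :: "nat \<Rightarrow> 'p \<times> 'a" and l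
  assume "(\<forall>n. x n \<in> {(p, z). z \<in> A p + m p ` C}) \<and> x \<longlonglongrightarrow> l"
  then have x: "\<And>n. snd (x n) \<in> A (fst (x n)) + m (fst (x n)) ` C" and lim: "x \<longlonglongrightarrow> l"
    by (auto simp: split_beta)
  have "\<forall>n. \<exists>c\<in>C. snd (x n) - m (fst (x n)) c \<in> A (fst (x n))"
  proof
    fix n
    obtain a c where "a \<in> A (fst (x n))" "c \<in> C" "snd (x n) = a + m (fst (x n)) c"
      using x[of n] unfolding set_plus_def by blast
    then show "\<exists>c\<in>C. snd (x n) - m (fst (x n)) c \<in> A (fst (x n))" by (intro bexI[of _ c]) auto
  qed
  then obtain c where c: "\<And>n. c n \<in> C" "\<And>n. snd (x n) - m (fst (x n)) (c n) \<in> A (fst (x n))" by metis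
  obtain b r where b: "b \<in> C" "strict_mono r" "(c \<circ> r) \<longlonglongrightarrow> b"
    using C c(1) unfolding compact_def by metis
  have xr: "(\<lambda>n. x (r n)) \<longlonglongrightarrow> l" using LIMSEQ_subseq_LIMSEQ[OF lim b(2)] by (simp add: o_def)
  have f: "(\<lambda>n. fst (x (r n))) \<longlonglongrightarrow> fst l" and s: "(\<lambda>n. snd (x (r n))) \<longlonglongrightarrow> snd l"
    using xr by (auto intro: tendsto_fst tendsto_snd)
  have cr: "(\<lambda>n. c (r n)) \<longlonglongrightarrow> b" using b(3) by (simp add: o_def)
  have "(\<lambda>n. (\<lambda>(p, c). m p c) (fst (x (r n)), c (r n))) \<longlonglongrightarrow> (\<lambda>(p, c). m p c) (fst l, b)"
    by (rule continuous_on_tendsto_compose[OF m tendsto_Pair[OF f cr]]) auto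
  then have "(\<lambda>n. (fst (x (r n)), snd (x (r n)) - m (fst (x (r n))) (c (r n)))) \<longlonglongrightarrow> (fst l, snd l - m (fst l) b)"
    by (intro tendsto_intros f s) simp
  moreover have "(fst (x (r n)), snd (x (r n)) - m (fst (x (r n))) (c (r n))) \<in> {(p, z). z \<in> A p}" for n
    using c(2) by simp
  ultimately have "(fst l, snd l - m (fst l) b) \<in> {(p, z). z \<in> A p}"
    using closed_sequentially[OF A, of "\<lambda>n. (fst (x (r n)), snd (x (r n)) - m (fst (x (r n))) (c (r n)))"] by blast
  then have a: "snd l - m (fst l) b \<in> A (fst l)" by simp
  have "(snd l - m (fst l) b) + m (fst l) b \<in> A (fst l) + m (fst l) ` C"
    by (rule set_plus_intro[OF a imageI[OF b(1)]])
  then show "l \<in> {(p, z). z \<in> A p + m p ` C}" by (simp add: split_beta)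
qed

lemma segment_0_image: "closed_segment 0 v = (\<lambda>s. s *\<^sub>R v) ` {0..1}" for v :: "'a::real_vector"
  by (rule set_eqI) (simp only: in_segment_0 image_iff Bex_def atLeastAtMost_iff, blast)

lemma closed_graph_plus_segment:
  fixes A :: "'p::first_countable_topology \<Rightarrow> 'a::euclidean_space set"
  assumes A: "closed {(p, z). z \<in> A p}" and u: "continuous_on UNIV u"
  shows "closed {(p, z). z \<in> A p + closed_segment 0 (u p)}"
  unfolding segment_0_image
proof (rule closed_graph_plus_image[OF A])
  have "continuous_on UNIV (\<lambda>z::'p \<times> real. u (fst z))"
    by (rule continuous_on_compose2[OF u]) (auto intro: continuous_intros)
  then show "continuous_on UNIV (\<lambda>(p, c). c *\<^sub>R u p)"
    by (auto simp: split_beta intro!: continuous_intros)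
qed simp

lemma borel_measurable_emeasure_section:
  fixes A :: "'p::second_countable_topology \<Rightarrow> 'a::euclidean_space set"
  assumes "closed {(p, z). z \<in> A p}"
  shows "(\<lambda>p. emeasure lborel (A p)) \<in> borel_measurable borel"
proof -
  have "{(p, z). z \<in> A p} \<in> sets (borel \<Otimes>\<^sub>M lborel)"
    using borel_closed[OF assms] by (simp add: borel_prod[symmetric] sets_pair_measure_cong[OF refl sets_lborel])
  then have "(\<lambda>p. emeasure lborel (Pair p -` {(p, z). z \<in> A p})) \<in> borel_measurable borel"
    by (rule sigma_finite_measure.measurable_emeasure_Pair[OF sigma_finite_lborel])
  moreover have "Pair p -` {(p, z). z \<in> A p} = A p" for p by auto
  ultimately show ?thesis by simp
qed

lemma borel_measurable_segment_diff:
  fixes A :: "'p::second_countable_topology \<Rightarrow> 'a::euclidean_space set"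
  assumes "closed {(p, z). z \<in> A p}" and "\<And>i. continuous_on UNIV (\<lambda>p. u p i)"
  shows "(\<lambda>p. segment_diff k (A p) (u p)) \<in> borel_measurable borel"
  using assms
proof (induction k arbitrary: A u)
  case 0
  then show ?case using borel_measurable_emeasure_section[of A] by (simp add: measure_def)
next
  case (Suc k)
  have 1: "(\<lambda>p. segment_diff k (A p + closed_segment 0 (u p 0)) (\<lambda>i. u p (Suc i))) \<in> borel_measurable borel"
    by (rule Suc.IH[OF closed_graph_plus_segment[OF Suc.prems(1)]]) (rule Suc.prems(2))+
  have 2: "(\<lambda>p. segment_diff k (A p) (\<lambda>i. u p (Suc i))) \<in> borel_measurable borel"
    by (rule Suc.IH[OF Suc.prems(1)]) (rule Suc.prems(2))
  show ?case unfolding segment_diff.simps by (rule borel_measurable_diff[OF 1 2])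
qed

text \<open>A crude bound on each of the \<open>2 ^ k\<close> volumes; its only purpose is
  integrability over random directions in the unit ball.\<close>

lemma segment_diff_bound:
  fixes A :: "'a::euclidean_space set"
  assumes "compact A" "A \<subseteq> cball 0 r" "\<And>i. norm (v i) \<le> 1"
  shows "\<bar>segment_diff k A v\<bar> \<le> 2 ^ k * vol (cball (0::'a::euclidean_space) (r + real k))"
  using assms
proof (induction k arbitrary: A v r)
  case 0
  have "vol A \<le> vol (cball (0::'a) r)" by (rule vol_mono[OF 0(2,1) compact_cball])
  then show ?case by simp
next
  case (Suc k)
  let ?v = "\<lambda>i. v (Suc i)"
  have c: "compact (A + closed_segment 0 (v 0))" by (intro compact_set_plus Suc.prems compact_segment)
  have sub: "A + closed_segment 0 (v 0) \<subseteq> cball 0 (r + 1)"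
  proof
    fix x assume "x \<in> A + closed_segment 0 (v 0)"
    then obtain a s where as: "a \<in> A" "0 \<le> s" "s \<le> 1" "x = a + s *\<^sub>R v 0" unfolding in_plus_segment by blast
    have "norm x \<le> norm a + s * norm (v 0)" using as norm_triangle_ineq[of a "s *\<^sub>R v 0"] by simp
    moreover have "norm a \<le> r" using as(1) Suc.prems(2) by auto
    moreover have "s * norm (v 0) \<le> 1" using as Suc.prems(3)[of 0] by (simp add: mult_le_one)
    ultimately show "x \<in> cball 0 (r + 1)" by simp
  qed
  have 1: "\<bar>segment_diff k (A + closed_segment 0 (v 0)) ?v\<bar> \<le> 2 ^ k * vol (cball (0::'a) (r + 1 + real k))"
    using c sub Suc.prems(3) by (intro Suc.IH) auto
  have "A \<subseteq> cball 0 (r + 1)"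
  proof
    fix x assume "x \<in> A"
    then show "x \<in> cball 0 (r + 1)" using Suc.prems(2) by fastforce
  qed
  then have 2: "\<bar>segment_diff k A ?v\<bar> \<le> 2 ^ k * vol (cball (0::'a) (r + 1 + real k))"
    using Suc.prems by (intro Suc.IH) auto
  have "\<bar>segment_diff (Suc k) A v\<bar> \<le> 2 ^ k * vol (cball (0::'a) (r + 1 + real k)) + 2 ^ k * vol (cball (0::'a) (r + 1 + real k))"
    using 1 2 unfolding segment_diff.simps by linarith
  then show ?case by (simp add: algebra_simps)
qed

section \<open>Sequences of independent random segments\<close>

abbreviation ball_seq :: "(nat \<Rightarrow> 'a::euclidean_space) measure" where
  "ball_seq \<equiv> PiM UNIV (\<lambda>_. ball_measure)"

interpretation ball_seq: sequence_space "ball_measure :: 'a::euclidean_space measure"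
  by standard

interpretation ball_seq: prob_space "ball_seq :: (nat \<Rightarrow> 'a::euclidean_space) measure"
  by (rule prob_space_PiM) (rule prob_space_ball_measure)

lemma sets_ball_seq: "sets (ball_seq :: (nat \<Rightarrow> 'a::euclidean_space) measure) = sets borel"
proof -
  have "sets (ball_seq :: (nat \<Rightarrow> 'a) measure) = sets (PiM UNIV (\<lambda>_. borel))"
    by (intro sets_PiM_cong) auto
  then show ?thesis by (simp add: sets_PiM_equal_borel)
qed

lemma space_ball_seq [simp]: "space (ball_seq :: (nat \<Rightarrow> 'a::euclidean_space) measure) = UNIV"
  by (simp add: space_PiM)

lemma AE_ball_seq: "AE \<omega> in (ball_seq :: (nat \<Rightarrow> 'a::euclidean_space) measure). \<forall>i. norm (\<omega> i) \<le> 1"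
  unfolding AE_all_countable
proof
  fix i
  show "AE \<omega> in (ball_seq :: (nat \<Rightarrow> 'a) measure). norm (\<omega> i) \<le> 1"
    by (rule AE_PiM_component[where P="\<lambda>g. norm g \<le> 1"]) (auto intro: prob_space_ball_measure AE_ball_measure)
qed

lemma continuous_on_coord: "continuous_on UNIV (\<lambda>\<omega>::nat \<Rightarrow> 'a::topological_space. \<omega> i)"
  by (rule continuous_on_product_coordinates)

text \<open>The value at negative radii is needed because functions of the radius are shown to be
  measurable on the whole line.\<close>

lemma plus_cball_neg: "t < 0 \<Longrightarrow> L + cball 0 t = {}" for L :: "'a::euclidean_space set"
  unfolding set_plus_def by simp

lemma compact_subset_cball:
  fixes L :: "'a::euclidean_space set"
  assumes "compact L"
  obtains r where "L \<subseteq> cball 0 r"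
proof -
  obtain r where "\<forall>x\<in>L. norm x \<le> r" using compact_imp_bounded[OF assms] unfolding bounded_iff by blast
  then have "L \<subseteq> cball 0 r" by (simp add: subset_iff)
  then show thesis by (rule that)
qed

lemma measurable_segment_diff_seq:
  fixes L :: "'a::euclidean_space set"
  assumes "closed L"
  shows "(\<lambda>\<omega>. segment_diff k L \<omega>) \<in> borel_measurable ball_seq"
proof -
  have "{(p::nat \<Rightarrow> 'a, z). z \<in> L} = UNIV \<times> L" by auto
  then have "closed {(p::nat \<Rightarrow> 'a, z). z \<in> L}" using assms by (simp add: closed_Times)
  then have "(\<lambda>\<omega>. segment_diff k L \<omega>) \<in> borel_measurable borel"
    by (intro borel_measurable_segment_diff continuous_on_coord)
  then show ?thesis by (simp cong: measurable_cong_sets add: sets_ball_seq)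
qed

lemma integrable_segment_diff_seq:
  fixes L :: "'a::euclidean_space set"
  assumes "compact L"
  shows "integrable ball_seq (\<lambda>\<omega>. segment_diff k L \<omega>)"
proof -
  obtain r where r: "L \<subseteq> cball 0 r" using compact_subset_cball[OF assms] .
  show ?thesis
  proof (rule ball_seq.integrable_const_bound)
    show "AE \<omega> in ball_seq. norm (segment_diff k L \<omega>) \<le> 2 ^ k * vol (cball (0::'a) (r + real k))"
      using AE_ball_seq by eventually_elim (simp add: segment_diff_bound[OF assms r])
  qed (rule measurable_segment_diff_seq[OF compact_imp_closed[OF assms]])
qed

text \<open>A density on the whole line instead of a restricted space, so that products with the
  other measures still carry the Borel sets of the product type.\<close>

abbreviation Icc_measure :: "real \<Rightarrow> real measure" where
  "Icc_measure \<epsilon> \<equiv> density lborel (indicator {0..\<epsilon>})"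

lemma AE_Icc_measure: "AE t in Icc_measure \<epsilon>. 0 \<le> t \<and> t \<le> \<epsilon>"
  by (subst AE_density) (auto simp: indicator_def)

text \<open>The triple consists of the directions, the segment that is prepended to them, and the
  radius. A function of one argument turns joint measurability into a single statement, from which
  all sections are obtained.\<close>

definition shell_integrand :: "nat \<Rightarrow> 'a::euclidean_space set \<Rightarrow> (nat \<Rightarrow> 'a) \<times> 'a \<times> real \<Rightarrow> real" where
  "shell_integrand k L p = segment_diff (Suc k) (L + cball 0 (snd (snd p))) (case_nat (fst (snd p)) (fst p))"

lemma borel_measurable_shell_integrand:
  fixes L :: "'a::euclidean_space set"
  assumes "compact L" "L \<noteq> {}"
  shows "shell_integrand k L \<in> borel_measurable borel"
  unfolding shell_integrand_def[abs_def]
proof (rule borel_measurable_segment_diff)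
  let ?X = "{p :: ((nat \<Rightarrow> 'a) \<times> 'a \<times> real) \<times> 'a. infdist (snd p) L \<le> snd (snd (fst p))}"
  have "closed ?X" by (intro closed_Collect_le continuous_intros)
  moreover have "{(p :: (nat \<Rightarrow> 'a) \<times> 'a \<times> real, z). z \<in> L + cball 0 (snd (snd p))} = ?X"
    using in_plus_cball[OF compact_imp_closed[OF assms(1)] assms(2)] by auto
  ultimately show "closed {(p :: (nat \<Rightarrow> 'a) \<times> 'a \<times> real, z). z \<in> L + cball 0 (snd (snd p))}" by simp
  fix i
  show "continuous_on UNIV (\<lambda>p :: (nat \<Rightarrow> 'a) \<times> 'a \<times> real. case_nat (fst (snd p)) (fst p) i)"
  proof (cases i)
    case (Suc j)
    have "continuous_on UNIV (\<lambda>p :: (nat \<Rightarrow> 'a) \<times> 'a \<times> real. fst p j)"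
      by (rule continuous_on_compose2[OF continuous_on_coord[of j]]) (auto intro: continuous_intros)
    then show ?thesis using Suc by simp
  next
    case 0
    have "continuous_on UNIV (\<lambda>p :: (nat \<Rightarrow> 'a) \<times> 'a \<times> real. fst (snd p))" by (intro continuous_intros)
    then show ?thesis using 0 by simp
  qed
qed

lemma shell_integrand_bound:
  fixes L :: "'a::euclidean_space set"
  assumes L: "compact L" "L \<subseteq> cball 0 r" and p: "\<forall>i. norm (fst p i) \<le> 1" "norm (fst (snd p)) \<le> 1" "0 \<le> snd (snd p)" "snd (snd p) \<le> \<epsilon>"
  shows "norm (shell_integrand k L p) \<le> 2 ^ (Suc k) * vol (cball (0::'a) (r + \<epsilon> + real (Suc k)))"
  unfolding shell_integrand_def real_norm_def
proof (rule segment_diff_bound)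
  show "compact (L + cball 0 (snd (snd p)))" by (intro compact_set_plus L compact_cball)
  show "L + cball 0 (snd (snd p)) \<subseteq> cball 0 (r + \<epsilon>)"
  proof
    fix x assume "x \<in> L + cball 0 (snd (snd p))"
    then obtain a b where "a \<in> L" "b \<in> cball 0 (snd (snd p))" "x = a + b" unfolding set_plus_def by blast
    moreover from this have "norm a \<le> r" using L(2) by auto
    ultimately show "x \<in> cball 0 (r + \<epsilon>)" using p(4) norm_triangle_ineq[of a b] by simp
  qed
  show "norm (case_nat (fst (snd p)) (fst p) i) \<le> 1" for i using p(1,2) by (cases i) auto
qed

text \<open>These are the product spaces on which Fubini is applied below: with fixed directions,
  with everything random, and with a fixed radius. In each case the integrand is bounded almost
  everywhere and the measure is finite.\<close>

lemma shell_integrals: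
  fixes L :: "'a::euclidean_space set"
  assumes L: "compact L" "L \<noteq> {}"
  shows integrable_shell_pair: "\<forall>i. norm (\<omega> i) \<le> 1 \<Longrightarrow> integrable (ball_measure \<Otimes>\<^sub>M Icc_measure \<epsilon>) (\<lambda>q. shell_integrand k L (\<omega>, q))"
    and integrable_shell_triple: "integrable (ball_seq \<Otimes>\<^sub>M (ball_measure \<Otimes>\<^sub>M Icc_measure \<epsilon>)) (shell_integrand k L)"
    and integrable_shell_cons: "0 \<le> t \<Longrightarrow> integrable (ball_measure \<Otimes>\<^sub>M ball_seq) (\<lambda>(g, \<omega>). shell_integrand k L (\<omega>, g, t))"
proof -
  obtain r where r: "L \<subseteq> cball 0 r" using compact_subset_cball[OF L(1)] .
  interpret I: finite_measure "Icc_measure \<epsilon>" by (rule finite_measure_density_Icc)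
  interpret GI: pair_sigma_finite "ball_measure :: 'a measure" "Icc_measure \<epsilon>"
    by (intro pair_sigma_finite.intro ball_measure.sigma_finite_measure_axioms I.sigma_finite_measure_axioms)
  interpret GIf: finite_measure "ball_measure \<Otimes>\<^sub>M Icc_measure \<epsilon> :: ('a \<times> real) measure"
    by (intro finite_measure_pair_measure I.finite_measure_axioms ball_measure.finite_measure_axioms)
  interpret SGI: pair_sigma_finite "ball_seq :: (nat \<Rightarrow> 'a) measure" "ball_measure \<Otimes>\<^sub>M Icc_measure \<epsilon> :: ('a \<times> real) measure"
    by (intro pair_sigma_finite.intro ball_seq.sigma_finite_measure_axioms finite_measure.axioms(1)[OF GIf.finite_measure_axioms])
  interpret SGIf: finite_measure "ball_seq \<Otimes>\<^sub>M (ball_measure \<Otimes>\<^sub>M Icc_measure \<epsilon>) :: ((nat \<Rightarrow> 'a) \<times> 'a \<times> real) measure"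
    by (intro finite_measure_pair_measure GIf.finite_measure_axioms ball_seq.finite_measure_axioms)
  interpret GS: pair_sigma_finite "ball_measure :: 'a measure" "ball_seq :: (nat \<Rightarrow> 'a) measure"
    by (intro pair_sigma_finite.intro ball_seq.sigma_finite_measure_axioms ball_measure.sigma_finite_measure_axioms)
  interpret GSf: finite_measure "ball_measure \<Otimes>\<^sub>M ball_seq :: ('a \<times> (nat \<Rightarrow> 'a)) measure"
    by (intro finite_measure_pair_measure ball_measure.finite_measure_axioms ball_seq.finite_measure_axioms)
  have sGI: "sets (ball_measure \<Otimes>\<^sub>M Icc_measure \<epsilon> :: ('a \<times> real) measure) = sets borel"
    by (simp add: borel_prod[symmetric] cong: sets_pair_measure_cong)
  have sSGI: "sets (ball_seq \<Otimes>\<^sub>M (ball_measure \<Otimes>\<^sub>M Icc_measure \<epsilon>) :: ((nat \<Rightarrow> 'a) \<times> 'a \<times> real) measure) = sets borel"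
    by (simp add: borel_prod[symmetric] sGI sets_ball_seq cong: sets_pair_measure_cong)
  have sGS: "sets (ball_measure \<Otimes>\<^sub>M ball_seq :: ('a \<times> (nat \<Rightarrow> 'a)) measure) = sets borel"
    by (simp add: borel_prod[symmetric] sets_ball_seq cong: sets_pair_measure_cong)
  note m = borel_measurable_shell_integrand[OF L, of k]
  have GI: "AE q in ball_measure \<Otimes>\<^sub>M Icc_measure \<epsilon>. norm (fst q :: 'a) \<le> 1 \<and> 0 \<le> snd q \<and> snd q \<le> \<epsilon>"
  proof (rule GI.AE_pair_measure)
    show "AE x in ball_measure. AE y in Icc_measure \<epsilon>. norm (fst (x, y) :: 'a) \<le> 1 \<and> 0 \<le> snd (x, y) \<and> snd (x, y) \<le> \<epsilon>"
      using AE_ball_measure AE_Icc_measure[of \<epsilon>] by (auto elim!: eventually_mono)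
  qed measurable
  {
    assume \<omega>: "\<forall>i. norm (\<omega> i) \<le> 1"
    show "integrable (ball_measure \<Otimes>\<^sub>M Icc_measure \<epsilon>) (\<lambda>q. shell_integrand k L (\<omega>, q))"
    proof (rule GIf.integrable_const_bound)
      show "AE q in ball_measure \<Otimes>\<^sub>M Icc_measure \<epsilon>.
          norm (shell_integrand k L (\<omega>, q)) \<le> 2 ^ (Suc k) * vol (cball (0::'a) (r + \<epsilon> + real (Suc k)))"
        using GI by eventually_elim (intro shell_integrand_bound[OF L(1) r], use \<omega> in auto)
      have "(\<lambda>q. (\<omega>, q)) \<in> borel_measurable borel"
        by (intro borel_measurable_continuous_onI continuous_intros)
      from measurable_compose[OF this m]
      show "(\<lambda>q. shell_integrand k L (\<omega>, q)) \<in> borel_measurable (ball_measure \<Otimes>\<^sub>M Icc_measure \<epsilon>)"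
        by (subst measurable_cong_sets[OF sGI refl])
    qed
  }
  show "integrable (ball_seq \<Otimes>\<^sub>M (ball_measure \<Otimes>\<^sub>M Icc_measure \<epsilon>)) (shell_integrand k L)"
  proof (rule SGIf.integrable_const_bound)
    have "AE p in ball_seq \<Otimes>\<^sub>M (ball_measure \<Otimes>\<^sub>M Icc_measure \<epsilon>).
       (\<forall>i. norm (fst p i :: 'a) \<le> 1) \<and> norm (fst (snd p) :: 'a) \<le> 1 \<and> 0 \<le> snd (snd p) \<and> snd (snd p) \<le> \<epsilon>"
    proof (rule SGI.AE_pair_measure)
      show "AE x in ball_seq. AE y in ball_measure \<Otimes>\<^sub>M Icc_measure \<epsilon>.
        (\<forall>i. norm (fst (x, y) i :: 'a) \<le> 1) \<and> norm (fst (snd (x, y)) :: 'a) \<le> 1 \<and> 0 \<le> snd (snd (x, y)) \<and> snd (snd (x, y)) \<le> \<epsilon>"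
        using AE_ball_seq GI by (auto elim!: eventually_mono)
    qed measurable
    then show "AE p in ball_seq \<Otimes>\<^sub>M (ball_measure \<Otimes>\<^sub>M Icc_measure \<epsilon>).
        norm (shell_integrand k L p) \<le> 2 ^ (Suc k) * vol (cball (0::'a) (r + \<epsilon> + real (Suc k)))"
      by eventually_elim (intro shell_integrand_bound[OF L(1) r], auto)
    show "shell_integrand k L \<in> borel_measurable (ball_seq \<Otimes>\<^sub>M (ball_measure \<Otimes>\<^sub>M Icc_measure \<epsilon>))"
      using m by (subst measurable_cong_sets[OF sSGI refl])
  qed
  {
    assume t: "0 \<le> t"
    show "integrable (ball_measure \<Otimes>\<^sub>M ball_seq) (\<lambda>(g, \<omega>). shell_integrand k L (\<omega>, g, t))"
    proof (rule GSf.integrable_const_bound)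
      have "AE p in ball_measure \<Otimes>\<^sub>M ball_seq. norm (fst p :: 'a) \<le> 1 \<and> (\<forall>i. norm (snd p i :: 'a) \<le> 1)"
      proof (rule GS.AE_pair_measure)
        show "AE x in ball_measure. AE y in ball_seq. norm (fst (x, y) :: 'a) \<le> 1 \<and> (\<forall>i. norm (snd (x, y) i :: 'a) \<le> 1)"
          using AE_ball_seq AE_ball_measure by (auto elim!: eventually_mono)
      qed measurable
      then show "AE p in ball_measure \<Otimes>\<^sub>M ball_seq.
          norm (case p of (g, \<omega>) \<Rightarrow> shell_integrand k L (\<omega>, g, t)) \<le> 2 ^ (Suc k) * vol (cball (0::'a) (r + t + real (Suc k)))"
        unfolding split_beta by eventually_elim (intro shell_integrand_bound[OF L(1) r], use t in auto)
      have "(\<lambda>(g, \<omega>). (\<omega>, g, t)) \<in> borel_measurable (borel :: ('a \<times> (nat \<Rightarrow> 'a)) measure)"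
        unfolding split_beta by (intro borel_measurable_continuous_onI continuous_intros)
      from measurable_compose[OF this m]
      show "(\<lambda>(g, \<omega>). shell_integrand k L (\<omega>, g, t)) \<in> borel_measurable (ball_measure \<Otimes>\<^sub>M ball_seq)"
        by (subst measurable_cong_sets[OF sGS refl]) (simp add: split_beta)
    qed
  }
qed

text \<open>The shell formula survives taking differences. Adding the fixed segment of
  \<open>v 0\<close> commutes with adding balls and further segments, so the induction subtracts the
  formula for \<open>L\<close> from the one for \<open>L\<close> plus that segment.\<close>

lemma segment_diff_shell:
  fixes L :: "(real^'n) set"
  assumes L: "compact L" "convex L" "L \<noteq> {}" and \<epsilon>: "\<epsilon> \<ge> 0" and v: "\<And>i. norm (v i) \<le> 1"
  shows "grad_const TYPE('n) * (segment_diff k (L + cball 0 \<epsilon>) v - segment_diff k L v) =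
    (\<integral>q. shell_integrand k L (v, q) \<partial>(ball_measure \<Otimes>\<^sub>M Icc_measure \<epsilon>))"
  using L v
proof (induction k arbitrary: L v)
  case 0
  interpret I: finite_measure "Icc_measure \<epsilon>" by (rule finite_measure_density_Icc)
  interpret GI: pair_sigma_finite "ball_measure :: (real^'n) measure" "Icc_measure \<epsilon>"
    by (intro pair_sigma_finite.intro ball_measure.sigma_finite_measure_axioms I.sigma_finite_measure_axioms)
  have int: "integrable (ball_measure \<Otimes>\<^sub>M Icc_measure \<epsilon>) (\<lambda>q. shell_integrand 0 L (v, q))"
    using 0 by (intro integrable_shell_pair) auto
  have "(\<integral>q. shell_integrand 0 L (v, q) \<partial>(ball_measure \<Otimes>\<^sub>M Icc_measure \<epsilon>))
      = (\<integral>g. (\<integral>t. shell_integrand 0 L (v, g, t) \<partial>Icc_measure \<epsilon>) \<partial>ball_measure)"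
    by (rule GI.integral_fst'[OF int, symmetric])
  then show ?case
    unfolding segment_diff.simps vol_shell[OF 0(1-3) \<epsilon>] by (simp add: shell_integrand_def)
next
  case (Suc k)
  let ?v = "\<lambda>i. v (Suc i)" and ?S = "closed_segment 0 (v 0)"
  have L': "compact (L + ?S)" "convex (L + ?S)"
    by (intro compact_set_plus convex_set_plus Suc.prems compact_segment convex_closed_segment)+
  have ne: "L + ?S \<noteq> {}" using Suc.prems(3) unfolding set_plus_def by blast
  note L' = L' ne
  have comm: "L + cball 0 t + ?S = L + ?S + cball 0 t" for t
    by (simp only: add.assoc add.commute[of "cball 0 t"])
  have comm2: "A + closed_segment 0 g + ?S = A + ?S + closed_segment 0 g" for A g
    by (simp only: add.assoc add.commute[of "closed_segment 0 g"])
  have "shell_integrand (Suc k) L (v, q) = shell_integrand k (L + ?S) (?v, q) - shell_integrand k L (?v, q)" for q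
    unfolding shell_integrand_def segment_diff.simps fst_conv snd_conv nat.case
    by (simp only: comm comm2)
  then have "(\<integral>q. shell_integrand (Suc k) L (v, q) \<partial>(ball_measure \<Otimes>\<^sub>M Icc_measure \<epsilon>))
    = (\<integral>q. shell_integrand k (L + ?S) (?v, q) \<partial>(ball_measure \<Otimes>\<^sub>M Icc_measure \<epsilon>)) - (\<integral>q. shell_integrand k L (?v, q) \<partial>(ball_measure \<Otimes>\<^sub>M Icc_measure \<epsilon>))"
    using Suc.prems L' by (simp add: Bochner_Integration.integral_diff integrable_shell_pair)
  also have "\<dots> = grad_const TYPE('n) * (segment_diff k (L + ?S + cball 0 \<epsilon>) ?v - segment_diff k (L + ?S) ?v)
     - grad_const TYPE('n) * (segment_diff k (L + cball 0 \<epsilon>) ?v - segment_diff k L ?v)"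
    using Suc.IH[OF L', of ?v] Suc.IH[OF Suc.prems(1-3), of ?v] Suc.prems(4) by simp
  finally show ?case unfolding segment_diff.simps comm by (simp add: algebra_simps)
qed

definition mean_diff :: "nat \<Rightarrow> 'a::euclidean_space set \<Rightarrow> real" where
  "mean_diff k A = (\<integral>\<omega>. segment_diff k A \<omega> \<partial>ball_seq)"

text \<open>The first entry of an independent sequence is independent of the remaining ones, which
  again form a sequence with the same law.\<close>

lemma mean_diff_Suc:
  fixes L :: "'a::euclidean_space set"
  assumes L: "compact L" "L \<noteq> {}" and t: "0 \<le> t"
  shows "mean_diff (Suc k) (L + cball 0 t) = (\<integral>g. (\<integral>\<omega>. shell_integrand k L (\<omega>, g, t) \<partial>ball_seq) \<partial>ball_measure)"
proof -
  interpret GS: pair_sigma_finite "ball_measure :: 'a measure" "ball_seq :: (nat \<Rightarrow> 'a) measure"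
    by (intro pair_sigma_finite.intro ball_seq.sigma_finite_measure_axioms ball_measure.sigma_finite_measure_axioms)
  have cl: "closed (L + cball 0 t)" by (intro compact_imp_closed compact_set_plus L compact_cball)
  have "mean_diff (Suc k) (L + cball 0 t) = (\<integral>\<omega>. segment_diff (Suc k) (L + cball 0 t) \<omega> \<partial>distr (ball_measure \<Otimes>\<^sub>M ball_seq) ball_seq (\<lambda>(s, \<omega>). case_nat s \<omega>))"
    unfolding mean_diff_def ball_seq.PiM_iter ..
  also have "\<dots> = (\<integral>p. segment_diff (Suc k) (L + cball 0 t) (case p of (s, \<omega>) \<Rightarrow> case_nat s \<omega>) \<partial>(ball_measure \<Otimes>\<^sub>M ball_seq))"
    by (rule integral_distr[OF _ measurable_segment_diff_seq[OF cl]]) measurable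
  also have "\<dots> = (\<integral>p. (case p of (g, \<omega>) \<Rightarrow> shell_integrand k L (\<omega>, g, t)) \<partial>(ball_measure \<Otimes>\<^sub>M ball_seq))"
    by (simp add: shell_integrand_def split_beta)
  also have "\<dots> = (\<integral>g. (\<integral>\<omega>. shell_integrand k L (\<omega>, g, t) \<partial>ball_seq) \<partial>ball_measure)"
    using GS.integral_fst'[OF integrable_shell_cons[OF L t, of k]] by simp
  finally show ?thesis .
qed

text \<open>The differential equation in integrated form: along the parallel bodies,
  \<open>mean_diff k\<close> changes at the rate \<open>mean_diff (Suc k)\<close> divided by
  \<open>grad_const\<close>.\<close>

lemma mean_diff_shell:
  fixes L :: "(real^'n) set"
  assumes L: "compact L" "convex L" "L \<noteq> {}" and \<epsilon>: "\<epsilon> \<ge> 0"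
  shows "grad_const TYPE('n) * (mean_diff k (L + cball 0 \<epsilon>) - mean_diff k L) =
    (\<integral>t. mean_diff (Suc k) (L + cball 0 t) \<partial>Icc_measure \<epsilon>)"
proof -
  interpret I: finite_measure "Icc_measure \<epsilon>" by (rule finite_measure_density_Icc)
  interpret GI: pair_sigma_finite "ball_measure :: (real^'n) measure" "Icc_measure \<epsilon>"
    by (intro pair_sigma_finite.intro ball_measure.sigma_finite_measure_axioms I.sigma_finite_measure_axioms)
  interpret GIf: finite_measure "ball_measure \<Otimes>\<^sub>M Icc_measure \<epsilon> :: ((real^'n) \<times> real) measure"
    by (intro finite_measure_pair_measure I.finite_measure_axioms ball_measure.finite_measure_axioms)
  interpret SGI: pair_sigma_finite "ball_seq :: (nat \<Rightarrow> (real^'n)) measure" "ball_measure \<Otimes>\<^sub>M Icc_measure \<epsilon> :: ((real^'n) \<times> real) measure"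
    by (intro pair_sigma_finite.intro ball_seq.sigma_finite_measure_axioms finite_measure.axioms(1)[OF GIf.finite_measure_axioms])
  have comp: "compact (L + cball 0 \<epsilon>)" by (intro compact_set_plus L compact_cball)
  let ?f = "\<lambda>\<omega> q. shell_integrand k L (\<omega>, q)"
  have int: "integrable (ball_seq \<Otimes>\<^sub>M (ball_measure \<Otimes>\<^sub>M Icc_measure \<epsilon>)) (case_prod ?f)"
    using integrable_shell_triple[OF L(1,3), of \<epsilon> k] by simp
  have eq: "case_prod (\<lambda>g t. \<integral>\<omega>. ?f \<omega> (g, t) \<partial>ball_seq) = (\<lambda>q. \<integral>\<omega>. ?f \<omega> q \<partial>ball_seq)" by auto
  have int2: "integrable (ball_measure \<Otimes>\<^sub>M Icc_measure \<epsilon>) (case_prod (\<lambda>g t. \<integral>\<omega>. ?f \<omega> (g, t) \<partial>ball_seq))"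
    unfolding eq by (rule SGI.integrable_snd[OF int])
  have "grad_const TYPE('n) * (mean_diff k (L + cball 0 \<epsilon>) - mean_diff k L)
     = (\<integral>\<omega>. grad_const TYPE('n) * (segment_diff k (L + cball 0 \<epsilon>) \<omega> - segment_diff k L \<omega>) \<partial>ball_seq)"
    unfolding mean_diff_def
    by (simp add: Bochner_Integration.integral_diff integrable_segment_diff_seq comp L)
  also have "\<dots> = (\<integral>\<omega>. (\<integral>q. ?f \<omega> q \<partial>(ball_measure \<Otimes>\<^sub>M Icc_measure \<epsilon>)) \<partial>ball_seq)"
  proof (rule integral_cong_AE)
    show "AE \<omega> in ball_seq. grad_const TYPE('n) * (segment_diff k (L + cball 0 \<epsilon>) \<omega> - segment_diff k L \<omega>)
        = (\<integral>q. ?f \<omega> q \<partial>(ball_measure \<Otimes>\<^sub>M Icc_measure \<epsilon>))"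
      using AE_ball_seq by eventually_elim (intro segment_diff_shell[OF L \<epsilon>], auto)
    show "(\<lambda>\<omega>. \<integral>q. ?f \<omega> q \<partial>(ball_measure \<Otimes>\<^sub>M Icc_measure \<epsilon>)) \<in> borel_measurable ball_seq"
      using SGI.integrable_fst[OF int] by (rule borel_measurable_integrable)
    show "(\<lambda>\<omega>. grad_const TYPE('n) * (segment_diff k (L + cball 0 \<epsilon>) \<omega> - segment_diff k L \<omega>)) \<in> borel_measurable ball_seq"
      by (intro borel_measurable_times borel_measurable_const borel_measurable_diff borel_measurable_integrable integrable_segment_diff_seq comp L)
  qed
  also have "\<dots> = (\<integral>q. (\<integral>\<omega>. ?f \<omega> q \<partial>ball_seq) \<partial>(ball_measure \<Otimes>\<^sub>M Icc_measure \<epsilon>))"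
    by (rule SGI.Fubini_integral[OF int, symmetric])
  also have "\<dots> = (\<integral>t. (\<integral>g. (\<integral>\<omega>. ?f \<omega> (g, t) \<partial>ball_seq) \<partial>ball_measure) \<partial>Icc_measure \<epsilon>)"
  proof -
    from GI.integral_snd[OF int2] show ?thesis unfolding eq by (rule sym)
  qed
  also have "\<dots> = (\<integral>t. mean_diff (Suc k) (L + cball 0 t) \<partial>Icc_measure \<epsilon>)"
  proof (rule integral_cong_AE)
    have "integrable (Icc_measure \<epsilon>) (\<lambda>t. \<integral>g. (\<integral>\<omega>. ?f \<omega> (g, t) \<partial>ball_seq) \<partial>ball_measure)"
      by (rule GI.integrable_snd[OF int2])
    then show 1: "(\<lambda>t. \<integral>g. (\<integral>\<omega>. ?f \<omega> (g, t) \<partial>ball_seq) \<partial>ball_measure) \<in> borel_measurable (Icc_measure \<epsilon>)"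
      by (rule borel_measurable_integrable)
    show "AE t in Icc_measure \<epsilon>. (\<integral>g. (\<integral>\<omega>. ?f \<omega> (g, t) \<partial>ball_seq) \<partial>ball_measure) = mean_diff (Suc k) (L + cball 0 t)"
      using AE_Icc_measure[of \<epsilon>] by eventually_elim (simp add: mean_diff_Suc[OF L(1,3)])
    have "(\<lambda>t. mean_diff (Suc k) (L + cball 0 t)) = (\<lambda>t. if 0 \<le> t then (\<integral>g. (\<integral>\<omega>. ?f \<omega> (g, t) \<partial>ball_seq) \<partial>ball_measure) else mean_diff (Suc k) ({} :: (real^'n) set))"
      using mean_diff_Suc[OF L(1,3)] by (auto simp: plus_cball_neg)
    then show "(\<lambda>t. mean_diff (Suc k) (L + cball 0 t)) \<in> borel_measurable (Icc_measure \<epsilon>)"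
      using 1 by simp
  qed
  finally show ?thesis .
qed

lemma integral_Icc_power:
  assumes "0 \<le> \<epsilon>"
  shows "(\<integral>t. t ^ i \<partial>Icc_measure \<epsilon>) = \<epsilon> ^ Suc i / real (Suc i)" and "integrable (Icc_measure \<epsilon>) (\<lambda>t. t ^ i)"
proof -
  have d: "Icc_measure \<epsilon> = density lborel (\<lambda>x. ennreal (indicator {0..\<epsilon>} x))" by (simp add: ennreal_indicator)
  show "(\<integral>t. t ^ i \<partial>Icc_measure \<epsilon>) = \<epsilon> ^ Suc i / real (Suc i)"
    unfolding d using assms integral_power[of 0 \<epsilon> i] by (subst integral_density) (auto simp: mult.commute)
  interpret I: finite_measure "Icc_measure \<epsilon>" by (rule finite_measure_density_Icc)
  show "integrable (Icc_measure \<epsilon>) (\<lambda>t. t ^ i)"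
  proof (rule I.integrable_const_bound[where B="\<epsilon> ^ i"])
    show "AE t in Icc_measure \<epsilon>. norm (t ^ i) \<le> \<epsilon> ^ i"
      using AE_Icc_measure[of \<epsilon>] by eventually_elim (auto simp: power_mono)
  qed simp
qed

text \<open>Taylor's formula without remainder. The induction descends from order
  \<open>k + m\<close>, where the mean difference vanishes on all parallel bodies of
  \<open>L\<close>, and integrates the polynomial of order \<open>Suc k\<close> once; this produces
  the factorials and the powers of \<open>grad_const\<close>.\<close>

lemma mean_diff_polynomial:
  fixes L :: "(real^'n) set"
  assumes L: "compact L" "convex L" "L \<noteq> {}" and \<epsilon>: "\<epsilon> \<ge> 0"
    and zero: "\<And>t. t \<ge> 0 \<Longrightarrow> mean_diff (k + m) (L + cball 0 t) = 0"
  shows "mean_diff k (L + cball 0 \<epsilon>) =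
    (\<Sum>i<m. mean_diff (k + i) L * \<epsilon> ^ i / (fact i * grad_const TYPE('n) ^ i))"
  using \<epsilon> zero
proof (induction m arbitrary: k \<epsilon>)
  case 0
  then show ?case by simp
next
  case (Suc m)
  let ?c = "grad_const TYPE('n)"
  have c: "?c \<noteq> 0" using grad_const(1)[where 'n='n] by simp
  let ?a = "\<lambda>i. mean_diff (Suc k + i) L / (fact i * ?c ^ i)"
  have IH: "mean_diff (Suc k) (L + cball 0 t) = (\<Sum>i<m. ?a i * t ^ i)" if "t \<ge> 0" for t
    using Suc.IH[OF that, of "Suc k"] Suc.prems(2) by simp
  have "?c * (mean_diff k (L + cball 0 \<epsilon>) - mean_diff k L) = (\<integral>t. mean_diff (Suc k) (L + cball 0 t) \<partial>Icc_measure \<epsilon>)"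
    by (rule mean_diff_shell[OF L Suc.prems(1)])
  also have "\<dots> = (\<integral>t. (\<Sum>i<m. ?a i * t ^ i) \<partial>Icc_measure \<epsilon>)"
  proof (rule integral_cong_AE)
    show "AE t in Icc_measure \<epsilon>. mean_diff (Suc k) (L + cball 0 t) = (\<Sum>i<m. ?a i * t ^ i)"
      using AE_Icc_measure[of \<epsilon>] by eventually_elim (simp add: IH)
    have "(\<lambda>t. mean_diff (Suc k) (L + cball 0 t)) = (\<lambda>t. if 0 \<le> t then (\<Sum>i<m. ?a i * t ^ i) else mean_diff (Suc k) ({} :: (real^'n) set))"
    proof
      fix t show "mean_diff (Suc k) (L + cball 0 t) = (if 0 \<le> t then (\<Sum>i<m. ?a i * t ^ i) else mean_diff (Suc k) ({} :: (real^'n) set))"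
      proof (cases "0 \<le> t")
        case True
        then show ?thesis unfolding IH[OF True] by (simp only: if_True)
      next
        case False
        then show ?thesis by (simp add: plus_cball_neg)
      qed
    qed
    then show "(\<lambda>t. mean_diff (Suc k) (L + cball 0 t)) \<in> borel_measurable (Icc_measure \<epsilon>)" by simp
  qed simp
  also have "\<dots> = (\<Sum>i<m. ?a i * (\<epsilon> ^ Suc i / real (Suc i)))"
    using Suc.prems(1)
    by (subst Bochner_Integration.integral_sum) (simp_all add: integral_Icc_power mult_ac del: of_nat_Suc power_Suc)
  finally have "mean_diff k (L + cball 0 \<epsilon>) = mean_diff k L + (\<Sum>i<m. ?a i * (\<epsilon> ^ Suc i / real (Suc i))) / ?c"
    using c by (simp add: field_simps)
  also have "(\<Sum>i<m. ?a i * (\<epsilon> ^ Suc i / real (Suc i))) / ?c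
    = (\<Sum>i<m. mean_diff (k + Suc i) L * \<epsilon> ^ Suc i / (fact (Suc i) * ?c ^ Suc i))"
    unfolding sum_divide_distrib
    by (intro sum.cong refl) (simp add: divide_simps)
  finally show ?case by (simp add: sum.lessThan_Suc_shift del: sum.lessThan_Suc)
qed

section \<open>Projections and the Steiner formula\<close>

text \<open>Orthogonal projection is represented by \<open>closest_point\<close>. Once this
  characterization by orthogonal decomposition is available, the minimising property is hardly
  touched again.\<close>

lemma closest_point_subspace_eq:
  fixes E :: "'a::euclidean_space set"
  assumes E: "subspace E" and y: "y \<in> E" and z: "z \<in> orthogonal_comp E"
  shows "closest_point E (y + z) = y"
proof (rule closest_point_unique[symmetric])
  show "convex E" "closed E" using E by (auto simp: subspace_imp_convex closed_subspace)
  show "\<forall>w\<in>E. dist (y + z) y \<le> dist (y + z) w"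
  proof
    fix w assume "w \<in> E"
    then have "orthogonal (y - w) z" using E y z by (auto simp: orthogonal_comp_def subspace_diff)
    then have "(norm ((y - w) + z))\<^sup>2 = (norm (y - w))\<^sup>2 + (norm z)\<^sup>2" by (rule norm_add_Pythagorean)
    then have "(norm z)\<^sup>2 \<le> (norm ((y - w) + z))\<^sup>2" by simp
    then have "norm z \<le> norm ((y - w) + z)" by (rule power2_le_imp_le) simp
    then show "dist (y + z) y \<le> dist (y + z) w" by (simp add: dist_norm algebra_simps)
  qed
qed (rule y)

lemma subspace_decomp:
  fixes E :: "'a::euclidean_space set"
  assumes E: "subspace E"
  obtains y z where "y \<in> E" "z \<in> orthogonal_comp E" "x = y + z"
proof -
  obtain y z where *: "y \<in> span E" "\<And>w. w \<in> span E \<Longrightarrow> orthogonal z w" "x = y + z"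
    using orthogonal_subspace_decomp_exists[of E x] by metis
  have "span E = E" by (rule span_eq_iff[THEN iffD2, OF E])
  with * show thesis by (intro that[of y z]) (auto simp only: orthogonal_comp_def orthogonal_commute)
qed

lemma closest_point_subspace:
  fixes E :: "'a::euclidean_space set"
  assumes E: "subspace E"
  shows closest_point_subspace_in: "closest_point E x \<in> E"
    and closest_point_subspace_compl: "x - closest_point E x \<in> orthogonal_comp E"
    and linear_closest_point_subspace: "linear (closest_point E)"
proof -
  have *: "closest_point E x \<in> E \<and> x - closest_point E x \<in> orthogonal_comp E" for x
  proof -
    obtain y z where "y \<in> E" "z \<in> orthogonal_comp E" "x = y + z" using subspace_decomp[OF E] .
    then show ?thesis using closest_point_subspace_eq[OF E] by simp
  qed
  then show "closest_point E x \<in> E" "x - closest_point E x \<in> orthogonal_comp E" by auto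
  note sub = E subspace_orthogonal_comp[of E]
  show "linear (closest_point E)"
  proof (rule linearI)
    fix a b :: 'a
    have "a + b = (closest_point E a + closest_point E b) + ((a - closest_point E a) + (b - closest_point E b))" by simp
    then show "closest_point E (a + b) = closest_point E a + closest_point E b"
      using closest_point_subspace_eq[OF E] * sub by (metis subspace_add)
  next
    fix c and a :: 'a
    have "c *\<^sub>R a = c *\<^sub>R closest_point E a + c *\<^sub>R (a - closest_point E a)" by (simp add: scaleR_diff_right)
    then show "closest_point E (c *\<^sub>R a) = c *\<^sub>R closest_point E a"
      using closest_point_subspace_eq[OF E] * sub by (metis subspace_scale)
  qed
qed

lemma linear_image_plus:
  assumes "linear f"
  shows "f ` (A + B) = f ` A + f ` B"
  unfolding set_plus_image
  by (auto simp: image_iff linear_add[OF assms]) (metis SigmaI linear_add[OF assms] split_conv)+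

lemma linear_image_segment_0:
  assumes "linear f"
  shows "f ` closed_segment 0 v = closed_segment 0 (f v)"
  using closed_segment_linear_image[OF assms, of 0 v] by (simp add: linear_0[OF assms])

lemma compact_linear_image:
  fixes f :: "'a::euclidean_space \<Rightarrow> 'b::euclidean_space"
  assumes "linear f" "compact A"
  shows "compact (f ` A)"
  using assms by (intro compact_continuous_image linear_continuous_on) (auto simp: linear_conv_bounded_linear)

lemma nat_mult_bounded_imp_nonpos:
  fixes x c :: real
  assumes "\<And>N::nat. real N * x \<le> c"
  shows "x \<le> 0"
proof (rule ccontr)
  assume "\<not> x \<le> 0"
  then obtain N where "c < real N * x" using reals_Archimedean3[of x] by auto
  then show False using assms[of N] by simp
qed

text \<open>A convex body and its projection along \<open>g\<close> differ by a bounded shift in the direction \<open>g\<close>,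
  so adding long segments makes their volumes grow at the same rate.\<close>

lemma vol_plus_segment_projection:
  fixes A :: "'a::euclidean_space set" and g :: 'a
  assumes A: "compact A" "convex A" and g: "g \<noteq> 0"
  shows "vol (A + closed_segment 0 g) - vol A = vol (closest_point {x. g \<bullet> x = 0} ` A + closed_segment 0 g)"
proof -
  let ?H = "{x. g \<bullet> x = 0}"
  have H: "subspace ?H" by (rule subspace_hyperplane)
  define P where "P = closest_point ?H"
  have lin: "linear P" unfolding P_def by (rule linear_closest_point_subspace[OF H])
  define \<tau> where "\<tau> x = (g \<bullet> x) / (g \<bullet> g)" for x
  have gg: "g \<bullet> g \<noteq> 0" using g by simp
  have P: "x = P x + \<tau> x *\<^sub>R g" for x
  proof -
    have "x - \<tau> x *\<^sub>R g \<in> ?H" using gg by (simp add: \<tau>_def inner_diff_right)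
    moreover have "\<tau> x *\<^sub>R g \<in> orthogonal_comp ?H"
      by (auto simp: orthogonal_comp_def orthogonal_def inner_commute)
    ultimately have "P ((x - \<tau> x *\<^sub>R g) + \<tau> x *\<^sub>R g) = x - \<tau> x *\<^sub>R g"
      unfolding P_def by (rule closest_point_subspace_eq[OF H])
    then show ?thesis by simp
  qed
  obtain r where r: "A \<subseteq> cball 0 r" using compact_subset_cball[OF A(1)] .
  \<comment> \<open>A natural number bounds the shifts, so that the lengthened segment is again a
    natural multiple of \<open>g\<close> and the linear growth law applies to it.\<close>
  obtain R :: nat where R: "norm g * r / (g \<bullet> g) \<le> real R" using real_arch_simple by blast
  have \<tau>: "\<bar>\<tau> a\<bar> \<le> real R" if "a \<in> A" for a
  proof -
    have "\<bar>g \<bullet> a\<bar> \<le> norm g * norm a" by (rule Cauchy_Schwarz_ineq2)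
    also have "\<dots> \<le> norm g * r" using r that by (intro mult_left_mono) auto
    finally have "\<bar>\<tau> a\<bar> \<le> norm g * r / (g \<bullet> g)" by (simp add: \<tau>_def abs_div divide_right_mono)
    then show ?thesis using R by simp
  qed
  have PA: "compact (P ` A)" "convex (P ` A)"
    using lin A by (auto intro: compact_linear_image convex_linear_image)
  have seg: "x + s *\<^sub>R g \<in> X + closed_segment 0 (c *\<^sub>R g)" if "x \<in> X" "0 \<le> s" "s \<le> c" for x :: 'a and X s c
  proof -
    have "s *\<^sub>R g = (s / c) *\<^sub>R (c *\<^sub>R g)" using that by (cases "c = 0") auto
    then show ?thesis unfolding in_plus_segment using that
      by (intro bexI[of _ x] exI[of _ "s / c"]) (auto simp: divide_le_eq_1)
  qed
  \<comment> \<open>Starting earlier by \<open>R\<close> and lengthening by \<open>2 * R\<close>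
    absorbs a shift of size at most \<open>R\<close> in either direction.\<close>
  have incl: "X + closed_segment 0 (real N *\<^sub>R g) \<subseteq> (+) (- real R *\<^sub>R g) ` (Y + closed_segment 0 (real (N + 2 * R) *\<^sub>R g))"
    if XY: "\<And>x. x \<in> X \<Longrightarrow> \<exists>y\<in>Y. \<exists>t. \<bar>t\<bar> \<le> real R \<and> x = y + t *\<^sub>R g" for X Y N
  proof
    fix z assume "z \<in> X + closed_segment 0 (real N *\<^sub>R g)"
    then obtain x s where xs: "x \<in> X" "0 \<le> s" "s \<le> 1" "z = x + s *\<^sub>R real N *\<^sub>R g" unfolding in_plus_segment by blast
    obtain y t where y: "y \<in> Y" "\<bar>t\<bar> \<le> real R" "x = y + t *\<^sub>R g" using XY[OF xs(1)] by blast
    have "s * real N \<le> real N" "0 \<le> s * real N" using xs by (simp_all add: mult_left_le_one_le)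
    then have "y + (t + s * real N + real R) *\<^sub>R g \<in> Y + closed_segment 0 (real (N + 2 * R) *\<^sub>R g)"
      using y by (intro seg) auto
    moreover have "z = - real R *\<^sub>R g + (y + (t + s * real N + real R) *\<^sub>R g)"
      unfolding xs(4) y(3) by (simp add: algebra_simps)
    ultimately show "z \<in> (+) (- real R *\<^sub>R g) ` (Y + closed_segment 0 (real (N + 2 * R) *\<^sub>R g))" by blast
  qed
  let ?W = "\<lambda>X. vol (X + closed_segment 0 g) - vol X"
  have grow: "vol X + real N * ?W X \<le> vol Y + real (N + 2 * R) * ?W Y"
    if X: "compact X" "convex X" and Y: "compact Y" "convex Y"
      and XY: "\<And>x. x \<in> X \<Longrightarrow> \<exists>y\<in>Y. \<exists>t. \<bar>t\<bar> \<le> real R \<and> x = y + t *\<^sub>R g" for X Y N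
  proof -
    have cY: "compact (Y + closed_segment 0 (real (N + 2 * R) *\<^sub>R g))" by (intro compact_set_plus Y compact_segment)
    have "vol (X + closed_segment 0 (real N *\<^sub>R g)) \<le> vol ((+) (- real R *\<^sub>R g) ` (Y + closed_segment 0 (real (N + 2 * R) *\<^sub>R g)))"
      by (intro vol_mono incl XY compact_set_plus X compact_segment compact_translation cY)
    also have "\<dots> = vol (Y + closed_segment 0 (real (N + 2 * R) *\<^sub>R g))"
      by (rule vol_translate[OF borel_compact[OF cY]])
    finally show ?thesis
      using vol_plus_segment_scale[OF X, of N g] vol_plus_segment_scale[OF Y, of "N + 2 * R" g] by linarith
  qed
  have AP: "\<exists>y\<in>P ` A. \<exists>t. \<bar>t\<bar> \<le> real R \<and> x = y + t *\<^sub>R g" if "x \<in> A" for x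
    using P[of x] \<tau>[OF that] that by blast
  have PA': "\<exists>y\<in>A. \<exists>t. \<bar>t\<bar> \<le> real R \<and> x = y + t *\<^sub>R g" if x: "x \<in> P ` A" for x
  proof -
    obtain a where a: "a \<in> A" "x = P a" using x by blast
    have "x = a + (- \<tau> a) *\<^sub>R g" using P[of a] a(2) by (simp add: algebra_simps)
    then show ?thesis using a(1) \<tau>[OF a(1)] by (intro bexI[of _ a] exI[of _ "- \<tau> a"]) auto
  qed
  have "real N * (?W A - ?W (P ` A)) \<le> vol (P ` A) + real (2 * R) * ?W (P ` A) - vol A" for N
    using grow[OF A PA AP, of N] by (simp add: algebra_simps)
  then have "?W A - ?W (P ` A) \<le> 0" by (rule nat_mult_bounded_imp_nonpos)
  moreover have "real N * (?W (P ` A) - ?W A) \<le> vol A + real (2 * R) * ?W A - vol (P ` A)" for N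
    using grow[OF PA A PA', of N] by (simp add: algebra_simps)
  then have "?W (P ` A) - ?W A \<le> 0" by (rule nat_mult_bounded_imp_nonpos)
  \<comment> \<open>The projection lies in a hyperplane, so its own volume drops out of the
    difference on the right.\<close>
  moreover have "vol (P ` A) = 0"
  proof -
    have "P ` A \<subseteq> ?H" using closest_point_subspace_in[OF H] unfolding P_def by blast
    then have "negligible (P ` A)" using negligible_hyperplane[of g 0] g negligible_subset by blast
    then have "measure lebesgue (P ` A) = 0" by (rule negligible_imp_measure0)
    moreover have "P ` A \<in> sets borel" using PA(1) by (rule borel_compact)
    ultimately show ?thesis by (simp add: measure_completion)
  qed
  ultimately show ?thesis unfolding P_def by linarith
qed

text \<open>In the second alternative \<open>E\<close> is constructed as the orthogonal complement
  of the first \<open>k\<close> directions, and \<open>Z\<close> as the box spanned by their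
  orthogonalised residues. Linearly dependent directions lead to the first alternative. Since
  \<open>E\<close> and \<open>Z\<close> are chosen before \<open>A\<close>, a body and the unit ball
  can later be compared through the same projection.\<close>

lemma segment_diff_projection:
  fixes v :: "nat \<Rightarrow> 'a::euclidean_space"
  shows "(\<forall>A. compact A \<longrightarrow> convex A \<longrightarrow> A \<noteq> {} \<longrightarrow> segment_diff k A v = 0) \<or>
    (\<exists>E Z. subspace E \<and> dim E + k = DIM('a) \<and> compact Z \<and> convex Z \<and> Z \<subseteq> orthogonal_comp E \<and>
       (\<forall>A. compact A \<longrightarrow> convex A \<longrightarrow> A \<noteq> {} \<longrightarrow> segment_diff k A v = vol (closest_point E ` A + Z)))"
proof (induction k arbitrary: v)
  case 0
  have cp: "closest_point UNIV ` A = A" for A :: "'a set" by (simp add: closest_point_self)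
  have zero: "A + {0} = A" for A :: "'a set" by (metis add.right_neutral set_zero)
  have "{0} \<subseteq> orthogonal_comp (UNIV :: 'a set)" by (simp add: orthogonal_comp_def orthogonal_def)
  moreover have "segment_diff 0 A v = vol (closest_point UNIV ` A + {0})" for A by (simp only: segment_diff.simps cp zero)
  ultimately show ?case
    by (intro disjI2 exI[of _ UNIV] exI[of _ "{0}"]) simp
next
  case (Suc k)
  let ?v = "\<lambda>i. v (Suc i)"
  have ccn: "compact (A + closed_segment 0 (v 0))" "convex (A + closed_segment 0 (v 0))" "A + closed_segment 0 (v 0) \<noteq> {}"
    if "compact A" "convex A" "A \<noteq> {}" for A
  proof -
    show "compact (A + closed_segment 0 (v 0))" "convex (A + closed_segment 0 (v 0))"
      by (intro compact_set_plus convex_set_plus that compact_segment convex_closed_segment)+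
    show "A + closed_segment 0 (v 0) \<noteq> {}" using that(3) unfolding set_plus_def by blast
  qed
  from Suc.IH[of ?v] consider
    (zero) "\<And>A. compact A \<Longrightarrow> convex A \<Longrightarrow> A \<noteq> {} \<Longrightarrow> segment_diff k A ?v = 0"
  | (proj) E Z where "subspace E" "dim E + k = DIM('a)" "compact Z" "convex Z" "Z \<subseteq> orthogonal_comp E"
      "\<And>A. compact A \<Longrightarrow> convex A \<Longrightarrow> A \<noteq> {} \<Longrightarrow> segment_diff k A ?v = vol (closest_point E ` A + Z)"
    by metis
  then show ?case
  proof cases
    case zero
    have "segment_diff (Suc k) A v = 0" if "compact A" "convex A" "A \<noteq> {}" for A
      unfolding segment_diff.simps zero[OF ccn[OF that]] zero[OF that] by simp
    then show ?thesis by blast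
  next
    case proj
    note E = proj(1)
    let ?P = "closest_point E"
    have lin: "linear ?P" by (rule linear_closest_point_subspace[OF E])
    define w where "w = ?P (v 0)"
    have wE: "w \<in> E" unfolding w_def by (rule closest_point_subspace_in[OF E])
    have step: "segment_diff (Suc k) A v = vol (?P ` A + Z + closed_segment 0 w) - vol (?P ` A + Z)"
      if A: "compact A" "convex A" "A \<noteq> {}" for A
    proof -
      have "?P ` (A + closed_segment 0 (v 0)) + Z = ?P ` A + Z + closed_segment 0 w"
        unfolding linear_image_plus[OF lin] linear_image_segment_0[OF lin] w_def
        by (simp only: add.assoc add.commute[of Z])
      then show ?thesis using proj(6)[OF ccn[OF A]] proj(6)[OF A] by (simp only: segment_diff.simps)
    qed
    show ?thesis
    proof (cases "w = 0")
      case True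
      have zero: "B + closed_segment 0 0 = B" for B :: "'a set" unfolding closed_segment_idem by (metis add.right_neutral set_zero)
      have "segment_diff (Suc k) A v = 0" if "compact A" "convex A" "A \<noteq> {}" for A
        using step[OF that] unfolding True zero by simp
      then show ?thesis by blast
    next
      case False
      let ?H = "{x. w \<bullet> x = 0}"
      let ?Q = "closest_point ?H"
      define E' where "E' = E \<inter> ?H"
      have H: "subspace ?H" by (rule subspace_hyperplane)
      have linQ: "linear ?Q" by (rule linear_closest_point_subspace[OF H])
      have E': "subspace E'" unfolding E'_def by (rule subspace_inter[OF E H])
      have "dim {y \<in> E. \<forall>x\<in>span {w}. orthogonal x y} + dim (span {w}) = dim E"
        using wE E by (intro dim_subspace_orthogonal_to_vectors) (auto intro: span_minimal[THEN subsetD])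
      moreover have "{y \<in> E. \<forall>x\<in>span {w}. orthogonal x y} = E'"
        unfolding E'_def by (auto simp: span_singleton orthogonal_def inner_commute)
      moreover have "dim (span {w}) = 1" using False by simp
      ultimately have dim: "dim E' + Suc k = DIM('a)" using proj(2) by simp
      have w_orth: "c *\<^sub>R w \<in> orthogonal_comp ?H" for c
        by (auto simp: orthogonal_comp_def orthogonal_def inner_commute)
      have mono: "orthogonal_comp E \<subseteq> orthogonal_comp E'" "orthogonal_comp ?H \<subseteq> orthogonal_comp E'"
        unfolding E'_def by (auto simp: orthogonal_comp_def)
      have QZ: "?Q z = z" if "z \<in> Z" for z
      proof -
        have "z \<in> ?H" using proj(5) wE that by (auto simp: orthogonal_comp_def orthogonal_def)
        then show ?thesis by (rule closest_point_self)
      qed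
      then have QZ: "?Q ` Z = Z" by force
      \<comment> \<open>Projecting to \<open>E\<close> and then to the hyperplane orthogonal to
        \<open>w\<close> is one projection to \<open>E'\<close>, because \<open>w\<close> lies in
        \<open>E\<close> and the second displacement is a multiple of \<open>w\<close>.\<close>
      have QP: "?Q (?P x) = closest_point E' x" for x
      proof -
        have 1: "?P x - ?Q (?P x) \<in> orthogonal_comp ?H" by (rule closest_point_subspace_compl[OF H])
        have "orthogonal_comp ?H = span {w}"
        proof -
          have "?H = orthogonal_comp (span {w})" by (auto simp: orthogonal_comp_def span_singleton orthogonal_def inner_commute)
          then show ?thesis using orthogonal_comp_self[of "span {w}"] by (simp add: subspace_span)
        qed
        then have "?P x - ?Q (?P x) \<in> E" using 1 wE E by (metis empty_subsetI insert_subset span_minimal subsetD)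
        then have "?P x - (?P x - ?Q (?P x)) \<in> E"
          by (rule subspace_diff[OF E closest_point_subspace_in[OF E]])
        then have in': "?Q (?P x) \<in> E'" unfolding E'_def using closest_point_subspace_in[OF H, of "?P x"] by simp
        have "(?P x - ?Q (?P x)) + (x - ?P x) \<in> orthogonal_comp E'"
          using 1 closest_point_subspace_compl[OF E, of x] mono by (intro subspace_add[OF subspace_orthogonal_comp]) auto
        from closest_point_subspace_eq[OF E' in' this] show ?thesis by simp
      qed
      have eq: "segment_diff (Suc k) A v = vol (closest_point E' ` A + (Z + closed_segment 0 w))"
        if A: "compact A" "convex A" "A \<noteq> {}" for A
      proof -
        have B: "compact (?P ` A + Z)" "convex (?P ` A + Z)"
          by (intro compact_set_plus convex_set_plus compact_linear_image convex_linear_image lin A proj)+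
        have "segment_diff (Suc k) A v = vol (?Q ` (?P ` A + Z) + closed_segment 0 w)"
          unfolding step[OF A] by (rule vol_plus_segment_projection[OF B False])
        also have "?Q ` (?P ` A + Z) = closest_point E' ` A + Z"
          unfolding linear_image_plus[OF linQ] QZ image_image QP ..
        finally show ?thesis by (simp only: add.assoc)
      qed
      have orth: "Z + closed_segment 0 w \<subseteq> orthogonal_comp E'"
      proof
        fix x assume "x \<in> Z + closed_segment 0 w"
        then obtain z s where zs: "z \<in> Z" "x = z + s *\<^sub>R w" unfolding in_plus_segment by blast
        have "z \<in> orthogonal_comp E'" "s *\<^sub>R w \<in> orthogonal_comp E'"
          using zs(1) proj(5) mono w_orth[of s] by blast+
        then show "x \<in> orthogonal_comp E'"
          unfolding zs(2) by (rule subspace_add[OF subspace_orthogonal_comp])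
      qed
      have cc: "compact (Z + closed_segment 0 w)" "convex (Z + closed_segment 0 w)"
        by (intro compact_set_plus convex_set_plus proj compact_segment convex_closed_segment)+
      show ?thesis
        by (rule disjI2, rule exI[of _ E'], rule exI[of _ "Z + closed_segment 0 w"])
           (intro conjI allI impI E' dim cc orth eq)
    qed
  qed
qed

text \<open>There are too many directions to be independent: \<open>dim E + k = DIM('a)\<close> has
  no solution once \<open>k\<close> exceeds the dimension, which leaves the alternative that the
  difference vanishes.\<close>

lemma mean_diff_Suc_DIM:
  fixes A :: "'a::euclidean_space set"
  assumes "compact A" "convex A" "A \<noteq> {}"
  shows "mean_diff (Suc DIM('a)) A = 0"
proof -
  have "segment_diff (Suc DIM('a)) A v = 0" for v
    using segment_diff_projection[of "Suc DIM('a)" v] assms by auto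
  then have "segment_diff (Suc DIM('a)) A = (\<lambda>_. 0)" by (rule ext)
  then show ?thesis unfolding mean_diff_def by (simp only: Bochner_Integration.integral_zero)
qed

lemma steiner_formula:
  fixes L :: "(real^'n) set"
  assumes L: "compact L" "convex L" "L \<noteq> {}" and \<epsilon>: "\<epsilon> \<ge> 0"
  shows "vol (L + cball 0 \<epsilon>) = (\<Sum>i\<le>CARD('n). mean_diff i L / (fact i * grad_const TYPE('n) ^ i) * \<epsilon> ^ i)"
proof -
  have "mean_diff (0 + Suc CARD('n)) (L + cball 0 t) = 0" if "t \<ge> 0" for t
  proof -
    have "compact (L + cball 0 t)" "convex (L + cball 0 t)" by (intro compact_set_plus convex_set_plus L compact_cball convex_cball)+
    moreover have "L + cball 0 t \<noteq> {}"
    proof -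
      obtain x where "x \<in> L" using L(3) by blast
      then have "x + 0 \<in> L + cball 0 t" using that by (intro set_plus_intro) auto
      then show ?thesis by blast
    qed
    ultimately show ?thesis using mean_diff_Suc_DIM[of "L + cball 0 t"] by simp
  qed
  from mean_diff_polynomial[OF L \<epsilon> this]
  have "mean_diff 0 (L + cball 0 \<epsilon>) = (\<Sum>i<Suc CARD('n). mean_diff (0 + i) L * \<epsilon> ^ i / (fact i * grad_const TYPE('n) ^ i))" .
  moreover have "mean_diff 0 A = vol A" for A :: "(real^'n) set"
  proof -
    have "segment_diff 0 A = (\<lambda>_. vol A)" by (rule ext) simp
    then show ?thesis unfolding mean_diff_def using prob_space.prob_space[OF prob_space_PiM[of "UNIV :: nat set" "\<lambda>_. ball_measure :: (real^'n) measure", OF prob_space_ball_measure]]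
      by simp
  qed
  ultimately show ?thesis by (simp add: lessThan_Suc_atMost del: sum.lessThan_Suc)
qed

section \<open>Lebesgue measure on subspaces\<close>

lemma sets_subspace_lborel [measurable_cong]: "sets (subspace_lborel E) = sets (restrict_space borel E)"
  by (simp add: subspace_lborel_def Let_def)

lemma space_subspace_lborel [simp]: "space (subspace_lborel E) = E"
  by (simp add: subspace_lborel_def Let_def space_restrict_space)

lemma measurable_subspace_lborelI:
  assumes "f \<in> borel_measurable borel"
  shows "f \<in> borel_measurable (subspace_lborel E)"
  using measurable_restrict_space1[OF assms, of E] by (simp cong: measurable_cong_sets add: sets_subspace_lborel)

lemma orthonormal_basis_exists:
  fixes E :: "(real^'n) set"
  assumes "subspace E"
  shows "\<exists>B. orthonormal_basis_of E B"
proof -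
  obtain B where "pairwise orthogonal B" "\<And>x. x \<in> B \<Longrightarrow> norm x = 1" "span B = E"
    by (rule orthonormal_basis_subspace[OF assms]) metis
  then show ?thesis unfolding orthonormal_basis_of_def by blast
qed

lemma orthonormal_basisD:
  fixes E :: "(real^'n) set"
  assumes "orthonormal_basis_of E B"
  shows "independent B" "finite B" "card B = dim E" "span B = E" "\<And>b. b \<in> B \<Longrightarrow> b \<in> E"
    "\<And>b c. b \<in> B \<Longrightarrow> c \<in> B \<Longrightarrow> b \<bullet> c = (if b = c then 1 else 0)"
proof -
  have *: "pairwise orthogonal B" "\<And>b. b \<in> B \<Longrightarrow> norm b = 1" and sp: "span B = E"
    using assms by (auto simp: orthonormal_basis_of_def)
  have "0 \<notin> B" using *(2) by force
  then show ind: "independent B" by (rule pairwise_orthogonal_independent[OF *(1)])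
  then show "finite B" by (rule independent_imp_finite)
  show "span B = E" by (rule sp)
  then show "b \<in> E" if "b \<in> B" for b using that span_base by blast
  show "card B = dim E" using dim_span_eq_card_independent[OF ind] sp by simp
  show "b \<bullet> c = (if b = c then 1 else 0)" if "b \<in> B" "c \<in> B" for b c
    using * that by (auto simp: pairwise_def orthogonal_def dot_square_norm)
qed

lemma norm_orthonormal_sum:
  fixes E :: "(real^'n) set"
  assumes B: "orthonormal_basis_of E B"
  shows "norm (\<Sum>b\<in>B. c b *\<^sub>R b) = sqrt (\<Sum>b\<in>B. (c b)\<^sup>2)"
proof -
  note D = orthonormal_basisD[OF B]
  have coord: "b \<bullet> (\<Sum>b\<in>B. c b *\<^sub>R b) = c b" if "b \<in> B" for b
  proof -
    have "b \<bullet> (\<Sum>b\<in>B. c b *\<^sub>R b) = (\<Sum>b'\<in>B. if b = b' then c b' else 0)"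
      unfolding inner_sum_right using D(6)[OF that] by (intro sum.cong refl) simp
    then show ?thesis using D(2) that by simp
  qed
  have "(\<Sum>b\<in>B. c b *\<^sub>R b) \<bullet> (\<Sum>b\<in>B. c b *\<^sub>R b) = (\<Sum>b\<in>B. c b * (b \<bullet> (\<Sum>b\<in>B. c b *\<^sub>R b)))"
    unfolding inner_sum_left by simp
  also have "\<dots> = (\<Sum>b\<in>B. c b * c b)"
    by (intro sum.cong refl) (simp add: coord)
  finally show ?thesis by (simp add: norm_eq_sqrt_inner power2_eq_square)
qed

interpretation lborel_product: product_sigma_finite "\<lambda>_. lborel :: real measure"
  by standard

lemma PiM_reindex:
  assumes I: "finite I" and h: "bij_betw h I J"
  shows "distr (PiM I (\<lambda>_. lborel :: real measure)) (PiM J (\<lambda>_. lborel)) (\<lambda>c. \<lambda>j\<in>J. c (inv_into I h j)) = PiM J (\<lambda>_. lborel)"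
proof (rule lborel_product.PiM_eqI)
  show "finite J" using I h bij_betw_finite by blast
  have inv: "inv_into I h j \<in> I" if "j \<in> J" for j using h that by (auto simp: bij_betw_def inv_into_into)
  have m: "(\<lambda>c. \<lambda>j\<in>J. c (inv_into I h j)) \<in> measurable (PiM I (\<lambda>_. lborel :: real measure)) (PiM J (\<lambda>_. lborel))"
    using inv by (intro measurable_restrict measurable_component_singleton)
  fix A assume A: "\<And>j. j \<in> J \<Longrightarrow> A j \<in> sets (lborel :: real measure)"
  have hi: "h i \<in> J" if "i \<in> I" for i using h that by (auto simp: bij_betw_def)
  have ih: "inv_into I h (h i) = i" if "i \<in> I" for i using h that by (auto simp: bij_betw_def inv_into_f_f)
  have hj: "h (inv_into I h j) = j" if "j \<in> J" for j using h that by (auto simp: bij_betw_def f_inv_into_f)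
  have pre: "(\<lambda>c. \<lambda>j\<in>J. c (inv_into I h j)) -` Pi\<^sub>E J A \<inter> space (PiM I (\<lambda>_. lborel)) = Pi\<^sub>E I (\<lambda>i. A (h i))"
  proof (intro equalityI subsetI)
    fix c assume c: "c \<in> (\<lambda>c. \<lambda>j\<in>J. c (inv_into I h j)) -` Pi\<^sub>E J A \<inter> space (PiM I (\<lambda>_. lborel))"
    then have "c (inv_into I h (h i)) \<in> A (h i)" if "i \<in> I" for i using hi[OF that] by (auto simp: PiE_iff)
    then show "c \<in> Pi\<^sub>E I (\<lambda>i. A (h i))" using c ih by (auto simp: space_PiM PiE_iff)
  next
    fix c assume c: "c \<in> Pi\<^sub>E I (\<lambda>i. A (h i))"
    then have "c (inv_into I h j) \<in> A (h (inv_into I h j))" if "j \<in> J" for j using inv[OF that] by (auto simp: PiE_iff)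
    then show "c \<in> (\<lambda>c. \<lambda>j\<in>J. c (inv_into I h j)) -` Pi\<^sub>E J A \<inter> space (PiM I (\<lambda>_. lborel))"
      using c hj by (auto simp: space_PiM PiE_iff)
  qed
  have "emeasure (distr (PiM I (\<lambda>_. lborel)) (PiM J (\<lambda>_. lborel)) (\<lambda>c. \<lambda>j\<in>J. c (inv_into I h j))) (Pi\<^sub>E J A)
      = emeasure (PiM I (\<lambda>_. lborel)) (Pi\<^sub>E I (\<lambda>i. A (h i)))"
    unfolding pre[symmetric] using \<open>finite J\<close> A by (intro emeasure_distr m sets_PiM_I_finite) auto
  also have "\<dots> = (\<Prod>i\<in>I. emeasure lborel (A (h i)))"
    using I A hi by (intro lborel_product.emeasure_PiM) auto
  also have "\<dots> = (\<Prod>j\<in>J. emeasure lborel (A j))"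
    using prod.reindex_bij_betw[OF h, of "\<lambda>j. emeasure lborel (A j)"] .
  finally show "emeasure (distr (PiM I (\<lambda>_. lborel)) (PiM J (\<lambda>_. lborel)) (\<lambda>c. \<lambda>j\<in>J. c (inv_into I h j))) (Pi\<^sub>E J A)
    = (\<Prod>j\<in>J. emeasure lborel (A j))" .
qed simp

lemma measurable_coord_sum [measurable]:
  fixes B :: "'a::euclidean_space set"
  shows "(\<lambda>c. \<Sum>b\<in>B. c b *\<^sub>R b) \<in> measurable (PiM B (\<lambda>_. lborel :: real measure)) borel"
  by (intro borel_measurable_sum borel_measurable_scaleR borel_measurable_const)
     (simp cong: measurable_cong_sets add: measurable_component_singleton)

text \<open>The orthogonal map that sends the standard basis to \<open>B\<close> preserves Lebesgue
  measure; what remains is a renaming of the index set of the product.\<close>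

lemma lborel_orthonormal_basis:
  fixes B :: "(real^'n) set"
  assumes B: "orthonormal_basis_of UNIV B"
  shows "lborel = distr (PiM B (\<lambda>_. lborel)) borel (\<lambda>c. \<Sum>b\<in>B. c b *\<^sub>R b)"
proof -
  note D = orthonormal_basisD[OF B]
  have "card (Basis :: (real^'n) set) = card B" using D(3) by (simp add: dim_UNIV)
  from finite_same_card_bij[OF finite_Basis D(2) this]
  obtain h where h: "bij_betw h (Basis :: (real^'n) set) B" ..
  have hB: "h i \<in> B" if "i \<in> Basis" for i using h that by (auto simp: bij_betw_def)
  have hinj: "h i = h j \<longleftrightarrow> i = j" if "i \<in> Basis" "j \<in> Basis" for i j
    using h that by (auto simp: bij_betw_def inj_on_def)
  define f where "f x = (\<Sum>i\<in>Basis. (x \<bullet> i) *\<^sub>R h i)" for x :: "real^'n"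
  have lin: "linear f"
    unfolding f_def by (rule linearI) (simp_all add: inner_add_left scaleR_add_left sum.distrib scaleR_sum_right)
  have hf: "h i \<bullet> f w = w \<bullet> i" if "i \<in> Basis" for i w
  proof -
    have "h i \<bullet> f w = (\<Sum>j\<in>Basis. if i = j then w \<bullet> j else 0)"
      unfolding f_def inner_sum_right using D(6) hB hinj that by (intro sum.cong refl) simp
    then show ?thesis using that by simp
  qed
  have "f v \<bullet> f w = v \<bullet> w" for v w
  proof -
    have "f v \<bullet> f w = (\<Sum>i\<in>Basis. (v \<bullet> i) * (h i \<bullet> f w))"
      by (subst f_def) (simp add: inner_sum_left)
    also have "\<dots> = (\<Sum>i\<in>Basis. (v \<bullet> i) * (w \<bullet> i))"
      by (intro sum.cong refl) (simp add: hf)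
    finally show ?thesis by (simp add: euclidean_inner[of v w])
  qed
  then have f: "orthogonal_transformation f" using lin by (simp add: orthogonal_transformation_def)
  have mf [measurable]: "f \<in> borel_measurable borel"
    by (rule borel_measurable_linear[OF lin])
  let ?R = "\<lambda>c. \<lambda>j\<in>B. c (inv_into Basis h j)"
  have inv: "inv_into Basis h j \<in> Basis" if "j \<in> B" for j using h that by (auto simp: bij_betw_def inv_into_into)
  have m: "?R \<in> measurable (PiM Basis (\<lambda>_. lborel :: real measure)) (PiM B (\<lambda>_. lborel))"
    using inv by (intro measurable_restrict measurable_component_singleton)
  have "lborel = distr lborel borel f" by (rule distr_lborel_orthogonal_transformation[OF f, symmetric])
  also have "\<dots> = distr (PiM Basis (\<lambda>_. lborel)) borel (f \<circ> (\<lambda>c. \<Sum>b\<in>Basis. c b *\<^sub>R b))"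
    by (subst lborel_eq, subst distr_distr) auto
  also have "f \<circ> (\<lambda>c. \<Sum>b\<in>Basis. c b *\<^sub>R b) = (\<lambda>c. \<Sum>b\<in>B. c b *\<^sub>R b) \<circ> ?R"
  proof
    fix c :: "real^'n \<Rightarrow> real"
    have "(f \<circ> (\<lambda>c. \<Sum>b\<in>Basis. c b *\<^sub>R b)) c = (\<Sum>i\<in>Basis. c i *\<^sub>R h i)"
      by (simp add: f_def inner_sum_left_Basis)
    also have "\<dots> = (\<Sum>i\<in>Basis. ?R c (h i) *\<^sub>R h i)"
      using h by (intro sum.cong refl) (auto simp: hB bij_betw_def inv_into_f_f)
    also have "\<dots> = (\<Sum>b\<in>B. ?R c b *\<^sub>R b)" by (rule sum.reindex_bij_betw[OF h])
    finally show "(f \<circ> (\<lambda>c. \<Sum>b\<in>Basis. c b *\<^sub>R b)) c = ((\<lambda>c. \<Sum>b\<in>B. c b *\<^sub>R b) \<circ> ?R) c" by simp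
  qed
  also have "distr (PiM Basis (\<lambda>_. lborel)) borel \<dots> = distr (distr (PiM Basis (\<lambda>_. lborel)) (PiM B (\<lambda>_. lborel)) ?R) borel (\<lambda>c. \<Sum>b\<in>B. c b *\<^sub>R b)"
    by (rule distr_distr[OF measurable_coord_sum m, symmetric])
  also have "\<dots> = distr (PiM B (\<lambda>_. lborel)) borel (\<lambda>c. \<Sum>b\<in>B. c b *\<^sub>R b)"
    by (simp only: PiM_reindex[OF finite_Basis h])
  finally show ?thesis .
qed

text \<open>Names the basis chosen inside \<open>subspace_lborel\<close>, so that the measure can be
  unfolded.\<close>

definition onb :: "(real^'n) set \<Rightarrow> (real^'n) set" where
  "onb E = (SOME B. orthonormal_basis_of E B)"

lemma onb:
  fixes E :: "(real^'n) set"
  assumes "subspace E"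
  shows "orthonormal_basis_of E (onb E)"
  unfolding onb_def using orthonormal_basis_exists[OF assms] by (rule someI_ex)

lemma subspace_lborel_onb:
  "subspace_lborel E = distr (PiM (onb E) (\<lambda>_. lborel)) (restrict_space borel E) (\<lambda>c. \<Sum>b\<in>onb E. c b *\<^sub>R b)"
  by (simp add: subspace_lborel_def onb_def Let_def)

lemma measurable_onb_sum:
  fixes E :: "(real^'n) set"
  assumes E: "subspace E"
  shows "(\<lambda>c. \<Sum>b\<in>onb E. c b *\<^sub>R b) \<in> measurable (PiM (onb E) (\<lambda>_. lborel)) (restrict_space borel E)"
proof (rule measurable_restrict_space2)
  note D = orthonormal_basisD[OF onb[OF E]]
  show "(\<lambda>c. \<Sum>b\<in>onb E. c b *\<^sub>R b) \<in> space (PiM (onb E) (\<lambda>_. lborel)) \<rightarrow> E"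
    using E D by (auto intro!: subspace_sum subspace_scale)
qed (rule measurable_coord_sum)

lemma nn_integral_subspace_lborel:
  fixes E :: "(real^'n) set"
  assumes E: "subspace E" and g: "g \<in> borel_measurable (subspace_lborel E)"
  shows "(\<integral>\<^sup>+y. g y \<partial>subspace_lborel E) = (\<integral>\<^sup>+c. g (\<Sum>b\<in>onb E. c b *\<^sub>R b) \<partial>PiM (onb E) (\<lambda>_. lborel))"
  unfolding subspace_lborel_onb
  using g by (intro nn_integral_distr measurable_onb_sum[OF E]) (simp cong: measurable_cong_sets add: sets_subspace_lborel)

lemma emeasure_subspace_cball:
  fixes E :: "(real^'n) set"
  assumes E: "subspace E" and r: "r > 0"
  shows "emeasure (subspace_lborel E) (E \<inter> cball 0 r) = ennreal (unit_ball_vol (real (dim E)) * r ^ dim E)"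
proof -
  note D = orthonormal_basisD[OF onb[OF E]]
  have "emeasure (subspace_lborel E) (E \<inter> cball 0 r)
     = emeasure (PiM (onb E) (\<lambda>_. lborel)) ((\<lambda>c. \<Sum>b\<in>onb E. c b *\<^sub>R b) -` (E \<inter> cball 0 r) \<inter> space (PiM (onb E) (\<lambda>_. lborel)))"
    unfolding subspace_lborel_onb
    by (intro emeasure_distr measurable_onb_sum[OF E]) (auto simp: sets_restrict_space)
  also have "(\<lambda>c. \<Sum>b\<in>onb E. c b *\<^sub>R b) -` (E \<inter> cball 0 r) \<inter> space (PiM (onb E) (\<lambda>_. lborel))
     = {c. sqrt (\<Sum>b\<in>onb E. (c b)\<^sup>2) \<le> r} \<inter> space (PiM (onb E) (\<lambda>_. lborel))"
  proof -
    have "(\<Sum>b\<in>onb E. c b *\<^sub>R b) \<in> E" for c using E D by (auto intro!: subspace_sum subspace_scale)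
    then show ?thesis by (auto simp: norm_orthonormal_sum[OF onb[OF E]])
  qed
  also have "emeasure (PiM (onb E) (\<lambda>_. lborel)) \<dots> = ennreal (unit_ball_vol (real (dim E)) * r ^ dim E)"
    using emeasure_cball_aux[OF D(2) r] D(3) by simp
  finally show ?thesis .
qed

lemma sigma_finite_subspace_lborel:
  fixes E :: "(real^'n) set"
  assumes E: "subspace E"
  shows "sigma_finite_measure (subspace_lborel E)"
proof
  show "\<exists>A. countable A \<and> A \<subseteq> sets (subspace_lborel E) \<and> \<Union> A = space (subspace_lborel E) \<and> (\<forall>a\<in>A. emeasure (subspace_lborel E) a \<noteq> \<infinity>)"
  proof (intro exI[of _ "range (\<lambda>k::nat. E \<inter> cball 0 (real (Suc k)))"] conjI)
    show "\<Union> (range (\<lambda>k::nat. E \<inter> cball 0 (real (Suc k)))) = space (subspace_lborel E)"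
    proof -
      have "\<exists>k. norm x \<le> 1 + real k" for x :: "real^'n"
      proof -
        obtain k where "norm x \<le> real k" using real_arch_simple by blast
        then have "norm x \<le> 1 + real k" by linarith
        then show ?thesis ..
      qed
      then show ?thesis by auto
    qed
    show "range (\<lambda>k::nat. E \<inter> cball 0 (real (Suc k))) \<subseteq> sets (subspace_lborel E)"
      by (auto simp: sets_subspace_lborel sets_restrict_space)
    show "\<forall>a\<in>range (\<lambda>k::nat. E \<inter> cball 0 (real (Suc k))). emeasure (subspace_lborel E) a \<noteq> \<infinity>"
      using emeasure_subspace_cball[OF E] by (auto simp del: of_nat_Suc)
  qed simp
qed

lemma orthonormal_basis_Un:
  fixes E :: "(real^'n) set"
  assumes E: "subspace E"
  shows "orthonormal_basis_of UNIV (onb E \<union> onb (orthogonal_comp E))" "onb E \<inter> onb (orthogonal_comp E) = {}"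
proof -
  let ?F = "orthogonal_comp E"
  have F: "subspace ?F" by (rule subspace_orthogonal_comp)
  note DE = orthonormal_basisD[OF onb[OF E]] and DF = orthonormal_basisD[OF onb[OF F]]
  have orth: "orthogonal b c" if "b \<in> onb E" "c \<in> onb ?F" for b c
    using DE(5)[OF that(1)] DF(5)[OF that(2)] by (auto simp: orthogonal_comp_def)
  show "onb E \<inter> onb ?F = {}"
  proof (rule ccontr)
    assume "onb E \<inter> onb ?F \<noteq> {}"
    then obtain b where b: "b \<in> onb E" "b \<in> onb ?F" by blast
    then show False using orth[OF b] DE(6)[OF b(1) b(1)] by (simp add: orthogonal_def)
  qed
  have pw: "pairwise orthogonal (onb E \<union> onb ?F)"
  proof (rule pairwiseI)
    fix b c assume "b \<in> onb E \<union> onb ?F" "c \<in> onb E \<union> onb ?F" "b \<noteq> c"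
    then consider "b \<in> onb E" "c \<in> onb E" | "b \<in> onb ?F" "c \<in> onb ?F" | "b \<in> onb E" "c \<in> onb ?F" | "c \<in> onb E" "b \<in> onb ?F"
      by blast
    then show "orthogonal b c"
    proof cases
      case 1
      then show ?thesis using DE(6) \<open>b \<noteq> c\<close> by (simp add: orthogonal_def)
    next
      case 2
      then show ?thesis using DF(6) \<open>b \<noteq> c\<close> by (simp add: orthogonal_def)
    next
      case 3
      then show ?thesis by (rule orth)
    next
      case 4
      then show ?thesis using orth orthogonal_commute by blast
    qed
  qed
  have "x \<in> span (onb E \<union> onb ?F)" for x
  proof -
    obtain y z where "y \<in> E" "z \<in> ?F" "x = y + z" using subspace_decomp[OF E] .
    then have "y \<in> span (onb E \<union> onb ?F)" "z \<in> span (onb E \<union> onb ?F)"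
      using DE(4) DF(4) span_mono[of "onb E" "onb E \<union> onb ?F"] span_mono[of "onb ?F" "onb E \<union> onb ?F"] by blast+
    then show ?thesis unfolding \<open>x = y + z\<close> by (rule span_add)
  qed
  then have "span (onb E \<union> onb ?F) = UNIV" by blast
  then show "orthonormal_basis_of UNIV (onb E \<union> onb ?F)"
    using pw onb[OF E] onb[OF F] unfolding orthonormal_basis_of_def by blast
qed

text \<open>The bases chosen for \<open>E\<close> and for its complement unite to an orthonormal
  basis of the whole space, so merging coordinates gives Lebesgue measure. In this way independence
  of the basis is called upon only in full dimension.\<close>

lemma distr_subspace_lborel_sum:
  fixes E :: "(real^'n) set"
  assumes E: "subspace E"
  shows "distr (subspace_lborel E \<Otimes>\<^sub>M subspace_lborel (orthogonal_comp E)) borel (\<lambda>(x, y). x + y) = lborel"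
proof -
  let ?F = "orthogonal_comp E"
  have F: "subspace ?F" by (rule subspace_orthogonal_comp)
  note DE = orthonormal_basisD[OF onb[OF E]] and DF = orthonormal_basisD[OF onb[OF F]]
  let ?PE = "PiM (onb E) (\<lambda>_. lborel :: real measure)" and ?PF = "PiM (onb ?F) (\<lambda>_. lborel :: real measure)"
  let ?P = "PiM (onb E \<union> onb ?F) (\<lambda>_. lborel :: real measure)"
  let ?sE = "\<lambda>c. \<Sum>b\<in>onb E. c b *\<^sub>R b" and ?sF = "\<lambda>c. \<Sum>b\<in>onb ?F. c b *\<^sub>R b"
  have sf: "sigma_finite_measure (distr ?PF (restrict_space borel ?F) ?sF)"
    using sigma_finite_subspace_lborel[OF F] unfolding subspace_lborel_onb .
  have add: "(\<lambda>(x, y). x + y) \<in> measurable (restrict_space borel E \<Otimes>\<^sub>M restrict_space borel ?F) (borel :: (real^'n) measure)"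
  proof -
    have 1: "fst \<in> measurable (restrict_space borel E \<Otimes>\<^sub>M restrict_space borel ?F) borel"
      by (rule measurable_compose[OF measurable_fst measurable_restrict_space1]) simp
    have 2: "snd \<in> measurable (restrict_space borel E \<Otimes>\<^sub>M restrict_space borel ?F) borel"
      by (rule measurable_compose[OF measurable_snd measurable_restrict_space1]) simp
    show ?thesis unfolding split_beta by (rule borel_measurable_add[OF 1 2])
  qed
  have "distr (subspace_lborel E \<Otimes>\<^sub>M subspace_lborel ?F) borel (\<lambda>(x, y). x + y)
    = distr (distr (?PE \<Otimes>\<^sub>M ?PF) (restrict_space borel E \<Otimes>\<^sub>M restrict_space borel ?F) (\<lambda>(x, y). (?sE x, ?sF y))) borel (\<lambda>(x, y). x + y)"
    unfolding subspace_lborel_onb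
    by (subst pair_measure_distr[OF measurable_onb_sum[OF E] measurable_onb_sum[OF F] sf]) simp
  also have "\<dots> = distr (?PE \<Otimes>\<^sub>M ?PF) borel ((\<lambda>(x, y). x + y) \<circ> (\<lambda>(x, y). (?sE x, ?sF y)))"
  proof (rule distr_distr[OF add])
    show "(\<lambda>(x, y). (?sE x, ?sF y)) \<in> measurable (?PE \<Otimes>\<^sub>M ?PF) (restrict_space borel E \<Otimes>\<^sub>M restrict_space borel ?F)"
      unfolding split_beta
      by (intro measurable_Pair measurable_compose[OF measurable_fst measurable_onb_sum[OF E]] measurable_compose[OF measurable_snd measurable_onb_sum[OF F]])
  qed
  also have "\<dots> = distr (?PE \<Otimes>\<^sub>M ?PF) borel ((\<lambda>c. \<Sum>b\<in>onb E \<union> onb ?F. c b *\<^sub>R b) \<circ> merge (onb E) (onb ?F))"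
  proof (rule arg_cong[where f="distr _ borel"], rule ext)
    fix p
    have "(\<Sum>b\<in>onb E \<union> onb ?F. merge (onb E) (onb ?F) p b *\<^sub>R b)
      = (\<Sum>b\<in>onb E. merge (onb E) (onb ?F) p b *\<^sub>R b) + (\<Sum>b\<in>onb ?F. merge (onb E) (onb ?F) p b *\<^sub>R b)"
      by (rule sum.union_disjoint[OF DE(2) DF(2) orthonormal_basis_Un(2)[OF E]])
    also have "\<dots> = ?sE (fst p) + ?sF (snd p)"
      using orthonormal_basis_Un(2)[OF E]
      by (intro arg_cong2[where f="(+)"] sum.cong refl) (auto simp: merge_def split_beta)
    finally show "((\<lambda>(x, y). x + y) \<circ> (\<lambda>(x, y). (?sE x, ?sF y))) p = ((\<lambda>c. \<Sum>b\<in>onb E \<union> onb ?F. c b *\<^sub>R b) \<circ> merge (onb E) (onb ?F)) p"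
      by (simp add: split_beta)
  qed
  also have "\<dots> = distr (distr (?PE \<Otimes>\<^sub>M ?PF) ?P (merge (onb E) (onb ?F))) borel (\<lambda>c. \<Sum>b\<in>onb E \<union> onb ?F. c b *\<^sub>R b)"
    by (rule distr_distr[symmetric, OF measurable_coord_sum measurable_merge])
  also have "\<dots> = distr ?P borel (\<lambda>c. \<Sum>b\<in>onb E \<union> onb ?F. c b *\<^sub>R b)"
    by (simp only: lborel_product.distr_merge[OF orthonormal_basis_Un(2)[OF E] DE(2) DF(2)])
  also have "\<dots> = lborel"
    by (rule lborel_orthonormal_basis[OF orthonormal_basis_Un(1)[OF E], symmetric])
  finally show ?thesis .
qed

lemma sets_subspace_lborelI:
  fixes E :: "(real^'n) set"
  assumes "X \<in> sets borel" "X \<subseteq> E"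
  shows "X \<in> sets (subspace_lborel E)"
  using assms by (auto simp: sets_subspace_lborel sets_restrict_space)

text \<open>In the splitting into \<open>E\<close> and its complement the sum \<open>X + Z\<close>
  is a Cartesian product. This links the measure on a subspace to ordinary volume.\<close>

lemma emeasure_subspace_plus:
  fixes E :: "(real^'n) set"
  assumes E: "subspace E" and X: "compact X" "X \<subseteq> E" and Z: "compact Z" "Z \<subseteq> orthogonal_comp E"
  shows "emeasure lborel (X + Z) = emeasure (subspace_lborel E) X * emeasure (subspace_lborel (orthogonal_comp E)) Z"
proof -
  let ?F = "orthogonal_comp E"
  have F: "subspace ?F" by (rule subspace_orthogonal_comp)
  interpret sF: sigma_finite_measure "subspace_lborel ?F" by (rule sigma_finite_subspace_lborel[OF F])
  have XZ: "X + Z \<in> sets borel" by (intro borel_compact compact_set_plus X Z)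
  have m: "(\<lambda>(x, y). x + y) \<in> measurable (subspace_lborel E \<Otimes>\<^sub>M subspace_lborel ?F) (borel :: (real^'n) measure)"
    unfolding split_beta
    by (intro borel_measurable_add measurable_compose[OF measurable_fst measurable_subspace_lborelI] measurable_compose[OF measurable_snd measurable_subspace_lborelI]) auto
  have pre: "(\<lambda>(x, y). x + y) -` (X + Z) \<inter> space (subspace_lborel E \<Otimes>\<^sub>M subspace_lborel ?F) = X \<times> Z"
  proof (intro equalityI subsetI)
    fix p assume p: "p \<in> (\<lambda>(x, y). x + y) -` (X + Z) \<inter> space (subspace_lborel E \<Otimes>\<^sub>M subspace_lborel ?F)"
    then have "fst p + snd p \<in> X + Z" "fst p \<in> E" "snd p \<in> ?F" by (auto simp: space_pair_measure)
    then obtain x z where xz: "x \<in> X" "z \<in> Z" "fst p + snd p = x + z" unfolding set_plus_def by blast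
    have "fst p = closest_point E (fst p + snd p)"
      using closest_point_subspace_eq[OF E \<open>fst p \<in> E\<close> \<open>snd p \<in> ?F\<close>] by simp
    also have "\<dots> = x" unfolding xz(3) using closest_point_subspace_eq[OF E] xz X(2) Z(2) by blast
    finally show "p \<in> X \<times> Z" using xz by (cases p) auto
  qed (use X(2) Z(2) in \<open>auto simp: space_pair_measure intro: set_plus_intro\<close>)
  have "emeasure lborel (X + Z) = emeasure (distr (subspace_lborel E \<Otimes>\<^sub>M subspace_lborel ?F) borel (\<lambda>(x, y). x + y)) (X + Z)"
    by (simp only: distr_subspace_lborel_sum[OF E])
  also have "\<dots> = emeasure (subspace_lborel E \<Otimes>\<^sub>M subspace_lborel ?F) (X \<times> Z)"
    unfolding pre[symmetric] by (rule emeasure_distr[OF m XZ])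
  also have "\<dots> = emeasure (subspace_lborel E) X * emeasure (subspace_lborel ?F) Z"
    by (intro sF.emeasure_pair_measure_Times sets_subspace_lborelI borel_compact X Z)
  finally show ?thesis .
qed

section \<open>Scaling and homogeneous functions on a subspace\<close>

lemma PiM_scale:
  assumes B: "finite B" and t: "t > 0"
  shows "scale_measure (ennreal t ^ card B) (distr (PiM B (\<lambda>_. lborel :: real measure)) (PiM B (\<lambda>_. lborel)) (\<lambda>c. \<lambda>b\<in>B. t * c b)) = PiM B (\<lambda>_. lborel)"
proof (rule lborel_product.PiM_eqI)
  fix A assume A: "\<And>b. b \<in> B \<Longrightarrow> A b \<in> sets (lborel :: real measure)"
  have m: "(\<lambda>c. \<lambda>b\<in>B. t * c b) \<in> measurable (PiM B (\<lambda>_. lborel :: real measure)) (PiM B (\<lambda>_. lborel))"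
    by (intro measurable_restrict) measurable
  have pre: "(\<lambda>c. \<lambda>b\<in>B. t * c b) -` Pi\<^sub>E B A \<inter> space (PiM B (\<lambda>_. lborel)) = Pi\<^sub>E B (\<lambda>b. (*) t -` A b)"
    by (auto simp: space_PiM PiE_iff)
  have one: "ennreal t * emeasure lborel ((*) t -` X) = emeasure lborel X" if "X \<in> sets (borel :: real measure)" for X
  proof -
    have "emeasure lborel ((*) t -` X) = emeasure (distr lborel borel ((*) t)) X"
      using that by (subst emeasure_distr) auto
    also have "\<dots> = ennreal (inverse \<bar>t\<bar>) * emeasure lborel X"
      using that t by (subst lborel_distr_mult) (auto simp: emeasure_density_const)
    finally have "ennreal t * emeasure lborel ((*) t -` X) = (ennreal t * ennreal (inverse \<bar>t\<bar>)) * emeasure lborel X"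
      by (simp add: mult.assoc)
    also have "ennreal t * ennreal (inverse \<bar>t\<bar>) = 1" using t by (simp add: ennreal_mult[symmetric])
    finally show ?thesis by simp
  qed
  have mt: "(*) t -` A b \<in> sets borel" if "b \<in> B" for b
  proof -
    have "(*) t \<in> borel_measurable (borel :: real measure)" by measurable
    from measurable_sets[OF this, of "A b"] A[OF that] show ?thesis by simp
  qed
  have "emeasure (scale_measure (ennreal t ^ card B) (distr (PiM B (\<lambda>_. lborel)) (PiM B (\<lambda>_. lborel)) (\<lambda>c. \<lambda>b\<in>B. t * c b))) (Pi\<^sub>E B A)
     = ennreal t ^ card B * emeasure (distr (PiM B (\<lambda>_. lborel)) (PiM B (\<lambda>_. lborel)) (\<lambda>c. \<lambda>b\<in>B. t * c b)) (Pi\<^sub>E B A)"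
    by simp
  also have "emeasure (distr (PiM B (\<lambda>_. lborel)) (PiM B (\<lambda>_. lborel)) (\<lambda>c. \<lambda>b\<in>B. t * c b)) (Pi\<^sub>E B A)
     = emeasure (PiM B (\<lambda>_. lborel)) (Pi\<^sub>E B (\<lambda>b. (*) t -` A b))"
    unfolding pre[symmetric] using B A by (intro emeasure_distr m sets_PiM_I_finite) auto
  also have "\<dots> = (\<Prod>b\<in>B. emeasure lborel ((*) t -` A b))"
    using B mt by (intro lborel_product.emeasure_PiM) auto
  also have "ennreal t ^ card B * \<dots> = (\<Prod>b\<in>B. ennreal t * emeasure lborel ((*) t -` A b))"
    by (simp add: prod.distrib)
  also have "\<dots> = (\<Prod>b\<in>B. emeasure lborel (A b))"
    using A by (intro prod.cong refl one) auto
  finally show "emeasure (scale_measure (ennreal t ^ card B) (distr (PiM B (\<lambda>_. lborel)) (PiM B (\<lambda>_. lborel)) (\<lambda>c. \<lambda>b\<in>B. t * c b))) (Pi\<^sub>E B A)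
    = (\<Prod>b\<in>B. emeasure lborel (A b))" .
qed (use B in auto)

lemma nn_integral_subspace_scale:
  fixes E :: "(real^'n) set"
  assumes E: "subspace E" and t: "t > 0" and g: "g \<in> borel_measurable (subspace_lborel E)"
  shows "(\<integral>\<^sup>+y. g y \<partial>subspace_lborel E) = ennreal (t ^ dim E) * (\<integral>\<^sup>+y. g (t *\<^sub>R y) \<partial>subspace_lborel E)"
proof -
  note D = orthonormal_basisD[OF onb[OF E]]
  let ?B = "onb E" and ?s = "\<lambda>c. \<Sum>b\<in>onb E. c b *\<^sub>R b"
  let ?P = "PiM ?B (\<lambda>_. lborel :: real measure)" and ?T = "\<lambda>c. \<lambda>b\<in>?B. t * c b"
  have mT: "?T \<in> measurable ?P ?P" by (intro measurable_restrict) measurable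
  have mg: "g \<in> borel_measurable (restrict_space borel E)" using g by (simp cong: measurable_cong_sets add: sets_subspace_lborel)
  have gs: "(\<lambda>c. g (?s c)) \<in> borel_measurable ?P" by (rule measurable_compose[OF measurable_onb_sum[OF E] mg])
  have sT: "?s (?T c) = t *\<^sub>R ?s c" for c by (simp add: scaleR_sum_right)
  have gt: "(\<lambda>y. g (t *\<^sub>R y)) \<in> borel_measurable (subspace_lborel E)"
  proof -
    have 1: "(\<lambda>y. t *\<^sub>R y) \<in> measurable (subspace_lborel E) (restrict_space borel E)"
      using E by (intro measurable_restrict_space2 measurable_subspace_lborelI) (auto simp: subspace_scale)
    show ?thesis by (rule measurable_compose[OF 1 mg])
  qed
  have "(\<integral>\<^sup>+y. g y \<partial>subspace_lborel E) = (\<integral>\<^sup>+c. g (?s c) \<partial>?P)" by (rule nn_integral_subspace_lborel[OF E g])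
  also have "\<dots> = (\<integral>\<^sup>+c. g (?s c) \<partial>scale_measure (ennreal t ^ card ?B) (distr ?P ?P ?T))"
    by (simp only: PiM_scale[OF D(2) t])
  also have "\<dots> = ennreal t ^ card ?B * (\<integral>\<^sup>+c. g (?s c) \<partial>distr ?P ?P ?T)"
    using gs by (intro nn_integral_scale_measure) simp
  also have "(\<integral>\<^sup>+c. g (?s c) \<partial>distr ?P ?P ?T) = (\<integral>\<^sup>+c. g (?s (?T c)) \<partial>?P)"
    by (rule nn_integral_distr[OF mT]) (simp add: gs)
  also have "\<dots> = (\<integral>\<^sup>+y. g (t *\<^sub>R y) \<partial>subspace_lborel E)"
    unfolding sT by (rule nn_integral_subspace_lborel[OF E gt, symmetric])
  finally show ?thesis using t D(3) by (simp add: ennreal_power)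
qed

lemma nn_integral_powr_tail:
  assumes "p > 0" "a > (0::real)"
  shows "(\<integral>\<^sup>+t. ennreal (t powr (- p - 1)) * indicator {a..} t \<partial>lborel) = ennreal (a powr (- p) / p)"
proof -
  have "(\<integral>\<^sup>+t. ennreal (t powr (- p - 1)) * indicator {a..} t \<partial>lborel) = ennreal (0 - (- (a powr (- p) / p)))"
  proof (rule nn_integral_FTC_atLeast)
    show "DERIV (\<lambda>t. - (t powr (- p) / p)) x :> x powr (- p - 1)" if "a \<le> x" for x
      using assms that by (auto intro!: derivative_eq_intros simp: field_simps)
    have "((\<lambda>t. t powr (- p)) \<longlongrightarrow> 0) at_top"
      using assms by (intro tendsto_neg_powr filterlim_ident) auto
    from tendsto_minus[OF tendsto_divide[OF this tendsto_const[of p]]]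
    show "((\<lambda>t. - (t powr (- p) / p)) \<longlongrightarrow> 0) at_top" using assms by simp
  qed auto
  then show ?thesis by simp
qed

lemma nn_integral_Gamma_scale:
  assumes p: "p > 0" and c: "c > (0::real)"
  shows "(\<integral>\<^sup>+t. ennreal (t powr (p - 1) * exp (- (t * c))) * indicator {0<..} t \<partial>lborel) = ennreal (Gamma p * c powr (- p))"
proof -
  define J where "J = (\<integral>\<^sup>+t. ennreal (t powr (p - 1) * exp (- (t * c))) * indicator {0<..} t \<partial>lborel)"
  have "ennreal (Gamma p) = (\<integral>\<^sup>+t. ennreal (indicator {0..} t * t powr (p - 1) / exp t) \<partial>lborel)"
    by (rule Gamma_conv_nn_integral_real[OF p])
  also have "\<dots> = ennreal \<bar>c\<bar> * (\<integral>\<^sup>+t. ennreal (indicator {0..} (0 + c * t) * (0 + c * t) powr (p - 1) / exp (0 + c * t)) \<partial>lborel)"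
    using c by (intro nn_integral_real_affine) auto
  also have "(\<integral>\<^sup>+t. ennreal (indicator {0..} (0 + c * t) * (0 + c * t) powr (p - 1) / exp (0 + c * t)) \<partial>lborel)
    = (\<integral>\<^sup>+t. ennreal (c powr (p - 1)) * (ennreal (t powr (p - 1) * exp (- (t * c))) * indicator {0<..} t) \<partial>lborel)"
  proof (rule nn_integral_cong)
    fix t :: real
    show "ennreal (indicator {0..} (0 + c * t) * (0 + c * t) powr (p - 1) / exp (0 + c * t))
      = ennreal (c powr (p - 1)) * (ennreal (t powr (p - 1) * exp (- (t * c))) * indicator {0<..} t)"
      using c by (cases "t > 0"; cases "t = 0")
        (auto simp: indicator_def powr_mult exp_minus divide_inverse ennreal_mult[symmetric] mult_ac zero_le_mult_iff not_less)
  qed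
  also have "\<dots> = ennreal (c powr (p - 1)) * J"
    unfolding J_def by (rule nn_integral_cmult) measurable
  finally have "ennreal (Gamma p) = ennreal (c * c powr (p - 1)) * J"
    using c by (simp add: ennreal_mult mult.assoc)
  also have "c * c powr (p - 1) = c powr p" using c by (simp add: powr_diff)
  finally have G: "ennreal (Gamma p) = ennreal (c powr p) * J" .
  have "J = ennreal (c powr (- p)) * (ennreal (c powr p) * J)"
    using c by (simp add: mult.assoc[symmetric] ennreal_mult[symmetric] powr_add[symmetric])
  also have "\<dots> = ennreal (c powr (- p)) * ennreal (Gamma p)" by (simp only: G)
  also have "\<dots> = ennreal (Gamma p * c powr (- p))"
    using p by (simp add: ennreal_mult[symmetric] Gamma_real_nonneg mult.commute)
  finally show ?thesis unfolding J_def .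
qed

text \<open>Scaling by \<open>2\<close> fixes the origin but multiplies masses by
  \<open>2 ^ dim E > 1\<close>, and the mass of the origin is finite; it must be
  \<open>0\<close>.\<close>

lemma AE_subspace_lborel_nonzero:
  fixes E :: "(real^'n) set"
  assumes E: "subspace E" and d: "dim E \<ge> 1"
  shows "AE y in subspace_lborel E. y \<noteq> 0"
proof -
  have 0: "{0} \<in> sets (subspace_lborel E)" using E by (intro sets_subspace_lborelI) (auto simp: subspace_0)
  define z where "z = emeasure (subspace_lborel E) {0}"
  have "(\<integral>\<^sup>+y. indicator {0} y \<partial>subspace_lborel E) = ennreal (2 ^ dim E) * (\<integral>\<^sup>+y. indicator {0} (2 *\<^sub>R y) \<partial>subspace_lborel E)"
    using 0 by (intro nn_integral_subspace_scale[OF E, where t=2]) auto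
  also have "(\<integral>\<^sup>+y. indicator {0} (2 *\<^sub>R y) \<partial>subspace_lborel E) = (\<integral>\<^sup>+y. indicator {0} y \<partial>subspace_lborel E)"
    by (intro nn_integral_cong) (auto simp: indicator_def)
  finally have z: "z = ennreal (2 ^ dim E) * z" using 0 by (simp add: z_def)
  have "z \<le> emeasure (subspace_lborel E) (E \<inter> cball 0 1)"
    unfolding z_def using E by (intro emeasure_mono sets_subspace_lborelI) (auto simp: subspace_0 closed_subspace intro!: borel_closed closed_Int)
  also have "\<dots> < \<infinity>" using emeasure_subspace_cball[OF E, of 1] by simp
  finally have fin: "z < top" by simp
  then obtain r where r: "z = ennreal r" "r \<ge> 0" by (cases z) auto
  have "r = 2 ^ dim E * r" using z r by (simp add: ennreal_mult[symmetric])
  moreover have "(2::real) ^ dim E > 1" using d by (simp add: one_less_power)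
  ultimately have "r = 0" by (metis mult_cancel_right1 less_irrefl)
  then show ?thesis using r 0 AE_iff_measurable[OF 0, of "\<lambda>y. y \<noteq> 0"] subspace_0[OF E] by (auto simp: z_def)
qed

text \<open>Both integrands are obtained from a double integral over \<open>E\<close> and a scale \<open>t > 0\<close>: the
  factor \<open>H y powr p * t powr (- p - 1)\<close> for \<open>t \<ge> H y\<close> integrates to \<open>1 / p\<close>, and the
  substitution \<open>y \<mapsto> t powr (1 / d) *\<^sub>R y\<close> moves the scale to the exponential.\<close>

lemma integral_exp_homogeneous:
  fixes E :: "(real^'n) set" and h H :: "real^'n \<Rightarrow> real"
  assumes E: "subspace E" and dimE: "dim E \<ge> 1" and d: "d \<ge> 1"
    and h: "h \<in> borel_measurable (subspace_lborel E)" "\<And>t y. y \<in> E \<Longrightarrow> t > 0 \<Longrightarrow> h (t *\<^sub>R y) = t ^ d * h y"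
      "\<And>y. y \<in> E \<Longrightarrow> y \<noteq> 0 \<Longrightarrow> h y > 0"
    and H: "H \<in> borel_measurable (subspace_lborel E)" "\<And>t y. y \<in> E \<Longrightarrow> t > 0 \<Longrightarrow> H (t *\<^sub>R y) = t ^ d * H y"
      "\<And>y. y \<in> E \<Longrightarrow> y \<noteq> 0 \<Longrightarrow> H y > 0"
  shows "(\<integral>\<^sup>+y. ennreal (exp (- h y)) \<partial>subspace_lborel E)
    = ennreal (Gamma (1 + real (dim E) / real d)) *
      (\<integral>\<^sup>+y. ennreal ((H y / h y) powr (real (dim E) / real d)) * indicator {y. H y \<le> 1} y \<partial>subspace_lborel E)"
proof -
  define p where "p = real (dim E) / real d"
  have p: "p > 0" using dimE d by (simp add: p_def)
  let ?S = "subspace_lborel E"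
  note [measurable] = h(1) H(1)
  interpret S: sigma_finite_measure ?S by (rule sigma_finite_subspace_lborel[OF E])
  interpret SL: pair_sigma_finite ?S "lborel :: real measure" ..
  have nz: "AE y in ?S. y \<noteq> 0" by (rule AE_subspace_lborel_nonzero[OF E dimE])
  have inE: "AE y in ?S. y \<in> E" using AE_space[of ?S] by simp
  \<comment> \<open>\<open>H\<close> is a free normalisation with the same homogeneity as
    \<open>h\<close>. The choice \<open>H = h / \<alpha>\<close> will produce the volume of a
    sublevel set, the choice \<open>norm y ^ d\<close> an integral over the unit ball.\<close>
  let ?G = "\<lambda>t y. ennreal (p * H y powr p * exp (- h y)) * (ennreal (t powr (- p - 1)) * indicator {y. H y \<le> t} y)"
  let ?K = "\<lambda>t y. ennreal (p * H y powr p) * indicator {y. H y \<le> 1} y * (ennreal (t powr (p - 1) * exp (- (t * h y))) * indicator {0<..} t)"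
  have "(\<integral>\<^sup>+y. ennreal (exp (- h y)) \<partial>?S) = (\<integral>\<^sup>+y. (\<integral>\<^sup>+t. indicator {0<..} t * ?G t y \<partial>lborel) \<partial>?S)"
  proof (rule nn_integral_cong_AE)
    show "AE y in ?S. ennreal (exp (- h y)) = (\<integral>\<^sup>+t. indicator {0<..} t * ?G t y \<partial>lborel)"
      using nz inE
    proof eventually_elim
      case (elim y)
      then have Hy: "H y > 0" using H(3) by blast
      have "(\<integral>\<^sup>+t. indicator {0<..} t * ?G t y \<partial>lborel)
        = (\<integral>\<^sup>+t. ennreal (p * H y powr p * exp (- h y)) * (ennreal (t powr (- p - 1)) * indicator {H y..} t) \<partial>lborel)"
        using Hy by (intro nn_integral_cong) (auto simp: indicator_def)
      also have "\<dots> = ennreal (p * H y powr p * exp (- h y)) * ennreal (H y powr (- p) / p)"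
        by (subst nn_integral_cmult) (auto simp: nn_integral_powr_tail[OF p Hy])
      also have "\<dots> = ennreal (exp (- h y))"
        using p Hy by (simp add: ennreal_mult[symmetric] powr_minus field_simps)
      finally show ?case ..
    qed
  qed
  also have "\<dots> = (\<integral>\<^sup>+t. (\<integral>\<^sup>+y. indicator {0<..} t * ?G t y \<partial>?S) \<partial>lborel)"
    by (rule SL.Fubini'[symmetric]) measurable
  also have "\<dots> = (\<integral>\<^sup>+t. (\<integral>\<^sup>+y. ?K t y \<partial>?S) \<partial>lborel)"
  proof (rule nn_integral_cong)
    fix t :: real
    show "(\<integral>\<^sup>+y. indicator {0<..} t * ?G t y \<partial>?S) = (\<integral>\<^sup>+y. ?K t y \<partial>?S)"
    proof (cases "t > 0")
      case t: True
      define s where "s = t powr (1 / real d)"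
      have s: "s > 0" using t by (simp add: s_def)
      have sd: "s ^ d = t" using t d by (simp add: s_def powr_realpow[symmetric] powr_powr)
      have sj: "s ^ dim E = t powr p" using t s by (simp add: s_def powr_realpow[symmetric] powr_powr p_def)
      have mG: "(\<lambda>y. ?G t y) \<in> borel_measurable ?S" by measurable
      have "(\<integral>\<^sup>+y. indicator {0<..} t * ?G t y \<partial>?S) = (\<integral>\<^sup>+y. ?G t y \<partial>?S)" using t by simp
      also have "\<dots> = ennreal (s ^ dim E) * (\<integral>\<^sup>+y. ?G t (s *\<^sub>R y) \<partial>?S)"
        by (rule nn_integral_subspace_scale[OF E s mG])
      also have "\<dots> = (\<integral>\<^sup>+y. ennreal (s ^ dim E) * ?G t (s *\<^sub>R y) \<partial>?S)"
      proof (rule nn_integral_cmult[symmetric])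
        have 1: "(\<lambda>y. s *\<^sub>R y) \<in> measurable ?S ?S"
        proof -
          have "(\<lambda>y. s *\<^sub>R y) \<in> measurable ?S (restrict_space borel E)"
            using E by (intro measurable_restrict_space2 measurable_subspace_lborelI) (auto simp: subspace_scale)
          then show ?thesis by (simp cong: measurable_cong_sets add: sets_subspace_lborel)
        qed
        show "(\<lambda>y. ?G t (s *\<^sub>R y)) \<in> borel_measurable ?S" by (rule measurable_compose[OF 1 mG])
      qed
      also have "\<dots> = (\<integral>\<^sup>+y. ?K t y \<partial>?S)"
      proof (rule nn_integral_cong_AE)
        show "AE y in ?S. ennreal (s ^ dim E) * ?G t (s *\<^sub>R y) = ?K t y"
          using nz inE
        proof eventually_elim
          case (elim y)
          then have Hy: "H y > 0" using H(3) by blast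
          have Hs: "H (s *\<^sub>R y) = t * H y" "h (s *\<^sub>R y) = t * h y" using elim s H(2) h(2) sd by auto
          have le: "t * H y \<le> t \<longleftrightarrow> H y \<le> 1" using t by simp
          have "t powr p * (p * (t * H y) powr p * exp (- (t * h y)) * t powr (- p - 1)) = p * H y powr p * (t powr (p - 1) * exp (- (t * h y)))"
          proof -
            have "(t * H y) powr p = t powr p * H y powr p" using t Hy by (simp add: powr_mult)
            moreover have "t powr p * t powr p * t powr (- p - 1) = t powr (p - 1)"
              by (simp add: powr_add[symmetric])
            ultimately show ?thesis by (simp add: mult_ac)
          qed
          then show ?case
            using t p unfolding Hs sj
            by (cases "H y \<le> 1") (simp_all add: Hs le ennreal_mult[symmetric] mult_ac)
        qed
      qed
      finally show ?thesis .
    qed simp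
  qed
  also have "\<dots> = (\<integral>\<^sup>+y. (\<integral>\<^sup>+t. ?K t y \<partial>lborel) \<partial>?S)"
    by (rule SL.Fubini') measurable
  also have "\<dots> = (\<integral>\<^sup>+y. ennreal (Gamma (1 + p)) * (ennreal ((H y / h y) powr p) * indicator {y. H y \<le> 1} y) \<partial>?S)"
  proof (rule nn_integral_cong_AE)
    show "AE y in ?S. (\<integral>\<^sup>+t. ?K t y \<partial>lborel) = ennreal (Gamma (1 + p)) * (ennreal ((H y / h y) powr p) * indicator {y. H y \<le> 1} y)"
      using nz inE
    proof eventually_elim
      case (elim y)
      then have Hy: "H y > 0" and hy: "h y > 0" using H(3) h(3) by blast+
      have "(\<integral>\<^sup>+t. ?K t y \<partial>lborel) = ennreal (p * H y powr p) * indicator {y. H y \<le> 1} y * ennreal (Gamma p * h y powr (- p))"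
        by (subst nn_integral_cmult) (auto simp: nn_integral_Gamma_scale[OF p hy])
      also have "\<dots> = ennreal (p * H y powr p * (Gamma p * h y powr (- p))) * indicator {y. H y \<le> 1} y"
        using p by (simp add: ennreal_mult Gamma_real_nonneg mult_ac)
      also have "p * H y powr p * (Gamma p * h y powr (- p)) = Gamma (1 + p) * (H y / h y) powr p"
      proof -
        have "p \<notin> \<int>\<^sub>\<le>\<^sub>0" using p by (auto elim!: nonpos_Ints_cases)
        then have "Gamma (1 + p) = p * Gamma p" using Gamma_plus1[of p] by (simp add: add.commute)
        moreover have "(H y / h y) powr p = H y powr p * h y powr (- p)"
          using Hy hy by (simp add: powr_divide powr_minus_divide)
        ultimately show ?thesis by simp
      qed
      finally show ?case using p by (simp add: ennreal_mult Gamma_real_nonneg mult.assoc)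
    qed
  qed
  also have "\<dots> = ennreal (Gamma (1 + p)) * (\<integral>\<^sup>+y. ennreal ((H y / h y) powr p) * indicator {y. H y \<le> 1} y \<partial>?S)"
    by (rule nn_integral_cmult) measurable
  finally show ?thesis unfolding p_def .
qed

section \<open>Rotations and the Grassmannian\<close>

lemma orthogonal_matrix_transformation:
  "orthogonal_matrix (Q :: real^'n^'n) \<Longrightarrow> orthogonal_transformation ((*v) Q)"
  by (simp add: orthogonal_transformation_matrix)

lemma orthogonal_matrix_inverse:
  assumes "orthogonal_matrix (Q :: real^'n^'n)"
  shows "Q *v (transpose Q *v x) = x" "transpose Q *v (Q *v x) = x"
  using assms unfolding orthogonal_matrix_def matrix_vector_mul_assoc by simp_all

lemma rotation_matrix_transpose: "rotation_matrix R \<Longrightarrow> rotation_matrix (transpose R :: real^'n^'n)"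
  by (simp add: rotation_matrix_def)

lemma continuous_on_matrix_mult:
  fixes f :: "'a::topological_space \<Rightarrow> real^'n^'m" and g :: "'a \<Rightarrow> real^'k^'n"
  assumes "continuous_on S f" "continuous_on S g"
  shows "continuous_on S (\<lambda>x. f x ** g x)"
  unfolding matrix_matrix_mult_def by (intro continuous_intros assms)

lemma continuous_on_matrix_vector_mult:
  fixes f :: "'a::topological_space \<Rightarrow> real^'n^'m" and g :: "'a \<Rightarrow> real^'n"
  assumes "continuous_on S f" "continuous_on S g"
  shows "continuous_on S (\<lambda>x. f x *v g x)"
  unfolding matrix_vector_mult_def by (intro continuous_intros assms)

lemma continuous_on_transpose:
  fixes f :: "'a::topological_space \<Rightarrow> real^'n^'m"
  assumes "continuous_on S f"
  shows "continuous_on S (\<lambda>x. transpose (f x))"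
  unfolding transpose_def by (intro continuous_intros assms)

lemma continuous_on_det:
  fixes f :: "'a::topological_space \<Rightarrow> real^'n^'n"
  assumes "continuous_on S f"
  shows "continuous_on S (\<lambda>x. det (f x))"
  unfolding det_def by (intro continuous_intros assms)

text \<open>A reflection for \<open>\<delta> = -1\<close>. With \<delta> the determinant of an
  orthogonal matrix, multiplication by it makes the determinant \<open>1\<close> without a case
  distinction.\<close>

definition coord_scale :: "'n \<Rightarrow> real \<Rightarrow> real^'n^'n" where
  "coord_scale k \<delta> = (\<chi> i j. if i = j then (if j = k then \<delta> else 1) else 0)"

lemma det_coord_scale: "det (coord_scale k \<delta>) = \<delta>"
  by (subst det_diagonal) (simp_all add: coord_scale_def)

lemma coord_scale_vector: "coord_scale k \<delta> *v y = y + ((\<delta> - 1) * y $ k) *\<^sub>R axis k 1"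
proof -
  have "(\<Sum>j\<in>UNIV. (if i = j then if j = k then \<delta> else 1 else 0) * y $ j) = (\<Sum>j\<in>UNIV. if i = j then (if j = k then \<delta> else 1) * y $ j else 0)" for i
    by (intro sum.cong refl) simp
  then show ?thesis
    by (simp add: vec_eq_iff coord_scale_def matrix_vector_mult_def axis_def algebra_simps)
qed

lemma orthogonal_coord_scale:
  assumes "\<delta> = 1 \<or> \<delta> = -1"
  shows "orthogonal_matrix (coord_scale k \<delta>)"
proof -
  have c: "column j (coord_scale k \<delta>) = (if j = k then \<delta> else 1) *\<^sub>R axis j 1" for j
    by (simp add: vec_eq_iff column_def coord_scale_def axis_def)
  show ?thesis
    unfolding orthogonal_matrix_orthonormal_columns c using assms
    by (auto simp: orthogonal_def inner_axis_axis)
qed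

text \<open>The reflection along a unit vector \<open>e\<close> of \<open>E\<close> moves points
  only in the direction \<open>e\<close>, hence keeps \<open>E\<close> invariant. It is built by
  conjugating a coordinate reflection, which shows its determinant.\<close>

lemma subspace_reflection_exists:
  fixes E :: "(real^'n) set"
  assumes n: "CARD('n) \<ge> 2" and E: "subspace E" "dim E \<ge> 1"
  obtains S :: "real^'n^'n" where "orthogonal_matrix S" "det S = -1" "\<And>x. x \<in> E \<Longrightarrow> S *v x \<in> E"
proof -
  obtain y where y: "y \<in> E" "y \<noteq> 0"
  proof -
    have "\<not> E \<subseteq> {0}" using E(2) by (metis dim_eq_0 not_one_le_zero)
    then show thesis using that by blast
  qed
  define e where "e = y /\<^sub>R norm y"
  have e: "e \<in> E" "norm e = 1" using y E by (auto simp: e_def subspace_scale)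
  obtain k :: 'n where True by blast
  obtain T where T: "rotation_matrix T" "T *v axis k 1 = e" using rotation_matrix_exists_basis[OF n e(2)] .
  let ?S = "T ** coord_scale k (-1) ** transpose T"
  have oT: "orthogonal_matrix T" using T by (simp add: rotation_matrix_def)
  show thesis
  proof (rule that)
    show "orthogonal_matrix ?S" using oT by (intro orthogonal_matrix_mul orthogonal_coord_scale) auto
    show "det ?S = -1" using T by (simp add: det_mul det_coord_scale rotation_matrix_def)
    fix x assume x: "x \<in> E"
    have "?S *v x = T *v (coord_scale k (-1) *v (transpose T *v x))" by (simp only: matrix_vector_mul_assoc matrix_mul_assoc)
    also have "\<dots> = T *v (transpose T *v x) + T *v (((-1 - 1) * (transpose T *v x) $ k) *\<^sub>R axis k 1)"
      unfolding coord_scale_vector by (rule matrix_vector_right_distrib)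
    also have "\<dots> = x + ((-1 - 1) * (transpose T *v x) $ k) *\<^sub>R e"
      unfolding orthogonal_matrix_inverse[OF oT] linear_scale[OF matrix_vector_mul_linear] T(2) ..
    finally show "?S *v x \<in> E" using x e E by (simp only: subspace_add subspace_scale)
  qed
qed

lemma dim_orthogonal_comp:
  fixes E :: "'a::euclidean_space set"
  assumes "subspace E"
  shows "dim (orthogonal_comp E) + dim E = DIM('a)"
proof -
  have "{y \<in> UNIV. \<forall>x\<in>E. orthogonal x y} = orthogonal_comp E" by (auto simp: orthogonal_comp_def)
  then show ?thesis using dim_subspace_orthogonal_to_vectors[OF assms subspace_UNIV] by simp
qed

text \<open>Isometries between the subspaces and between their complements are glued to an
  orthogonal map. If its determinant is \<open>-1\<close>, a reflection that preserves
  \<open>F\<close> is composed with it.\<close>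

lemma rotation_subspace_transitive:
  fixes E F :: "(real^'n) set"
  assumes n: "CARD('n) \<ge> 2" and E: "subspace E" and F: "subspace F" and d: "dim E = dim F" "dim F \<ge> 1"
  obtains S :: "real^'n^'n" where "rotation_matrix S" "(\<lambda>x. S *v x) ` E = F"
proof -
  let ?E' = "orthogonal_comp E" and ?F' = "orthogonal_comp F"
  have E': "subspace ?E'" and F': "subspace ?F'" by (rule subspace_orthogonal_comp)+
  have d': "dim ?E' = dim ?F'" using dim_orthogonal_comp[OF E] dim_orthogonal_comp[OF F] d by linarith
  obtain f where f: "linear f" "f ` E = F" "\<And>x. x \<in> E \<Longrightarrow> norm (f x) = norm x"
    by (rule isometry_subspaces[OF E F d(1)]) blast
  obtain g where g: "linear g" "g ` ?E' = ?F'" "\<And>x. x \<in> ?E' \<Longrightarrow> norm (g x) = norm x"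
    by (rule isometry_subspaces[OF E' F' d']) blast
  let ?p = "closest_point E"
  define h where "h x = f (?p x) + g (x - ?p x)" for x
  have linp: "linear ?p" by (rule linear_closest_point_subspace[OF E])
  have linh: "linear h"
    unfolding h_def using f(1) g(1) linp
    by (intro linear_compose_add linear_compose[of ?p f, unfolded o_def] linear_compose[of "\<lambda>x. x - ?p x" g, unfolded o_def] linear_compose_sub linear_id[unfolded id_def])
  have normh: "norm (h x) = norm x" for x
  proof -
    have 1: "?p x \<in> E" "x - ?p x \<in> ?E'" by (rule closest_point_subspace_in[OF E], rule closest_point_subspace_compl[OF E])
    then have "f (?p x) \<in> F" "g (x - ?p x) \<in> ?F'" using f(2) g(2) by blast+
    then have "orthogonal (f (?p x)) (g (x - ?p x))" by (auto simp: orthogonal_comp_def)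
    then have "(norm (h x))\<^sup>2 = (norm (f (?p x)))\<^sup>2 + (norm (g (x - ?p x)))\<^sup>2"
      unfolding h_def by (rule norm_add_Pythagorean)
    also have "\<dots> = (norm (?p x))\<^sup>2 + (norm (x - ?p x))\<^sup>2" using f(3) g(3) 1 by simp
    also have "\<dots> = (norm (?p x + (x - ?p x)))\<^sup>2"
      using 1 by (intro norm_add_Pythagorean[symmetric]) (auto simp: orthogonal_comp_def)
    finally show ?thesis by (simp add: power2_eq_iff_nonneg)
  qed
  have orth: "orthogonal_transformation h" using linh normh by (simp add: orthogonal_transformation)
  have hE: "h ` E = F"
  proof -
    have "h x = f x" if "x \<in> E" for x
      using that by (simp add: h_def closest_point_self linear_0[OF g(1)])
    then show ?thesis using f(2) by (metis image_cong)
  qed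
  define H where "H = matrix h"
  have Hv: "H *v x = h x" for x unfolding H_def using linh by (simp add: matrix_works linear_matrix_vector_mul_eq)
  have oH: "orthogonal_matrix H" unfolding H_def using orth orthogonal_transformation_matrix by blast
  have HE: "(\<lambda>x. H *v x) ` E = F" using hE by (simp add: Hv)
  have "det H = 1 \<or> det H = -1" using oH by (rule det_orthogonal_matrix)
  then show thesis
  proof
    assume "det H = 1"
    then show thesis using that[of H] oH HE by (simp add: rotation_matrix_def)
  next
    assume dH: "det H = -1"
    obtain S :: "real^'n^'n" where S: "orthogonal_matrix S" "det S = -1" "\<And>x. x \<in> F \<Longrightarrow> S *v x \<in> F"
      by (rule subspace_reflection_exists[OF n F d(2)]) blast
    have SF: "(\<lambda>x. S *v x) ` F = F"
    proof (rule subspace_dim_equal)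
      show "subspace ((\<lambda>x. S *v x) ` F)" by (rule linear_subspace_image[OF matrix_vector_mul_linear F])
      have inj: "inj ((*v) S)" by (rule orthogonal_transformation_inj[OF orthogonal_matrix_transformation[OF S(1)]])
      have "dim ((\<lambda>x. S *v x) ` F) = dim F"
        by (rule dim_image_eq[OF matrix_vector_mul_linear]) (metis inj inj_on_subset subset_UNIV)
      then show "dim ((\<lambda>x. S *v x) ` F) \<ge> dim F" by simp
    qed (use S(3) F in auto)
    have "rotation_matrix (S ** H)"
      using S oH dH by (simp add: rotation_matrix_def det_mul orthogonal_matrix_mul)
    moreover have "(\<lambda>x. (S ** H) *v x) ` E = F"
      using HE SF by (simp only: matrix_vector_mul_assoc[symmetric] image_image[symmetric])
    ultimately show thesis by (rule that)
  qed
qed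

section \<open>Random rotations by the Gram-Schmidt process\<close>

fun gram_schmidt :: "(nat \<Rightarrow> 'a::real_inner) \<Rightarrow> nat \<Rightarrow> 'a" where
  "gram_schmidt x k = sgn (x k - (\<Sum>l<k. (gram_schmidt x l \<bullet> x k) *\<^sub>R gram_schmidt x l))"

declare gram_schmidt.simps [simp del]

text \<open>The recursion uses only inner products, linear combinations and norms, so it commutes
  with orthogonal maps. This carries the invariance of Lebesgue measure on matrices over to the law
  of the resulting rotation.\<close>

lemma gram_schmidt_orthogonal_transformation:
  fixes f :: "'a::real_inner \<Rightarrow> 'a"
  assumes f: "orthogonal_transformation f"
  shows "gram_schmidt (\<lambda>i. f (x i)) k = f (gram_schmidt x k)"
proof (induction k rule: less_induct)
  case (less k)
  have lin: "linear f" and norm: "\<And>v. norm (f v) = norm v"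
    using f unfolding orthogonal_transformation by auto
  have inner: "f v \<bullet> f w = v \<bullet> w" for v w using f unfolding orthogonal_transformation_def by blast
  have "(\<Sum>l<k. (gram_schmidt (\<lambda>i. f (x i)) l \<bullet> f (x k)) *\<^sub>R gram_schmidt (\<lambda>i. f (x i)) l)
      = (\<Sum>l<k. (gram_schmidt x l \<bullet> x k) *\<^sub>R f (gram_schmidt x l))"
    using less by (intro sum.cong refl) (simp add: inner)
  also have "\<dots> = f (\<Sum>l<k. (gram_schmidt x l \<bullet> x k) *\<^sub>R gram_schmidt x l)"
    by (simp add: linear_sum[OF lin] linear_scale[OF lin])
  finally show ?case
    by (subst (1 2) gram_schmidt.simps) (simp add: sgn_div_norm linear_diff[OF lin, symmetric] linear_scale[OF lin] norm)
qed

lemma gram_schmidt_orthonormal: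
  fixes x :: "nat \<Rightarrow> 'a::real_inner"
  assumes ind: "\<And>i. i < n \<Longrightarrow> x i \<notin> span (x ` {..<i})"
  shows "k < n \<Longrightarrow> norm (gram_schmidt x k) = 1 \<and> gram_schmidt x k \<in> span (x ` {..k}) \<and> (\<forall>l<k. gram_schmidt x l \<bullet> gram_schmidt x k = 0)"
proof (induction k rule: less_induct)
  case (less k)
  let ?q = "gram_schmidt x"
  let ?w = "x k - (\<Sum>l<k. (?q l \<bullet> x k) *\<^sub>R ?q l)"
  have q: "?q k = sgn ?w" by (rule gram_schmidt.simps)
  have IH: "norm (?q l) = 1" "?q l \<in> span (x ` {..l})" "\<forall>m<l. ?q m \<bullet> ?q l = 0" if "l < k" for l
    using less.IH[OF that] less.prems that by auto
  have span_l: "?q l \<in> span (x ` {..<k})" if "l < k" for l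
  proof -
    have "x ` {..l} \<subseteq> x ` {..<k}" using that by auto
    from span_mono[OF this] show ?thesis using IH(2)[OF that] by blast
  qed
  have sum_in: "(\<Sum>l<k. (?q l \<bullet> x k) *\<^sub>R ?q l) \<in> span (x ` {..<k})"
    by (intro span_sum span_scale span_l) auto
  have w0: "?w \<noteq> 0" using ind[OF less.prems] sum_in by auto
  have sub: "x ` {..<k} \<subseteq> x ` {..k}" by auto
  have w_in: "?w \<in> span (x ` {..k})"
  proof (rule span_diff)
    show "x k \<in> span (x ` {..k})" by (intro span_base) auto
    show "(\<Sum>l<k. (?q l \<bullet> x k) *\<^sub>R ?q l) \<in> span (x ` {..k})" using sum_in span_mono[OF sub] by blast
  qed
  have orth: "?q m \<bullet> ?w = 0" if m: "m < k" for m
  proof -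
    have "?q m \<bullet> (\<Sum>l<k. (?q l \<bullet> x k) *\<^sub>R ?q l) = (\<Sum>l<k. if m = l then ?q l \<bullet> x k else 0)"
      unfolding inner_sum_right
    proof (intro sum.cong refl)
      fix l assume "l \<in> {..<k}"
      then have l: "l < k" by simp
      consider "l < m" | "m < l" | "l = m" by linarith
      then show "?q m \<bullet> ((?q l \<bullet> x k) *\<^sub>R ?q l) = (if m = l then ?q l \<bullet> x k else 0)"
      proof cases
        case 1
        then show ?thesis using IH(3)[OF m] by (simp add: inner_commute)
      next
        case 2
        then show ?thesis using IH(3)[OF l] by simp
      next
        case 3
        then show ?thesis using IH(1)[OF m] by (simp add: dot_square_norm)
      qed
    qed
    also have "\<dots> = ?q m \<bullet> x k" using m by simp
    finally show ?thesis by (simp add: inner_diff_right)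
  qed
  show ?case
    using w0 w_in orth unfolding q by (auto simp: norm_sgn sgn_div_norm span_scale)
qed

text \<open>Gram-Schmidt needs an order of the columns and the index type carries none; an arbitrary
  enumeration is fixed.\<close>

definition enum_index :: "nat \<Rightarrow> 'n::finite" where
  "enum_index = (SOME e. bij_betw e {..<CARD('n)} UNIV)"

lemma enum_index: "bij_betw (enum_index :: nat \<Rightarrow> 'n::finite) {..<CARD('n)} UNIV"
proof -
  have "\<exists>e. bij_betw e {..<CARD('n)} (UNIV :: 'n set)"
    using ex_bij_betw_nat_finite[of "UNIV :: 'n set"] by (simp add: atLeast0LessThan)
  then show ?thesis unfolding enum_index_def by (rule someI_ex)
qed

definition index_enum :: "'n::finite \<Rightarrow> nat" where
  "index_enum = inv_into {..<CARD('n)} enum_index"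

lemma index_enum: "index_enum (i::'n::finite) < CARD('n)" "enum_index (index_enum i) = i"
  using inv_into_into[of i enum_index "{..<CARD('n)}"] f_inv_into_f[of i enum_index "{..<CARD('n)}"] enum_index[where 'n='n]
  by (auto simp: index_enum_def bij_betw_def)

definition gs_matrix :: "real^'n^'n \<Rightarrow> real^'n^'n" where
  "gs_matrix M = (\<chi> i j. gram_schmidt (\<lambda>k. column (enum_index k) M) (index_enum j) $ i)"

lemma column_gs_matrix: "column j (gs_matrix M) = gram_schmidt (\<lambda>k. column (enum_index k) M) (index_enum j)"
  by (simp add: gs_matrix_def column_def)

lemma column_matrix_mult: "column j (A ** B) = A *v column j B" for A :: "real^'n^'m" and B :: "real^'k^'n"
  by (simp add: column_def matrix_matrix_mult_def matrix_vector_mult_def vec_eq_iff)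

lemma matrix_eq_columns: "(\<And>j. column j A = column j B) \<Longrightarrow> A = (B :: real^'n^'m)"
  by (simp add: column_def vec_eq_iff)

lemma gs_matrix_mult:
  assumes R: "orthogonal_matrix (R :: real^'n^'n)"
  shows "gs_matrix (R ** M) = R ** gs_matrix M"
proof (rule matrix_eq_columns)
  fix j
  show "column j (gs_matrix (R ** M)) = column j (R ** gs_matrix M)"
    unfolding column_matrix_mult column_gs_matrix
    by (rule gram_schmidt_orthogonal_transformation[OF orthogonal_matrix_transformation[OF R]])
qed

lemma orthogonal_gs_matrix:
  assumes M: "det (M :: real^'n^'n) \<noteq> 0"
  shows "orthogonal_matrix (gs_matrix M)"
proof -
  let ?x = "\<lambda>k. column (enum_index k) M"
  let ?q = "gram_schmidt ?x"
  have ind: "vec.independent (columns M)" using M det_dependent_columns by blast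
  have notin: "?x i \<notin> span (?x ` {..<i})" if i: "i < CARD('n)" for i
  proof
    assume "?x i \<in> span (?x ` {..<i})"
    \<comment> \<open>\<open>columns M\<close> is a set, so the columns must be known to be distinct
      before the earlier ones can be placed in \<open>columns M - {?x i}\<close>. A repeated column
      would make the determinant vanish.\<close>
    moreover have "?x ` {..<i} \<subseteq> columns M - {?x i}"
    proof
      fix y assume "y \<in> ?x ` {..<i}"
      then obtain l where l: "l < i" "y = ?x l" by blast
      then have "enum_index l \<noteq> (enum_index i :: 'n)"
        using enum_index[where 'n='n] i by (auto simp: bij_betw_def inj_on_def)
      then have "?x l \<noteq> ?x i" using det_identical_columns[of "enum_index l" "enum_index i" M] M by blast
      then show "y \<in> columns M - {?x i}" using l by (auto simp: columns_def)
    qed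
    ultimately have "?x i \<in> vec.span (columns M - {?x i})" using span_mono unfolding span_vec_eq by blast
    moreover have "?x i \<in> columns M" by (auto simp: columns_def)
    ultimately show False using ind unfolding vec.dependent_def by blast
  qed
  have on: "norm (?q k) = 1 \<and> ?q k \<in> span (?x ` {..k}) \<and> (\<forall>l<k. ?q l \<bullet> ?q k = 0)" if "k < CARD('n)" for k
    by (rule gram_schmidt_orthonormal[OF _ that]) (rule notin)
  have orth: "?q k \<bullet> ?q l = 0" if "k < CARD('n)" "l < CARD('n)" "k \<noteq> l" for k l
    using on[OF that(1)] on[OF that(2)] that(3) by (cases k l rule: linorder_cases) (auto simp: inner_commute)
  show ?thesis
    unfolding orthogonal_matrix_orthonormal_columns column_gs_matrix orthogonal_def
  proof (intro conjI allI impI)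
    fix i j :: 'n
    show "norm (?q (index_enum i)) = 1" using on index_enum by blast
    assume "i \<noteq> j"
    then have "index_enum i \<noteq> index_enum j" using index_enum(2) by metis
    then show "?q (index_enum i) \<bullet> ?q (index_enum j) = 0" using orth index_enum(1) by blast
  qed
qed

text \<open>Flips one arbitrary column if the determinant is \<open>-1\<close>. The correction is
  multiplied from the right, so that equivariance under multiplication by rotations from the left is
  kept.\<close>

definition rotation_of :: "real^'n^'n \<Rightarrow> real^'n^'n" where
  "rotation_of M = gs_matrix M ** coord_scale undefined (det (gs_matrix M))"

lemma rotation_matrix_rotation_of:
  assumes "det (M :: real^'n^'n) \<noteq> 0"
  shows "rotation_matrix (rotation_of M)"
proof -
  note o = orthogonal_gs_matrix[OF assms]
  have d: "det (gs_matrix M) = 1 \<or> det (gs_matrix M) = -1" using o by (rule det_orthogonal_matrix)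
  then show ?thesis
    using o orthogonal_coord_scale[OF d]
    by (auto simp: rotation_matrix_def rotation_of_def det_mul det_coord_scale intro!: orthogonal_matrix_mul)
qed

lemma rotation_of_mult:
  assumes "rotation_matrix (R :: real^'n^'n)"
  shows "rotation_of (R ** M) = R ** rotation_of M"
  using assms gs_matrix_mult[of R M] by (simp add: rotation_of_def rotation_matrix_def det_mul matrix_mul_assoc)

lemma borel_measurable_column [measurable]: "(\<lambda>M::real^'n^'m. column j M) \<in> borel_measurable borel"
  unfolding column_def by (intro borel_measurable_continuous_onI continuous_intros)

lemma borel_measurable_gram_schmidt:
  fixes x :: "'p \<Rightarrow> nat \<Rightarrow> 'a::euclidean_space"
  assumes "\<And>i. (\<lambda>p. x p i) \<in> borel_measurable N"
  shows "(\<lambda>p. gram_schmidt (x p) k) \<in> borel_measurable N"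
proof (induction k rule: less_induct)
  case (less k)
  have [measurable]: "(\<lambda>p. x p i) \<in> borel_measurable N" for i by (rule assms)
  have "(\<lambda>p. \<Sum>l<k. (gram_schmidt (x p) l \<bullet> x p k) *\<^sub>R gram_schmidt (x p) l) \<in> borel_measurable N"
    using less by (intro borel_measurable_sum borel_measurable_scaleR borel_measurable_inner assms) auto
  then show ?case
    by (subst gram_schmidt.simps) (simp add: sgn_div_norm)
qed

lemma borel_measurable_vec:
  fixes f :: "'p \<Rightarrow> 'a::euclidean_space^'n"
  assumes "\<And>i. (\<lambda>p. f p $ i) \<in> borel_measurable N"
  shows "f \<in> borel_measurable N"
proof (rule borel_measurable_euclidean_space[THEN iffD2], rule ballI)
  fix b :: "'a^'n" assume "b \<in> Basis"
  then obtain i u where b: "b = axis i u" by (auto simp: Basis_vec_def)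
  show "(\<lambda>p. f p \<bullet> b) \<in> borel_measurable N"
    unfolding b inner_axis by (intro borel_measurable_inner assms borel_measurable_const)
qed

lemma borel_measurable_rotation_of: "rotation_of \<in> borel_measurable (borel :: (real^'n^'n) measure)"
proof -
  have gs: "gs_matrix \<in> borel_measurable (borel :: (real^'n^'n) measure)"
  proof (intro borel_measurable_vec)
    fix i j :: 'n
    have "(\<lambda>M::real^'n^'n. gram_schmidt (\<lambda>k. column (enum_index k) M) (index_enum j)) \<in> borel_measurable borel"
      by (rule borel_measurable_gram_schmidt) measurable
    then have "(\<lambda>M::real^'n^'n. gram_schmidt (\<lambda>k. column (enum_index k) M) (index_enum j) \<bullet> axis i 1) \<in> borel_measurable borel"
      by (intro borel_measurable_inner borel_measurable_const)
    then show "(\<lambda>M::real^'n^'n. gs_matrix M $ i $ j) \<in> borel_measurable borel"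
      by (simp add: gs_matrix_def inner_axis)
  qed
  have "continuous_on UNIV (\<lambda>M::real^'n^'n. M ** coord_scale undefined (det M))"
  proof (intro continuous_on_matrix_mult continuous_on_id)
    have c: "continuous_on UNIV (\<lambda>M::real^'n^'n. if i = j then if j = undefined then det M else 1 else (0::real))" for i j :: 'n
      by (cases "i = j"; cases "j = undefined") (auto intro!: continuous_on_det continuous_on_id continuous_on_const)
    show "continuous_on UNIV (\<lambda>M::real^'n^'n. coord_scale undefined (det M) :: real^'n^'n)"
      unfolding coord_scale_def by (intro continuous_on_vec_lambda c)
  qed
  then have "(\<lambda>M::real^'n^'n. M ** coord_scale undefined (det M)) \<in> borel_measurable borel"
    by (rule borel_measurable_continuous_onI)
  from measurable_compose[OF gs this] show ?thesis unfolding rotation_of_def[abs_def] .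
qed

lemma inner_matrix_columns: "M \<bullet> N = (\<Sum>j\<in>UNIV. column j M \<bullet> column j N)" for M N :: "real^'n^'m"
  by (simp add: inner_vec_def column_def) (rule sum.swap)

text \<open>The inner product of matrices is the sum of those of their columns, and left
  multiplication acts on each column by itself. Lebesgue measure on matrices is therefore invariant
  under it.\<close>

lemma orthogonal_transformation_matrix_mult:
  assumes R: "orthogonal_matrix (R :: real^'n^'n)"
  shows "orthogonal_transformation (\<lambda>M::real^'n^'n. R ** M)"
proof -
  have "(R ** M) \<bullet> (R ** N) = M \<bullet> N" for M N :: "real^'n^'n"
    using orthogonal_matrix_transformation[OF R]
    by (simp add: inner_matrix_columns column_matrix_mult orthogonal_transformation_def)
  moreover have "linear (\<lambda>M::real^'n^'n. R ** M)"
  proof (rule linearI)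
    show "R ** (M + N) = R ** M + R ** N" for M N :: "real^'n^'n" by (rule matrix_add_ldistrib)
  qed (simp add: matrix_matrix_mult_def vec_eq_iff sum_distrib_left mult_ac)
  ultimately show ?thesis by (simp add: orthogonal_transformation_def)
qed

text \<open>The bound gives finite volume, hence a uniform law. Singular matrices are removed
  outright, so that Gram-Schmidt always succeeds; then it suffices that the remaining set has
  positive volume.\<close>

definition regular_ball :: "(real^'n^'n) set" where
  "regular_ball = {M \<in> cball 0 1. det M \<noteq> 0}"

lemma regular_ball_borel [measurable]: "regular_ball \<in> sets (borel :: (real^'n^'n) measure)"
proof -
  have "open {M::real^'n^'n. det M \<noteq> 0}"
    by (intro open_Collect_neq continuous_on_det continuous_on_id continuous_on_const)
  then have 1: "{M::real^'n^'n. det M \<noteq> 0} \<in> sets borel" by (rule borel_open)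
  have 2: "cball (0 :: real^'n^'n) 1 \<in> sets borel" by simp
  have "regular_ball = cball 0 1 \<inter> {M::real^'n^'n. det M \<noteq> 0}" by (auto simp: regular_ball_def)
  then show ?thesis using sets.Int[OF 2 1] by (simp only:)
qed

lemma emeasure_regular_ball:
  "emeasure lborel (regular_ball :: (real^'n^'n) set) \<noteq> 0" "emeasure lborel (regular_ball :: (real^'n^'n) set) \<noteq> \<infinity>"
proof -
  let ?U = "ball 0 1 \<inter> {M::real^'n^'n. det M \<noteq> 0}"
  have "open ?U" by (intro open_Int open_ball open_Collect_neq continuous_on_det continuous_on_id continuous_on_const)
  moreover have "?U \<noteq> {}"
  proof -
    let ?I = "mat 1 :: real^'n^'n"
    \<comment> \<open>A multiple of the identity small enough for the open unit ball: the open set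
      is nonempty and so not negligible.\<close>
    define c where "c = 1 / (norm ?I + 1)"
    have c: "c > 0" by (simp add: c_def add_nonneg_pos)
    have "norm (c *\<^sub>R ?I) < 1" using c by (simp add: c_def divide_less_eq add_nonneg_pos)
    moreover have "det (c *\<^sub>R ?I) \<noteq> 0"
    proof -
      have "det (c *\<^sub>R ?I) = (\<Prod>i\<in>(UNIV::'n set). (c *\<^sub>R ?I) $ i $ i)" by (rule det_diagonal) (simp add: mat_def)
      then show ?thesis using c by (simp add: mat_def)
    qed
    ultimately have "c *\<^sub>R ?I \<in> ?U" by simp
    then show ?thesis by blast
  qed
  ultimately have "\<not> negligible ?U" by (rule open_not_negligible)
  then have "?U \<notin> null_sets lebesgue" by (simp add: negligible_iff_null_sets)
  then have nz: "emeasure lborel ?U \<noteq> 0"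
    using \<open>open ?U\<close> by (simp add: null_sets_completion_iff null_sets_def borel_open)
  have "emeasure lborel ?U \<le> emeasure lborel (regular_ball :: (real^'n^'n) set)"
  proof (rule emeasure_mono)
    show "?U \<subseteq> regular_ball" by (auto simp: regular_ball_def)
  qed (simp add: regular_ball_borel)
  with nz show "emeasure lborel (regular_ball :: (real^'n^'n) set) \<noteq> 0" by (metis le_zero_eq)
  have "emeasure lborel (regular_ball :: (real^'n^'n) set) \<le> emeasure lborel (cball (0 :: real^'n^'n) 1)"
    by (intro emeasure_mono) (auto simp: regular_ball_def)
  also have "\<dots> < \<infinity>" by (simp add: emeasure_unit_cball)
  finally show "emeasure lborel (regular_ball :: (real^'n^'n) set) \<noteq> \<infinity>" by simp
qed

text \<open>Haar measure of the rotation group, realised as a measure on all matrices that is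
  concentrated on the rotations. Statements about it therefore hold almost everywhere, and all
  invariance is meant under left multiplication.\<close>

definition rotation_haar :: "(real^'n^'n) measure" where
  "rotation_haar = distr (uniform_measure lborel regular_ball) borel rotation_of"

lemma sets_rotation_haar [simp, measurable_cong]: "sets rotation_haar = sets borel"
  by (simp add: rotation_haar_def)

lemma space_rotation_haar [simp]: "space rotation_haar = UNIV"
  by (simp add: rotation_haar_def)

lemma prob_space_rotation_haar: "prob_space (rotation_haar :: (real^'n^'n) measure)"
proof -
  interpret U: prob_space "uniform_measure lborel (regular_ball :: (real^'n^'n) set)"
    using emeasure_regular_ball by (intro prob_space_uniform_measure) auto
  show ?thesis unfolding rotation_haar_def
    using borel_measurable_rotation_of by (intro U.prob_space_distr) (simp cong: measurable_cong_sets)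
qed

lemma AE_rotation_haar: "AE Q in (rotation_haar :: (real^'n^'n) measure). rotation_matrix Q"
proof -
  have m: "rotation_of \<in> measurable (uniform_measure lborel regular_ball) (borel :: (real^'n^'n) measure)"
    using borel_measurable_rotation_of by (simp cong: measurable_cong_sets)
  have "closed {Q::real^'n^'n. transpose Q ** Q = mat 1 \<and> det Q = 1}"
    by (intro closed_Collect_conj closed_Collect_eq continuous_on_matrix_mult continuous_on_transpose continuous_on_det continuous_on_id continuous_on_const)
  then have s: "{Q \<in> space borel. rotation_matrix (Q :: real^'n^'n)} \<in> sets borel"
    unfolding rotation_matrix_def orthogonal_matrix by (simp add: borel_closed)
  show ?thesis
    unfolding rotation_haar_def AE_distr_iff[OF m s]
  proof (rule AE_uniform_measureI)
    show "AE M in lborel. M \<in> regular_ball \<longrightarrow> rotation_matrix (rotation_of (M :: real^'n^'n))"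
      by (intro AE_I2) (auto simp: regular_ball_def rotation_matrix_rotation_of)
  qed (simp add: regular_ball_borel)
qed

lemma rotation_haar_invariant:
  assumes R: "rotation_matrix (R :: real^'n^'n)"
  shows "distr rotation_haar borel (\<lambda>Q. R ** Q) = rotation_haar"
proof -
  let ?U = "uniform_measure lborel (regular_ball :: (real^'n^'n) set)"
  let ?L = "\<lambda>M::real^'n^'n. R ** M"
  have oR: "orthogonal_matrix R" using R by (simp add: rotation_matrix_def)
  have orth: "orthogonal_transformation ?L" by (rule orthogonal_transformation_matrix_mult[OF oR])
  have mL: "?L \<in> borel_measurable borel"
    by (intro borel_measurable_continuous_onI continuous_on_matrix_mult continuous_on_id continuous_on_const)
  have mr: "rotation_of \<in> measurable ?U (borel :: (real^'n^'n) measure)"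
    using borel_measurable_rotation_of by (simp cong: measurable_cong_sets)
  have reg: "?L M \<in> regular_ball \<longleftrightarrow> M \<in> regular_ball" for M
    using orth R by (auto simp: regular_ball_def det_mul rotation_matrix_def orthogonal_transformation)
  have U: "distr ?U borel ?L = ?U"
  proof (rule measure_eqI)
    fix A assume "A \<in> sets (distr ?U borel ?L)"
    then have A: "A \<in> sets borel" by simp
    have "emeasure lborel (regular_ball \<inter> ?L -` A) = emeasure lborel (?L -` (regular_ball \<inter> A))"
      by (rule arg_cong[where f="emeasure lborel"]) (auto simp: reg)
    also have "\<dots> = emeasure (distr lborel borel ?L) (regular_ball \<inter> A)"
      using mL A regular_ball_borel by (subst emeasure_distr) auto
    finally have *: "emeasure lborel (regular_ball \<inter> ?L -` A) = emeasure lborel (regular_ball \<inter> A)"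
      by (simp add: distr_lborel_orthogonal_transformation[OF orth])
    have "?L -` A \<in> sets borel" using measurable_sets[OF mL A] by simp
    with * A mL show "emeasure (distr ?U borel ?L) A = emeasure ?U A"
      by (simp add: emeasure_distr regular_ball_borel cong: measurable_cong_sets)
  qed simp
  have mLU: "?L \<in> measurable ?U borel" using mL by (simp cong: measurable_cong_sets)
  have "distr rotation_haar borel ?L = distr ?U borel (?L \<circ> rotation_of)"
    unfolding rotation_haar_def by (rule distr_distr[OF mL mr])
  also have "?L \<circ> rotation_of = rotation_of \<circ> ?L" using rotation_of_mult[OF R] by (auto simp: o_def)
  also have "distr ?U borel (rotation_of \<circ> ?L) = distr (distr ?U borel ?L) borel rotation_of"
    by (rule distr_distr[symmetric, OF borel_measurable_rotation_of mLU])
  finally show ?thesis unfolding U rotation_haar_def .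
qed

lemma nn_integral_rotation_haar_left:
  assumes R: "rotation_matrix (R :: real^'n^'n)" and g: "g \<in> borel_measurable borel"
  shows "(\<integral>\<^sup>+Q. g (R ** Q) \<partial>rotation_haar) = (\<integral>\<^sup>+Q. g Q \<partial>rotation_haar)"
proof -
  have mL: "(\<lambda>M::real^'n^'n. R ** M) \<in> measurable rotation_haar borel"
    by (subst measurable_cong_sets[OF sets_rotation_haar refl])
       (intro borel_measurable_continuous_onI continuous_on_matrix_mult continuous_on_id continuous_on_const)
  have "(\<integral>\<^sup>+Q. g Q \<partial>rotation_haar) = (\<integral>\<^sup>+Q. g Q \<partial>distr rotation_haar borel (\<lambda>Q. R ** Q))"
    by (simp only: rotation_haar_invariant[OF R])
  also have "\<dots> = (\<integral>\<^sup>+Q. g (R ** Q) \<partial>rotation_haar)"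
    using g by (intro nn_integral_distr[OF mL]) simp
  finally show ?thesis ..
qed

section \<open>The Grassmannian through projection matrices\<close>

definition proj_matrix :: "(real^'n) set \<Rightarrow> real^'n^'n" where
  "proj_matrix E = matrix (closest_point E)"

lemma proj_matrix_vector:
  "subspace E \<Longrightarrow> proj_matrix E *v x = closest_point E x"
  unfolding proj_matrix_def using linear_closest_point_subspace[of E] by (simp add: matrix_works linear_matrix_vector_mul_eq)

lemma subspace_matrix_image: "subspace E \<Longrightarrow> subspace ((\<lambda>x. (R :: real^'n^'n) *v x) ` E)"
  by (rule linear_subspace_image[OF matrix_vector_mul_linear])

lemma closest_point_rotated:
  fixes E :: "(real^'n) set"
  assumes E: "subspace E" and R: "orthogonal_matrix R"
  shows "closest_point ((\<lambda>x. R *v x) ` E) x = R *v closest_point E (transpose R *v x)"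
proof -
  let ?y = "closest_point E (transpose R *v x)"
  have inner: "(R *v a) \<bullet> (R *v b) = a \<bullet> b" for a b
    using orthogonal_matrix_transformation[OF R] by (simp add: orthogonal_transformation_def)
  have 1: "R *v ?y \<in> (\<lambda>x. R *v x) ` E" using closest_point_subspace_in[OF E] by blast
  have "R *v (transpose R *v x - ?y) \<in> orthogonal_comp ((\<lambda>x. R *v x) ` E)"
    using closest_point_subspace_compl[OF E, of "transpose R *v x"]
    by (auto simp: orthogonal_comp_def orthogonal_def inner)
  from closest_point_subspace_eq[OF subspace_matrix_image[OF E] 1 this]
  have "closest_point ((\<lambda>x. R *v x) ` E) (R *v ?y + R *v (transpose R *v x - ?y)) = R *v ?y" .
  moreover have "R *v ?y + R *v (transpose R *v x - ?y) = x"
    unfolding matrix_vector_right_distrib[symmetric] using orthogonal_matrix_inverse(1)[OF R, of x] by simp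
  ultimately show ?thesis by simp
qed

lemma proj_matrix_rotated:
  fixes E :: "(real^'n) set"
  assumes E: "subspace E" and R: "orthogonal_matrix R"
  shows "proj_matrix ((\<lambda>x. R *v x) ` E) = R ** proj_matrix E ** transpose R"
  unfolding matrix_eq
  by (simp only: matrix_vector_mul_assoc[symmetric] proj_matrix_vector[OF E] proj_matrix_vector[OF subspace_matrix_image[OF E]]
      closest_point_rotated[OF E R] simp_thms)

lemma grassmannian_rotated:
  assumes E: "E \<in> grassmannian j" and R: "orthogonal_matrix (R :: real^'n^'n)"
  shows "(\<lambda>x. R *v x) ` E \<in> grassmannian j"
proof -
  have inj: "inj ((*v) R)" by (rule orthogonal_transformation_inj[OF orthogonal_matrix_transformation[OF R]])
  have "dim ((\<lambda>x. R *v x) ` E) = dim E"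
    by (rule dim_image_eq[OF matrix_vector_mul_linear]) (metis inj inj_on_subset subset_UNIV)
  then show ?thesis using E subspace_matrix_image[of E R] by (simp add: grassmannian_def)
qed

text \<open>The sigma-algebra of the Grassmannian is pulled back along \<open>proj_matrix\<close>,
  so maps out of it and into it are tested on matrices. This is why integrands below have the form
  \<open>\<Phi> (proj_matrix E)\<close>.\<close>

lemma haar_measurable:
  assumes \<nu>: "is_grassmannian_haar j \<nu>"
  shows space_grassmannian_haar: "space \<nu> = grassmannian j"
    and measurable_proj_matrix: "proj_matrix \<in> measurable \<nu> borel"
    and measurable_into_grassmannian:
      "T \<in> space N \<rightarrow> grassmannian j \<Longrightarrow> (\<lambda>x. proj_matrix (T x)) \<in> measurable N borel \<Longrightarrow> T \<in> measurable N \<nu>"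
proof -
  have s: "sets \<nu> = sets (vimage_algebra (grassmannian j) proj_matrix borel)"
    using \<nu> by (simp add: is_grassmannian_haar_def grassmannian_borel_def proj_matrix_def[abs_def])
  show sp: "space \<nu> = grassmannian j" using sets_eq_imp_space_eq[OF s] by simp
  show "proj_matrix \<in> measurable \<nu> borel"
    by (subst measurable_cong_sets[OF s refl]) (rule measurable_vimage_algebra1, simp)
  show "T \<in> measurable N \<nu>" if "T \<in> space N \<rightarrow> grassmannian j" "(\<lambda>x. proj_matrix (T x)) \<in> measurable N borel"
    by (subst measurable_cong_sets[OF refl s]) (rule measurable_vimage_algebra2[OF that])
qed

text \<open>Invariance is given for images of measurable sets. The image under \<open>R\<close> is
  the preimage under the transpose, which turns it into the invariance of a pushforward
  measure.\<close>

lemma nn_integral_grassmannian_rotate: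
  fixes \<nu> :: "(real^'n) set measure"
  assumes \<nu>: "is_grassmannian_haar j \<nu>" and R: "rotation_matrix R" and \<Phi>: "\<Phi> \<in> borel_measurable borel"
  shows "(\<integral>\<^sup>+E. \<Phi> (transpose R ** proj_matrix E ** R) \<partial>\<nu>) = (\<integral>\<^sup>+E. \<Phi> (proj_matrix E) \<partial>\<nu>)"
proof -
  define T where "T R E = (\<lambda>x. R *v x) ` E" for R :: "real^'n^'n" and E :: "(real^'n) set"
  have sp: "space \<nu> = grassmannian j" by (rule space_grassmannian_haar[OF \<nu>])
  have P: "proj_matrix \<in> measurable \<nu> borel" by (rule measurable_proj_matrix[OF \<nu>])
  have oR: "orthogonal_matrix R" and oT: "orthogonal_matrix (transpose R)" using R by (auto simp: rotation_matrix_def)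
  have inv: "T R (T (transpose R) E) = E" "T (transpose R) (T R E) = E" for E
    by (auto simp: T_def image_image orthogonal_matrix_inverse[OF oR] simp del: transpose_matrix_vector)
  have TR: "T R E \<in> grassmannian j" "T (transpose R) E \<in> grassmannian j" if "E \<in> grassmannian j" for E
    unfolding T_def using grassmannian_rotated[OF that] oR oT by blast+
  have PT: "proj_matrix (T (transpose R) E) = transpose R ** proj_matrix E ** R" if "E \<in> grassmannian j" for E
    unfolding T_def using proj_matrix_rotated[OF _ oT, of E] that by (simp add: grassmannian_def)
  have mT: "T (transpose R) \<in> measurable \<nu> \<nu>"
  proof (rule measurable_into_grassmannian[OF \<nu>])
    show "T (transpose R) \<in> space \<nu> \<rightarrow> grassmannian j" using TR sp by auto
    have "(\<lambda>M. transpose R ** M ** R) \<in> borel_measurable borel"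
      by (intro borel_measurable_continuous_onI continuous_on_matrix_mult continuous_on_id continuous_on_const)
    from measurable_compose[OF P this]
    show "(\<lambda>E. proj_matrix (T (transpose R) E)) \<in> borel_measurable \<nu>"
      by (rule measurable_cong[THEN iffD1, rotated]) (simp add: PT sp)
  qed
  have "distr \<nu> \<nu> (T (transpose R)) = \<nu>"
  proof (rule measure_eqI)
    fix A assume "A \<in> sets (distr \<nu> \<nu> (T (transpose R)))"
    then have A: "A \<in> sets \<nu>" by simp
    then have Asp: "A \<subseteq> grassmannian j" using sets.sets_into_space sp by blast
    have "emeasure (distr \<nu> \<nu> (T (transpose R))) A = emeasure \<nu> (T (transpose R) -` A \<inter> space \<nu>)"
      by (rule emeasure_distr[OF mT A])
    also have "T (transpose R) -` A \<inter> space \<nu> = T R ` A"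
    proof (intro equalityI subsetI)
      fix E assume "E \<in> T (transpose R) -` A \<inter> space \<nu>"
      then have "T (transpose R) E \<in> A" by simp
      then have "T R (T (transpose R) E) \<in> T R ` A" by (rule imageI)
      then show "E \<in> T R ` A" unfolding inv .
    next
      fix E assume "E \<in> T R ` A"
      then obtain F where "F \<in> A" "E = T R F" by blast
      then show "E \<in> T (transpose R) -` A \<inter> space \<nu>" using inv Asp TR sp by auto
    qed
    also have "emeasure \<nu> (T R ` A) = emeasure \<nu> A"
      using \<nu> R A unfolding is_grassmannian_haar_def T_def[abs_def] by blast
    finally show "emeasure (distr \<nu> \<nu> (T (transpose R))) A = emeasure \<nu> A" .
  qed simp
  then have "(\<integral>\<^sup>+E. \<Phi> (proj_matrix E) \<partial>\<nu>) = (\<integral>\<^sup>+E. \<Phi> (proj_matrix E) \<partial>distr \<nu> \<nu> (T (transpose R)))" by simp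
  also have "\<dots> = (\<integral>\<^sup>+E. \<Phi> (proj_matrix (T (transpose R) E)) \<partial>\<nu>)"
    using measurable_compose[OF P \<Phi>] by (intro nn_integral_distr[OF mT]) simp
  also have "\<dots> = (\<integral>\<^sup>+E. \<Phi> (transpose R ** proj_matrix E ** R) \<partial>\<nu>)"
    by (intro nn_integral_cong) (simp add: PT sp)
  finally show ?thesis ..
qed

text \<open>Uniqueness of the rotation-invariant measure: averaging the invariance of \<open>\<nu>\<close> over all
  rotations and exchanging the integrals turns the inner integral into a constant.\<close>

lemma nn_integral_grassmannian_haar:
  fixes \<nu> :: "(real^'n) set measure"
  assumes n: "CARD('n) \<ge> 2" and j: "1 \<le> j" and \<nu>: "is_grassmannian_haar j \<nu>"
    and \<Phi>: "\<Phi> \<in> borel_measurable borel" and F: "F \<in> grassmannian j"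
  shows "(\<integral>\<^sup>+E. \<Phi> (proj_matrix E) \<partial>\<nu>) = (\<integral>\<^sup>+Q. \<Phi> (transpose Q ** proj_matrix F ** Q) \<partial>rotation_haar)"
proof -
  have sp: "space \<nu> = grassmannian j" by (rule space_grassmannian_haar[OF \<nu>])
  have P: "proj_matrix \<in> measurable \<nu> borel" by (rule measurable_proj_matrix[OF \<nu>])
  interpret H: prob_space "rotation_haar :: (real^'n^'n) measure" by (rule prob_space_rotation_haar)
  interpret \<nu>: prob_space \<nu> using \<nu> by (simp add: is_grassmannian_haar_def)
  interpret HN: pair_sigma_finite "rotation_haar :: (real^'n^'n) measure" \<nu> ..
  have cont: "continuous_on UNIV (\<lambda>p. transpose (fst p) ** snd p ** fst p :: real^'n^'n)"
    by (intro continuous_on_matrix_mult continuous_on_transpose continuous_on_fst continuous_on_snd continuous_on_id)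
  have meas: "(\<lambda>p. \<Phi> (transpose (fst p) ** snd p ** fst p)) \<in> borel_measurable (borel \<Otimes>\<^sub>M borel)"
    using measurable_compose[OF borel_measurable_continuous_onI[OF cont] \<Phi>] by (simp add: borel_prod)
  have joint: "(\<lambda>(Q, E). \<Phi> (transpose Q ** proj_matrix E ** Q)) \<in> borel_measurable (rotation_haar \<Otimes>\<^sub>M \<nu>)"
  proof -
    have "(\<lambda>p. (fst p, proj_matrix (snd p))) \<in> measurable (rotation_haar \<Otimes>\<^sub>M \<nu>) (borel \<Otimes>\<^sub>M borel)"
    proof (rule measurable_Pair)
      show "fst \<in> borel_measurable (rotation_haar \<Otimes>\<^sub>M \<nu>)"
        using measurable_fst[of "rotation_haar :: (real^'n^'n) measure" \<nu>] by (simp cong: measurable_cong_sets)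
      show "(\<lambda>p. proj_matrix (snd p)) \<in> borel_measurable (rotation_haar \<Otimes>\<^sub>M \<nu>)"
        by (rule measurable_compose[OF measurable_snd P])
    qed
    from measurable_compose[OF this meas] show ?thesis by (simp add: split_beta)
  qed
  define I where "I = (\<integral>\<^sup>+Q. \<Phi> (transpose Q ** proj_matrix F ** Q) \<partial>rotation_haar)"
  \<comment> \<open>\<open>E\<close> is a rotated copy of \<open>F\<close>, and left invariance of
    \<open>rotation_haar\<close> absorbs that rotation; so the value is the same for all
    \<open>E\<close>.\<close>
  have inner: "(\<integral>\<^sup>+Q. \<Phi> (transpose Q ** proj_matrix E ** Q) \<partial>rotation_haar) = I" if E: "E \<in> grassmannian j" for E
  proof -
    obtain S :: "real^'n^'n" where S: "rotation_matrix S" "(\<lambda>x. S *v x) ` F = E"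
      using rotation_subspace_transitive[OF n, of F E] E F j by (auto simp: grassmannian_def)
    have sF: "subspace F" using F by (simp add: grassmannian_def)
    have oS: "orthogonal_matrix S" using S by (simp add: rotation_matrix_def)
    have "proj_matrix E = S ** proj_matrix F ** transpose S" using proj_matrix_rotated[OF sF oS] S(2) by simp
    then have eq: "transpose Q ** proj_matrix E ** Q = transpose (transpose S ** Q) ** proj_matrix F ** (transpose S ** Q)" for Q
      by (simp add: matrix_transpose_mul matrix_mul_assoc)
    have "(\<lambda>Q. \<Phi> (transpose Q ** proj_matrix F ** Q)) \<in> borel_measurable borel"
      by (rule measurable_compose[OF borel_measurable_continuous_onI \<Phi>])
         (intro continuous_on_matrix_mult continuous_on_transpose continuous_on_id continuous_on_const)
    from nn_integral_rotation_haar_left[OF rotation_matrix_transpose[OF S(1)] this]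
    show ?thesis unfolding eq I_def .
  qed
  have "(\<integral>\<^sup>+E. \<Phi> (proj_matrix E) \<partial>\<nu>) = (\<integral>\<^sup>+Q. (\<integral>\<^sup>+E. \<Phi> (proj_matrix E) \<partial>\<nu>) \<partial>(rotation_haar :: (real^'n^'n) measure))"
    using H.emeasure_space_1 by simp
  also have "\<dots> = (\<integral>\<^sup>+Q. (\<integral>\<^sup>+E. \<Phi> (transpose Q ** proj_matrix E ** Q) \<partial>\<nu>) \<partial>rotation_haar)"
    using AE_rotation_haar
    by (intro nn_integral_cong_AE) (auto elim!: eventually_mono simp: nn_integral_grassmannian_rotate[OF \<nu> _ \<Phi>])
  also have "\<dots> = (\<integral>\<^sup>+E. (\<integral>\<^sup>+Q. \<Phi> (transpose Q ** proj_matrix E ** Q) \<partial>rotation_haar) \<partial>\<nu>)"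
    by (rule HN.Fubini'[symmetric, OF joint])
  also have "\<dots> = (\<integral>\<^sup>+E. I \<partial>\<nu>)" by (intro nn_integral_cong) (simp add: inner sp)
  also have "\<dots> = I" using \<nu>.emeasure_space_1 by simp
  finally show ?thesis unfolding I_def .
qed

section \<open>Kubota's formula\<close>

lemma polynomial_eq_on_nonneg:
  fixes a b :: "nat \<Rightarrow> real"
  assumes eq: "\<And>x. x \<ge> 0 \<Longrightarrow> (\<Sum>i\<le>n. a i * x ^ i) = (\<Sum>i\<le>n. b i * x ^ i)" and k: "k \<le> n"
  shows "a k = b k"
proof (rule ccontr)
  assume "a k \<noteq> b k"
  then have "\<exists>i\<le>n. a i - b i \<noteq> 0" using k by auto
  then have "finite {x. (\<Sum>i\<le>n. (a i - b i) * x ^ i) = 0}" by (simp add: polyfun_finite_roots)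
  moreover have "{0::real..} \<subseteq> {x. (\<Sum>i\<le>n. (a i - b i) * x ^ i) = 0}"
    using eq by (auto simp: left_diff_distrib sum_subtractf)
  ultimately have "finite {0::real..}" by (rule finite_subset[rotated])
  then show False by (simp add: infinite_Ici)
qed

text \<open>The coefficient of \<open>\<epsilon> ^ i\<close> in the Steiner polynomial: for a convex
  body, the intrinsic volume of index \<open>n - i\<close> times the volume of the
  \<open>i\<close>-dimensional unit ball.\<close>

definition parallel_coeff :: "nat \<Rightarrow> (real^'n) set \<Rightarrow> real" where
  "parallel_coeff i A = mean_diff i A / (fact i * grad_const TYPE('n) ^ i)"

text \<open>The definite description needs existence, supplied by the Steiner formula, and
  uniqueness, which comes from comparing two polynomials on the half-line. Powers of \<epsilon>
  descend in the definition, hence the reversal of the sum.\<close>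

lemma intrinsic_volume_eq:
  fixes K :: "(real^'n) set"
  assumes K: "compact K" "convex K" "K \<noteq> {}" and j: "j \<le> CARD('n)"
  shows "intrinsic_volume j K = parallel_coeff (CARD('n) - j) K / unit_ball_vol (real (CARD('n) - j))"
proof -
  let ?n = "CARD('n)"
  let ?a = "\<lambda>i. parallel_coeff i K"
  let ?\<kappa> = "\<lambda>i. unit_ball_vol (real i)"
  have set: "{x + \<epsilon> *\<^sub>R b | x b. x \<in> K \<and> b \<in> cball 0 1} = K + cball 0 \<epsilon>" if "\<epsilon> \<ge> 0" for \<epsilon>
  proof -
    have "{x + \<epsilon> *\<^sub>R b | x b. x \<in> K \<and> b \<in> cball 0 1} = K + (\<lambda>b. \<epsilon> *\<^sub>R b) ` cball 0 1"
      unfolding set_plus_def by blast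
    also have "(\<lambda>b. \<epsilon> *\<^sub>R b) ` cball (0 :: real^'n) 1 = cball 0 \<epsilon>"
      using cball_scale[of \<epsilon> "0 :: real^'n" 1] that by (cases "\<epsilon> = 0") (auto simp: image_constant_conv)
    finally show ?thesis .
  qed
  have vol: "measure lebesgue {x + \<epsilon> *\<^sub>R b | x b. x \<in> K \<and> b \<in> cball 0 1} = (\<Sum>i\<le>?n. ?a i * \<epsilon> ^ i)"
    if \<epsilon>: "\<epsilon> \<ge> 0" for \<epsilon>
  proof -
    have "K + cball 0 \<epsilon> \<in> sets borel" by (intro borel_compact compact_set_plus K compact_cball)
    then show ?thesis unfolding set[OF \<epsilon>]
      using steiner_formula[OF K \<epsilon>] by (simp add: measure_completion parallel_coeff_def)
  qed
  have rev: "(\<Sum>i\<le>?n. ?\<kappa> (?n - i) * V i * \<epsilon> ^ (?n - i)) = (\<Sum>i\<le>?n. (?\<kappa> i * V (?n - i)) * \<epsilon> ^ i)" for V :: "nat \<Rightarrow> real" and \<epsilon>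
    by (rule sum.reindex_bij_witness[of _ "\<lambda>i. ?n - i" "\<lambda>i. ?n - i"]) auto
  show ?thesis
    unfolding intrinsic_volume_def
  proof (rule the_equality)
    show "\<exists>V. V j = ?a (?n - j) / ?\<kappa> (?n - j) \<and> (\<forall>\<epsilon>\<ge>0. measure lebesgue {x + \<epsilon> *\<^sub>R b |x b. x \<in> K \<and> b \<in> cball 0 1} =
          (\<Sum>i\<le>?n. ?\<kappa> (?n - i) * V i * \<epsilon> ^ (?n - i)))"
    proof (intro exI[of _ "\<lambda>i. ?a (?n - i) / ?\<kappa> (?n - i)"] conjI allI impI refl)
      fix \<epsilon> :: real assume "\<epsilon> \<ge> 0"
      then show "measure lebesgue {x + \<epsilon> *\<^sub>R b |x b. x \<in> K \<and> b \<in> cball 0 1} =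
          (\<Sum>i\<le>?n. ?\<kappa> (?n - i) * (?a (?n - i) / ?\<kappa> (?n - i)) * \<epsilon> ^ (?n - i))"
        unfolding vol[OF \<open>\<epsilon> \<ge> 0\<close>] rev by (intro sum.cong refl) simp
    qed
  next
    fix v assume "\<exists>V. V j = v \<and> (\<forall>\<epsilon>\<ge>0. measure lebesgue {x + \<epsilon> *\<^sub>R b |x b. x \<in> K \<and> b \<in> cball 0 1} =
          (\<Sum>i\<le>?n. ?\<kappa> (?n - i) * V i * \<epsilon> ^ (?n - i)))"
    then obtain V where V: "V j = v" and "\<forall>\<epsilon>\<ge>0. measure lebesgue {x + \<epsilon> *\<^sub>R b |x b. x \<in> K \<and> b \<in> cball 0 1} =
          (\<Sum>i\<le>?n. ?\<kappa> (?n - i) * V i * \<epsilon> ^ (?n - i))" by blast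
    then have eq: "(\<Sum>i\<le>?n. ?a i * \<epsilon> ^ i) = (\<Sum>i\<le>?n. (?\<kappa> i * V (?n - i)) * \<epsilon> ^ i)" if "\<epsilon> \<ge> 0" for \<epsilon>
      using that vol[OF that] unfolding rev by simp
    have "?a (?n - j) = ?\<kappa> (?n - j) * V (?n - (?n - j))"
      by (rule polynomial_eq_on_nonneg[OF eq]) auto
    \<comment> \<open>The bound on \<open>j\<close> enters here: it makes
      \<open>?n - (?n - j)\<close> equal to \<open>j\<close>, so that truncated subtraction does no
      harm.\<close>
    then show "v = ?a (?n - j) / ?\<kappa> (?n - j)" using V j by (simp del: of_nat_diff)
  qed
qed

lemma cball_plus_cball:
  assumes "0 \<le> s" "0 \<le> t"
  shows "cball (0::'a::euclidean_space) s + cball 0 t = cball 0 (s + t)"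
proof (intro equalityI subsetI)
  fix x :: 'a assume "x \<in> cball 0 s + cball 0 t"
  then obtain a b where "norm a \<le> s" "norm b \<le> t" "x = a + b" unfolding set_plus_def by auto
  then show "x \<in> cball 0 (s + t)" using norm_triangle_ineq[of a b] by simp
next
  fix x :: 'a assume x: "x \<in> cball 0 (s + t)"
  show "x \<in> cball 0 s + cball 0 t"
  proof (cases "s + t = 0")
    case True
    then have "x = 0" "s = 0" "t = 0" using x assms by auto
    then show ?thesis using set_plus_intro[of 0 "cball (0::'a) s" 0 "cball 0 t"] by simp
  next
    case False
    then have st: "s + t > 0" using assms by linarith
    have "norm x \<le> s + t" using x by simp
    then have "s * norm x \<le> s * (s + t)" "t * norm x \<le> t * (s + t)" using assms by (auto intro: mult_left_mono)
    then have "(s / (s + t)) *\<^sub>R x \<in> cball 0 s" "(t / (s + t)) *\<^sub>R x \<in> cball 0 t"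
      using st assms by (auto simp: divide_le_eq abs_div)
    then have "(s / (s + t)) *\<^sub>R x + (t / (s + t)) *\<^sub>R x \<in> cball 0 s + cball 0 t" by (rule set_plus_intro)
    moreover have "(s / (s + t)) *\<^sub>R x + (t / (s + t)) *\<^sub>R x = x"
      using st by (simp add: scaleR_add_left[symmetric] add_divide_distrib[symmetric])
    ultimately show ?thesis by simp
  qed
qed

text \<open>The parallel bodies of the unit ball are the balls of radius
  \<open>1 + \<epsilon>\<close>. The binomial theorem gives the coefficients, which become the
  numerator of the constant in Kubota's formula.\<close>

lemma parallel_coeff_ball:
  assumes "i \<le> CARD('n)"
  shows "parallel_coeff i (cball (0 :: real^'n) 1) = real (CARD('n) choose i) * unit_ball_vol (real CARD('n))"
proof (rule polynomial_eq_on_nonneg[OF _ assms])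
  fix \<epsilon> :: real assume \<epsilon>: "\<epsilon> \<ge> 0"
  have "(\<Sum>i\<le>CARD('n). parallel_coeff i (cball (0 :: real^'n) 1) * \<epsilon> ^ i) = vol (cball (0 :: real^'n) 1 + cball 0 \<epsilon>)"
    unfolding parallel_coeff_def by (rule steiner_formula[symmetric]) (use \<epsilon> in auto)
  also have "\<dots> = unit_ball_vol (real CARD('n)) * (1 + \<epsilon>) ^ CARD('n)"
    using \<epsilon> content_cball[of "1 + \<epsilon>" "0 :: real^'n"] by (simp add: cball_plus_cball measure_completion)
  also have "(1 + \<epsilon>) ^ CARD('n) = (\<Sum>i\<le>CARD('n). real (CARD('n) choose i) * \<epsilon> ^ i)"
    using binomial_ring[of \<epsilon> 1 "CARD('n)"] by (simp add: add.commute)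
  finally show "(\<Sum>i\<le>CARD('n). parallel_coeff i (cball (0 :: real^'n) 1) * \<epsilon> ^ i)
    = (\<Sum>i\<le>CARD('n). real (CARD('n) choose i) * unit_ball_vol (real CARD('n)) * \<epsilon> ^ i)"
    by (simp add: sum_distrib_left mult_ac)
qed

lemma matrix_image_ccn:
  fixes K :: "(real^'n) set" and Q :: "real^'n^'n"
  assumes "compact K" "convex K" "K \<noteq> {}"
  shows "compact ((\<lambda>x. Q *v x) ` K)" "convex ((\<lambda>x. Q *v x) ` K)" "(\<lambda>x. Q *v x) ` K \<noteq> {}"
  using assms by (auto intro: compact_linear_image convex_linear_image)

lemma orthogonal_matrix_image_cball:
  assumes Q: "orthogonal_matrix (Q :: real^'n^'n)"
  shows "(\<lambda>x. Q *v x) ` cball 0 r = cball 0 r"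
proof -
  have "norm (Q *v x) = norm x" "norm (transpose Q *v x) = norm x" for x
    using orthogonal_matrix_transformation[OF Q] orthogonal_matrix_transformation[of "transpose Q"] Q
    by (auto simp: orthogonal_transformation simp del: transpose_matrix_vector)
  then show ?thesis
    using orthogonal_matrix_inverse[OF Q] by (auto simp: image_iff simp del: transpose_matrix_vector)
      (metis dist_0_norm mem_cball)
qed

text \<open>Derived from the invariance of volume by comparing Steiner polynomials; no
  transformation of the random directions is involved.\<close>

lemma mean_diff_rotate:
  fixes K :: "(real^'n) set"
  assumes K: "compact K" "convex K" "K \<noteq> {}" and Q: "orthogonal_matrix Q" and i: "i \<le> CARD('n)"
  shows "mean_diff i ((\<lambda>x. Q *v x) ` K) = mean_diff i K"
proof -
  let ?QK = "(\<lambda>x. Q *v x) ` K"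
  have "parallel_coeff i ?QK = parallel_coeff i K"
  proof (rule polynomial_eq_on_nonneg[OF _ i])
    fix \<epsilon> :: real assume \<epsilon>: "\<epsilon> \<ge> 0"
    have "?QK + cball 0 \<epsilon> = (\<lambda>x. Q *v x) ` (K + cball 0 \<epsilon>)"
      by (simp only: linear_image_plus[OF matrix_vector_mul_linear] orthogonal_matrix_image_cball[OF Q])
    moreover have "K + cball 0 \<epsilon> \<in> sets borel" by (intro borel_compact compact_set_plus K compact_cball)
    ultimately have "vol (?QK + cball 0 \<epsilon>) = vol (K + cball 0 \<epsilon>)"
      using vol_orthogonal_image[OF orthogonal_matrix_transformation[OF Q]] by (simp add: measure_def)
    then show "(\<Sum>i\<le>CARD('n). parallel_coeff i ?QK * \<epsilon> ^ i) = (\<Sum>i\<le>CARD('n). parallel_coeff i K * \<epsilon> ^ i)"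
      unfolding parallel_coeff_def steiner_formula[OF K \<epsilon>] steiner_formula[OF matrix_image_ccn[OF K] \<epsilon>] .
  qed
  then show ?thesis using grad_const(1)[where 'n='n] by (simp add: parallel_coeff_def)
qed

section \<open>Volumes of projections\<close>

definition proj_vol :: "(real^'n) set \<Rightarrow> (real^'n) set \<Rightarrow> real" where
  "proj_vol E K = measure (subspace_lborel E) (closest_point E ` K)"

lemma emeasure_subspace_compact:
  fixes E :: "(real^'n) set"
  assumes E: "subspace E" and X: "compact X" "X \<subseteq> E"
  shows "emeasure (subspace_lborel E) X = ennreal (measure (subspace_lborel E) X)"
proof -
  obtain r where r: "X \<subseteq> cball 0 r" using compact_subset_cball[OF X(1)] .
  have "emeasure (subspace_lborel E) X \<le> emeasure (subspace_lborel E) (E \<inter> cball 0 (max r 1))"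
  proof (rule emeasure_mono)
    show "X \<subseteq> E \<inter> cball 0 (max r 1)" using r X(2) by auto
    show "E \<inter> cball 0 (max r 1) \<in> sets (subspace_lborel E)"
      by (intro sets_subspace_lborelI borel_closed closed_Int closed_subspace[OF E] closed_cball Int_lower1)
  qed
  also have "\<dots> < \<infinity>" using emeasure_subspace_cball[OF E, of "max r 1"] by simp
  finally show ?thesis by (simp add: emeasure_eq_ennreal_measure)
qed

lemma closest_point_image:
  fixes E :: "(real^'n) set"
  assumes "subspace E" "compact K"
  shows "compact (closest_point E ` K)" "closest_point E ` K \<subseteq> E"
  using assms closest_point_subspace_in[OF assms(1)] by (auto intro: compact_linear_image linear_closest_point_subspace)

lemma orthogonal_comp_cball:
  fixes E :: "(real^'n) set"
  assumes E: "subspace E"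
  shows "(\<lambda>b. b - closest_point E b) ` cball 0 1 = orthogonal_comp E \<inter> cball 0 1"
proof (intro equalityI subsetI)
  fix z assume "z \<in> (\<lambda>b. b - closest_point E b) ` cball 0 1"
  then obtain b where b: "norm b \<le> 1" "z = b - closest_point E b" by auto
  have z: "z \<in> orthogonal_comp E" using b(2) closest_point_subspace_compl[OF E] by simp
  have "orthogonal (closest_point E b) z" using z closest_point_subspace_in[OF E, of b] by (auto simp: orthogonal_comp_def)
  then have "(norm (closest_point E b + z))\<^sup>2 = (norm (closest_point E b))\<^sup>2 + (norm z)\<^sup>2" by (rule norm_add_Pythagorean)
  then have "(norm z)\<^sup>2 \<le> (norm b)\<^sup>2" using b(2) by simp
  then have "norm z \<le> norm b" by (rule power2_le_imp_le) simp
  then show "z \<in> orthogonal_comp E \<inter> cball 0 1" using z b(1) by simp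
next
  fix z assume z: "z \<in> orthogonal_comp E \<inter> cball 0 1"
  have "closest_point E z = 0" using closest_point_subspace_eq[OF E subspace_0[OF E], of z] z by simp
  then show "z \<in> (\<lambda>b. b - closest_point E b) ` cball 0 1" using z by (auto intro!: image_eqI[of _ _ z])
qed

lemma closest_point_cball:
  fixes E :: "(real^'n) set"
  assumes E: "subspace E"
  shows "closest_point E ` cball 0 1 = E \<inter> cball 0 1"
proof (intro equalityI subsetI)
  fix y assume "y \<in> closest_point E ` cball 0 1"
  then obtain b where b: "norm b \<le> 1" "y = closest_point E b" by auto
  have "orthogonal y (b - y)" using closest_point_subspace_compl[OF E, of b] closest_point_subspace_in[OF E, of b] b(2)
    by (auto simp: orthogonal_comp_def)
  then have "(norm (y + (b - y)))\<^sup>2 = (norm y)\<^sup>2 + (norm (b - y))\<^sup>2" by (rule norm_add_Pythagorean)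
  then have "(norm y)\<^sup>2 \<le> (norm b)\<^sup>2" by simp
  then have "norm y \<le> norm b" by (rule power2_le_imp_le) simp
  then show "y \<in> E \<inter> cball 0 1" using b closest_point_subspace_in[OF E] by simp
next
  fix y assume "y \<in> E \<inter> cball 0 1"
  then show "y \<in> closest_point E ` cball 0 1" using closest_point_self[of y E] by (auto intro!: image_eqI[of _ _ y])
qed

lemma proj_vol_cball:
  fixes E :: "(real^'n) set"
  assumes E: "subspace E"
  shows "proj_vol E (cball 0 1) = unit_ball_vol (real (dim E))"
  unfolding proj_vol_def closest_point_cball[OF E] using emeasure_subspace_cball[OF E, of 1]
  by (simp add: measure_def)

text \<open>Defined for arbitrary matrices \<open>P\<close>, so that measurability on the Grassmannian reduces to
  Borel measurability in the entries of the projection matrix.\<close>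

definition matrix_proj_vol :: "(real^'n) set \<Rightarrow> real^'n^'n \<Rightarrow> ennreal" where
  "matrix_proj_vol K P = emeasure lborel ((\<lambda>x. P *v x) ` K + (\<lambda>b. b - P *v b) ` cball 0 1)"

text \<open>At a projection matrix the second summand is the unit ball of the orthogonal complement.
  The thickened projection is then an orthogonal product, and the extra factor depends only on
  \<open>dim E\<close>.\<close>

lemma matrix_proj_vol_eq:
  fixes E :: "(real^'n) set"
  assumes E: "subspace E" and K: "compact K"
  shows "matrix_proj_vol K (proj_matrix E) = ennreal (proj_vol E K * unit_ball_vol (real (CARD('n) - dim E)))"
proof -
  let ?F = "orthogonal_comp E"
  have F: "subspace ?F" by (rule subspace_orthogonal_comp)
  note c = closest_point_image[OF E K]
  have "matrix_proj_vol K (proj_matrix E) = emeasure lborel (closest_point E ` K + (?F \<inter> cball 0 1))"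
    unfolding matrix_proj_vol_def proj_matrix_vector[OF E] orthogonal_comp_cball[OF E] ..
  also have "\<dots> = emeasure (subspace_lborel E) (closest_point E ` K) * emeasure (subspace_lborel ?F) (?F \<inter> cball 0 1)"
    by (intro emeasure_subspace_plus E c closed_Int_compact closed_subspace F compact_cball Int_lower1)
  also have "\<dots> = ennreal (proj_vol E K) * ennreal (unit_ball_vol (real (dim ?F)))"
    using emeasure_subspace_compact[OF E c] emeasure_subspace_cball[OF F, of 1] by (simp add: proj_vol_def)
  also have "dim ?F = CARD('n) - dim E" using dim_orthogonal_comp[OF E] by simp
  finally show ?thesis by (simp add: ennreal_mult proj_vol_def)
qed

lemma closed_graph_matrix_image:
  fixes K :: "(real^'n) set"
  assumes K: "compact K" and f: "continuous_on UNIV (f :: 'p::first_countable_topology \<Rightarrow> real^'n^'m)"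
  shows "closed {(p, z). z \<in> (\<lambda>x. f p *v x) ` K}"
proof -
  have 0: "{0} + A = A" for A :: "(real^'m) set" by (metis add.left_neutral set_zero)
  have "{(p::'p, z). z \<in> {0::real^'m}} = UNIV \<times> {0}" by auto
  then have cl: "closed {(p::'p, z). z \<in> {0::real^'m}}" by (simp add: closed_Times)
  have f1: "continuous_on UNIV (\<lambda>q :: 'p \<times> (real^'n). f (fst q))"
    by (rule continuous_on_compose2[OF f]) (auto intro: continuous_intros)
  have "closed {(p, z). z \<in> {0} + (\<lambda>x. f p *v x) ` K}"
    by (rule closed_graph_plus_image[OF cl K])
       (auto simp: split_beta intro!: continuous_on_matrix_vector_mult f1 continuous_intros)
  then show ?thesis unfolding 0 .
qed

lemma borel_measurable_matrix_proj_vol: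
  fixes K :: "(real^'n) set"
  assumes K: "compact K"
  shows "matrix_proj_vol K \<in> borel_measurable borel"
  unfolding matrix_proj_vol_def[abs_def]
proof (rule borel_measurable_emeasure_section, rule closed_graph_plus_image)
  show "closed {(P :: real^'n^'n, z). z \<in> (\<lambda>x. P *v x) ` K}"
    by (rule closed_graph_matrix_image[OF K continuous_on_id])
  show "continuous_on UNIV (\<lambda>(P :: real^'n^'n, b). b - P *v b)"
    unfolding split_beta by (intro continuous_on_diff continuous_on_matrix_vector_mult continuous_on_fst continuous_on_snd continuous_on_id)
qed simp

text \<open>The ball is mapped to itself, so the two sums differ by an orthogonal image as a whole.
  Averaging over conjugates of a projection matrix thus becomes averaging over rotated copies of
  \<open>K\<close>.\<close>

lemma matrix_proj_vol_rotate:
  fixes K :: "(real^'n) set"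
  assumes K: "compact K" and Q: "orthogonal_matrix Q"
  shows "matrix_proj_vol K (transpose Q ** P ** Q) = matrix_proj_vol ((\<lambda>x. Q *v x) ` K) P"
proof -
  let ?T = "transpose Q"
  let ?S = "(\<lambda>x. P *v x) ` (\<lambda>x. Q *v x) ` K + (\<lambda>b. b - P *v b) ` cball 0 1"
  have T: "orthogonal_matrix ?T" using Q by simp
  have lin: "linear (\<lambda>x. ?T *v x)" by (rule matrix_vector_mul_linear)
  have "(\<lambda>b. b - (?T ** P ** Q) *v b) ` cball 0 1 = (\<lambda>b. b - (?T ** P ** Q) *v b) ` (\<lambda>x. ?T *v x) ` cball 0 1"
    unfolding orthogonal_matrix_image_cball[OF T] ..
  also have "\<dots> = (\<lambda>x. ?T *v x) ` (\<lambda>b. b - P *v b) ` cball 0 1"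
    unfolding image_image
    by (intro image_cong refl) (simp only: matrix_vector_mul_assoc[symmetric] orthogonal_matrix_inverse[OF Q] linear_diff[OF lin])
  finally have "(\<lambda>x. (?T ** P ** Q) *v x) ` K + (\<lambda>b. b - (?T ** P ** Q) *v b) ` cball 0 1 = (\<lambda>x. ?T *v x) ` ?S"
    by (simp only: linear_image_plus[OF lin] image_image matrix_vector_mul_assoc[symmetric])
  moreover have "?S \<in> sets borel"
    using K by (intro borel_compact compact_set_plus compact_linear_image matrix_vector_mul_linear compact_cball linear_compose_sub linear_id[unfolded id_def])
  ultimately show ?thesis
    unfolding matrix_proj_vol_def using vol_orthogonal_image[OF orthogonal_matrix_transformation[OF T]] by simp
qed

lemma proj_vol_nonneg: "proj_vol E K \<ge> 0"
  by (simp add: proj_vol_def)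

text \<open>The point is that \<open>F\<close> is arbitrary: the lemma will be applied with a
  subspace that depends on the random directions, while the left-hand side does not.\<close>

lemma integral_proj_vol:
  fixes K :: "(real^'n) set" and \<nu> :: "(real^'n) set measure"
  assumes n: "CARD('n) \<ge> 2" and j: "1 \<le> j" and \<nu>: "is_grassmannian_haar j \<nu>" and K: "compact K" and F: "F \<in> grassmannian j"
  shows "(\<integral>E. proj_vol E K \<partial>\<nu>) =
     (\<integral>Q. enn2real (matrix_proj_vol K (transpose Q ** proj_matrix F ** Q)) / unit_ball_vol (real (CARD('n) - j)) \<partial>rotation_haar)"
proof -
  let ?\<kappa> = "unit_ball_vol (real (CARD('n) - j))"
  have kp: "?\<kappa> > 0" by simp
  note m = borel_measurable_matrix_proj_vol[OF K]
  have mP: "proj_matrix \<in> measurable \<nu> borel" by (rule measurable_proj_matrix[OF \<nu>])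
  have sp: "space \<nu> = grassmannian j" by (rule space_grassmannian_haar[OF \<nu>])
  have pv: "proj_vol E K = enn2real (matrix_proj_vol K (proj_matrix E)) / ?\<kappa>" if "E \<in> grassmannian j" for E
    using that matrix_proj_vol_eq[of E K] K by (simp add: grassmannian_def proj_vol_nonneg)
  have mc: "(\<lambda>Q. transpose Q ** proj_matrix F ** Q) \<in> borel_measurable borel"
    by (intro borel_measurable_continuous_onI continuous_on_matrix_mult continuous_on_transpose continuous_on_id continuous_on_const)
  have mQ: "(\<lambda>Q. matrix_proj_vol K (transpose Q ** proj_matrix F ** Q)) \<in> borel_measurable rotation_haar"
    using measurable_compose[OF mc m] by (simp cong: measurable_cong_sets)
  have mE: "(\<lambda>E. matrix_proj_vol K (proj_matrix E)) \<in> borel_measurable \<nu>" by (rule measurable_compose[OF mP m])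
  have fin: "AE Q in rotation_haar. matrix_proj_vol K (transpose Q ** proj_matrix F ** Q) < top"
    using AE_rotation_haar
  proof eventually_elim
    case (elim Q)
    then have Q: "orthogonal_matrix Q" by (simp add: rotation_matrix_def)
    have "compact ((\<lambda>x. Q *v x) ` K)" using K by (intro compact_linear_image matrix_vector_mul_linear)
    then show ?case using F by (simp add: matrix_proj_vol_rotate[OF K Q] matrix_proj_vol_eq grassmannian_def)
  qed
  have "(\<integral>E. proj_vol E K \<partial>\<nu>) = (\<integral>E. enn2real (matrix_proj_vol K (proj_matrix E)) \<partial>\<nu>) / ?\<kappa>"
  proof -
    have "(\<integral>E. proj_vol E K \<partial>\<nu>) = (\<integral>E. enn2real (matrix_proj_vol K (proj_matrix E)) / ?\<kappa> \<partial>\<nu>)"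
      by (rule Bochner_Integration.integral_cong[OF refl]) (simp only: pv sp)
    then show ?thesis by (simp only: integral_divide_zero)
  qed
  also have "(\<integral>E. enn2real (matrix_proj_vol K (proj_matrix E)) \<partial>\<nu>) = enn2real (\<integral>\<^sup>+E. matrix_proj_vol K (proj_matrix E) \<partial>\<nu>)"
  proof -
    have "(\<integral>E. enn2real (matrix_proj_vol K (proj_matrix E)) \<partial>\<nu>) = enn2real (\<integral>\<^sup>+E. ennreal (enn2real (matrix_proj_vol K (proj_matrix E))) \<partial>\<nu>)"
      using mE by (intro integral_eq_nn_integral) auto
    also have "(\<integral>\<^sup>+E. ennreal (enn2real (matrix_proj_vol K (proj_matrix E))) \<partial>\<nu>) = (\<integral>\<^sup>+E. matrix_proj_vol K (proj_matrix E) \<partial>\<nu>)"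
      using K by (intro nn_integral_cong) (auto simp: sp grassmannian_def matrix_proj_vol_eq proj_vol_nonneg)
    finally show ?thesis .
  qed
  also have "\<dots> = enn2real (\<integral>\<^sup>+Q. matrix_proj_vol K (transpose Q ** proj_matrix F ** Q) \<partial>rotation_haar)"
    by (simp only: nn_integral_grassmannian_haar[OF n j \<nu> m F])
  also have "\<dots> = (\<integral>Q. enn2real (matrix_proj_vol K (transpose Q ** proj_matrix F ** Q)) \<partial>rotation_haar)"
  proof -
    have "(\<integral>Q. enn2real (matrix_proj_vol K (transpose Q ** proj_matrix F ** Q)) \<partial>rotation_haar)
       = enn2real (\<integral>\<^sup>+Q. ennreal (enn2real (matrix_proj_vol K (transpose Q ** proj_matrix F ** Q))) \<partial>rotation_haar)"
      using mQ by (intro integral_eq_nn_integral) auto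
    also have "(\<integral>\<^sup>+Q. ennreal (enn2real (matrix_proj_vol K (transpose Q ** proj_matrix F ** Q))) \<partial>rotation_haar)
       = (\<integral>\<^sup>+Q. matrix_proj_vol K (transpose Q ** proj_matrix F ** Q) \<partial>rotation_haar)"
      using fin by (intro nn_integral_cong_AE) (auto elim!: eventually_mono)
    finally show ?thesis ..
  qed
  finally show ?thesis by simp
qed

text \<open>The unknown volume of \<open>Z\<close> is eliminated by evaluating the same difference
  at the unit ball, whose projections have a known volume.\<close>

lemma segment_diff_eq_proj_vol:
  fixes v :: "nat \<Rightarrow> real^'n"
  assumes j: "j \<le> CARD('n)"
  obtains F where "F \<in> grassmannian j"
    "\<And>A. compact A \<Longrightarrow> convex A \<Longrightarrow> A \<noteq> {} \<Longrightarrow>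
       segment_diff (CARD('n) - j) A v = segment_diff (CARD('n) - j) (cball 0 1) v / unit_ball_vol (real j) * proj_vol F A"
proof -
  let ?k = "CARD('n) - j"
  have B: "compact (cball (0 :: real^'n) 1)" "convex (cball (0 :: real^'n) 1)" "cball (0 :: real^'n) 1 \<noteq> {}" by auto
  consider (zero) "\<And>A. compact A \<Longrightarrow> convex A \<Longrightarrow> A \<noteq> {} \<Longrightarrow> segment_diff ?k A v = 0"
  | (proj) E Z where "subspace E" "dim E + ?k = CARD('n)" "compact Z" "Z \<subseteq> orthogonal_comp E"
      "\<And>A. compact A \<Longrightarrow> convex A \<Longrightarrow> A \<noteq> {} \<Longrightarrow> segment_diff ?k A v = vol (closest_point E ` A + Z)"
    using segment_diff_projection[of ?k v] by auto
  then show thesis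
  proof cases
    \<comment> \<open>Both sides vanish, so any subspace of dimension \<open>j\<close>
      serves.\<close>
    case zero
    have "j \<le> dim (UNIV :: (real^'n) set)" using j by simp
    then obtain F :: "(real^'n) set" where F: "subspace F" "dim F = j"
      using choose_subspace_of_subspace[of j "UNIV :: (real^'n) set"] by auto
    show thesis
    proof (rule that)
      show "F \<in> grassmannian j" using F by (simp add: grassmannian_def)
      fix A :: "(real^'n) set" assume "compact A" "convex A" "A \<noteq> {}"
      then show "segment_diff ?k A v = segment_diff ?k (cball 0 1) v / unit_ball_vol (real j) * proj_vol F A"
        using zero[of A] zero[OF B] by simp
    qed
  next
    case proj
    let ?E' = "orthogonal_comp E"
    have dE: "dim E = j" using proj(2) j by linarith
    have eq: "segment_diff ?k A v = measure (subspace_lborel ?E') Z * proj_vol E A" if A: "compact A" "convex A" "A \<noteq> {}" for A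
    proof -
      note c = closest_point_image[OF proj(1) A(1)]
      have "segment_diff ?k A v = enn2real (emeasure (subspace_lborel E) (closest_point E ` A) * emeasure (subspace_lborel ?E') Z)"
        unfolding proj(5)[OF A] measure_def emeasure_subspace_plus[OF proj(1) c proj(3,4)] ..
      then show ?thesis by (simp add: enn2real_mult measure_def proj_vol_def mult.commute)
    qed
    have b: "segment_diff ?k (cball 0 1) v = measure (subspace_lborel ?E') Z * unit_ball_vol (real j)"
      unfolding eq[OF B] proj_vol_cball[OF proj(1)] dE ..
    show thesis
    proof (rule that)
      show "E \<in> grassmannian j" using proj(1) dE by (simp add: grassmannian_def)
      fix A :: "(real^'n) set" assume "compact A" "convex A" "A \<noteq> {}"
      then show "segment_diff ?k A v = segment_diff ?k (cball 0 1) v / unit_ball_vol (real j) * proj_vol E A"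
        unfolding b using eq by simp
    qed
  qed
qed

text \<open>\<open>K\<close> is replaced by a random rotation of itself and the two means are
  interchanged. For fixed directions the mean over rotations is a multiple of the mean projection
  volume, and the multiple involves only the directions and the unit ball, so the remaining mean no
  longer involves \<open>K\<close>.\<close>

lemma mean_diff_kubota:
  fixes K :: "(real^'n) set" and \<nu> :: "(real^'n) set measure"
  assumes n: "CARD('n) \<ge> 2" and j: "1 \<le> j" "j \<le> CARD('n)" and \<nu>: "is_grassmannian_haar j \<nu>"
    and K: "compact K" "convex K" "K \<noteq> {}"
  shows "mean_diff (CARD('n) - j) K = mean_diff (CARD('n) - j) (cball (0 :: real^'n) 1) / unit_ball_vol (real j) * (\<integral>E. proj_vol E K \<partial>\<nu>)"
proof -
  let ?k = "CARD('n) - j"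
  let ?I = "\<integral>E. proj_vol E K \<partial>\<nu>"
  let ?f = "\<lambda>(Q :: real^'n^'n) \<omega>. segment_diff ?k ((\<lambda>x. Q *v x) ` K) \<omega>"
  interpret H: prob_space "rotation_haar :: (real^'n^'n) measure" by (rule prob_space_rotation_haar)
  interpret HS: pair_prob_space "rotation_haar :: (real^'n^'n) measure" "ball_seq :: (nat \<Rightarrow> real^'n) measure" ..
  have mf: "(\<lambda>p. ?f (fst p) (snd p)) \<in> borel_measurable borel"
  proof (rule borel_measurable_segment_diff)
    show "closed {(p :: (real^'n^'n) \<times> (nat \<Rightarrow> real^'n), z). z \<in> (\<lambda>x. fst p *v x) ` K}"
      by (rule closed_graph_matrix_image[OF K(1)]) (intro continuous_intros)
    show "continuous_on UNIV (\<lambda>p :: (real^'n^'n) \<times> (nat \<Rightarrow> real^'n). snd p i)" for i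
      by (rule continuous_on_compose2[OF continuous_on_coord[of i]]) (auto intro: continuous_intros)
  qed
  have sets: "sets (rotation_haar \<Otimes>\<^sub>M ball_seq :: ((real^'n^'n) \<times> (nat \<Rightarrow> real^'n)) measure) = sets borel"
    using sets_pair_measure_cong[OF sets_rotation_haar sets_ball_seq] by (simp only: borel_prod)
  obtain r where r: "K \<subseteq> cball 0 r" using compact_subset_cball[OF K(1)] .
  have int: "integrable (rotation_haar \<Otimes>\<^sub>M ball_seq) (case_prod ?f)"
  proof (rule HS.integrable_const_bound)
    have good: "AE p in rotation_haar \<Otimes>\<^sub>M ball_seq. ?f (fst p) (snd p) \<le> 2 ^ ?k * vol (cball (0 :: real^'n) (r + real ?k))
        \<and> - ?f (fst p) (snd p) \<le> 2 ^ ?k * vol (cball (0 :: real^'n) (r + real ?k))"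
    proof (rule HS.AE_pair_measure)
      have "AE Q in rotation_haar. AE \<omega> in ball_seq. \<bar>?f Q \<omega>\<bar> \<le> 2 ^ ?k * vol (cball (0 :: real^'n) (r + real ?k))"
        using AE_rotation_haar
      proof eventually_elim
        case (elim Q)
        then have Q: "orthogonal_matrix Q" by (simp add: rotation_matrix_def)
        have sub: "(\<lambda>x. Q *v x) ` K \<subseteq> cball 0 r"
          using image_mono[OF r, of "\<lambda>x. Q *v x"] unfolding orthogonal_matrix_image_cball[OF Q] .
        show ?case using AE_ball_seq
          by eventually_elim (intro segment_diff_bound matrix_image_ccn K sub, auto)
      qed
      then show "AE Q in rotation_haar. AE \<omega> in ball_seq. ?f (fst (Q, \<omega>)) (snd (Q, \<omega>)) \<le> 2 ^ ?k * vol (cball (0 :: real^'n) (r + real ?k))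
        \<and> - ?f (fst (Q, \<omega>)) (snd (Q, \<omega>)) \<le> 2 ^ ?k * vol (cball (0 :: real^'n) (r + real ?k))"
        by (auto elim!: eventually_mono)
      have [measurable]: "(\<lambda>p. ?f (fst p) (snd p)) \<in> borel_measurable (rotation_haar \<Otimes>\<^sub>M ball_seq)"
        by (subst measurable_cong_sets[OF sets refl]) (rule mf)
      show "{p \<in> space (rotation_haar \<Otimes>\<^sub>M ball_seq). ?f (fst p) (snd p) \<le> 2 ^ ?k * vol (cball (0 :: real^'n) (r + real ?k))
        \<and> - ?f (fst p) (snd p) \<le> 2 ^ ?k * vol (cball (0 :: real^'n) (r + real ?k))} \<in> sets (rotation_haar \<Otimes>\<^sub>M ball_seq)"
        by measurable
    qed
    then show "AE p in rotation_haar \<Otimes>\<^sub>M ball_seq. norm (case_prod ?f p) \<le> 2 ^ ?k * vol (cball (0 :: real^'n) (r + real ?k))"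
      by eventually_elim (auto simp: split_beta abs_le_iff)
    show "case_prod ?f \<in> borel_measurable (rotation_haar \<Otimes>\<^sub>M ball_seq)"
      by (subst measurable_cong_sets[OF sets refl]) (use mf in \<open>simp add: split_beta\<close>)
  qed
  have inner: "(\<integral>Q. ?f Q \<omega> \<partial>rotation_haar) = segment_diff ?k (cball 0 1) \<omega> / unit_ball_vol (real j) * ?I" for \<omega>
  proof -
    obtain F where F: "F \<in> grassmannian j"
      "\<And>A. compact A \<Longrightarrow> convex A \<Longrightarrow> A \<noteq> {} \<Longrightarrow>
       segment_diff ?k A \<omega> = segment_diff ?k (cball 0 1) \<omega> / unit_ball_vol (real j) * proj_vol F A"
      using segment_diff_eq_proj_vol[OF j(2), of \<omega>] by blast
    let ?g = "\<lambda>Q. enn2real (matrix_proj_vol K (transpose Q ** proj_matrix F ** Q)) / unit_ball_vol (real (CARD('n) - j))"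
    let ?c = "segment_diff ?k (cball 0 1) \<omega> / unit_ball_vol (real j)"
    have "(\<integral>Q. ?f Q \<omega> \<partial>rotation_haar) = (\<integral>Q. ?c * ?g Q \<partial>rotation_haar)"
    proof (rule integral_cong_AE)
      show "AE Q in rotation_haar. ?f Q \<omega> = ?c * ?g Q"
        using AE_rotation_haar
      proof eventually_elim
        case (elim Q)
        then have Q: "orthogonal_matrix Q" by (simp add: rotation_matrix_def)
        note QK = matrix_image_ccn[OF K, of Q]
        have "?g Q = proj_vol F ((\<lambda>x. Q *v x) ` K)"
          using F(1) QK(1) by (simp add: matrix_proj_vol_rotate[OF K(1) Q] matrix_proj_vol_eq grassmannian_def proj_vol_nonneg)
        then show ?case using F(2)[OF QK] by simp
      qed
      have "(\<lambda>Q. ?f Q \<omega>) \<in> borel_measurable borel"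
        by (rule borel_measurable_segment_diff) (intro closed_graph_matrix_image K continuous_on_id continuous_on_const)+
      then show "(\<lambda>Q. ?f Q \<omega>) \<in> borel_measurable rotation_haar" by (simp cong: measurable_cong_sets)
      have mc: "(\<lambda>Q. transpose Q ** proj_matrix F ** Q) \<in> borel_measurable borel"
        by (intro borel_measurable_continuous_onI continuous_on_matrix_mult continuous_on_transpose continuous_on_id continuous_on_const)
      from measurable_compose[OF mc borel_measurable_matrix_proj_vol[OF K(1)]]
      show "(\<lambda>Q. ?c * ?g Q) \<in> borel_measurable rotation_haar" by (simp cong: measurable_cong_sets)
    qed
    also have "\<dots> = ?c * (\<integral>Q. ?g Q \<partial>rotation_haar)" by (rule integral_mult_right_zero)
    also have "(\<integral>Q. ?g Q \<partial>rotation_haar) = ?I" by (rule integral_proj_vol[OF n j(1) \<nu> K(1) F(1), symmetric])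
    finally show ?thesis .
  qed
  have "mean_diff ?k K = (\<integral>Q. mean_diff ?k K \<partial>(rotation_haar :: (real^'n^'n) measure))"
    using H.prob_space by simp
  also have "\<dots> = (\<integral>Q. (\<integral>\<omega>. ?f Q \<omega> \<partial>ball_seq) \<partial>rotation_haar)"
  proof (rule integral_cong_AE)
    show "AE Q in rotation_haar. mean_diff ?k K = (\<integral>\<omega>. ?f Q \<omega> \<partial>ball_seq)"
      using AE_rotation_haar
    proof eventually_elim
      case (elim Q)
      then have "mean_diff ?k ((\<lambda>x. Q *v x) ` K) = mean_diff ?k K"
        by (intro mean_diff_rotate[OF K]) (auto simp: rotation_matrix_def)
      then show ?case by (simp add: mean_diff_def)
    qed
    show "(\<lambda>Q. \<integral>\<omega>. ?f Q \<omega> \<partial>ball_seq) \<in> borel_measurable rotation_haar"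
      using HS.integrable_fst[OF int] by (rule borel_measurable_integrable)
  qed simp
  also have "\<dots> = (\<integral>\<omega>. (\<integral>Q. ?f Q \<omega> \<partial>rotation_haar) \<partial>ball_seq)"
    by (rule HS.Fubini_integral[OF int, symmetric])
  also have "\<dots> = mean_diff ?k (cball (0 :: real^'n) 1) / unit_ball_vol (real j) * ?I"
    unfolding inner mean_diff_def by simp
  finally show ?thesis .
qed

text \<open>The constant is read off from the unit ball.\<close>

lemma kubota:
  fixes K :: "(real^'n) set" and \<nu> :: "(real^'n) set measure"
  assumes n: "CARD('n) \<ge> 2" and j: "1 \<le> j" "j \<le> CARD('n)" and \<nu>: "is_grassmannian_haar j \<nu>"
    and K: "compact K" "convex K" "K \<noteq> {}"
  shows "intrinsic_volume j K = real (CARD('n) choose j) * unit_ball_vol (real CARD('n)) /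
     (unit_ball_vol (real j) * unit_ball_vol (real (CARD('n) - j))) * (\<integral>E. proj_vol E K \<partial>\<nu>)"
proof -
  let ?k = "CARD('n) - j"
  have "parallel_coeff ?k K = parallel_coeff ?k (cball (0 :: real^'n) 1) / unit_ball_vol (real j) * (\<integral>E. proj_vol E K \<partial>\<nu>)"
    unfolding parallel_coeff_def mean_diff_kubota[OF n j \<nu> K] by simp
  also have "parallel_coeff ?k (cball (0 :: real^'n) 1) = real (CARD('n) choose j) * unit_ball_vol (real CARD('n))"
    using parallel_coeff_ball[of ?k, where 'n='n] binomial_symmetric[OF j(2)] by simp
  finally show ?thesis
    unfolding intrinsic_volume_eq[OF K j(2)] by simp
qed

section \<open>Homogeneous convex polynomials\<close>

lemma pos_hom_convex_polynomialsD:
  fixes f :: "real^'n \<Rightarrow> real"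
  assumes f: "f \<in> pos_hom_convex_polynomials d" and d: "d \<ge> 1"
  shows pos_hom_continuous: "continuous_on UNIV f"
    and pos_hom_convex: "convex_on UNIV f"
    and pos_hom_scale: "l > 0 \<Longrightarrow> f (l *\<^sub>R x) = l ^ d * f x"
    and pos_hom_pos: "x \<noteq> 0 \<Longrightarrow> f x > 0"
    and pos_hom_0: "f 0 = 0"
    and pos_hom_nonneg: "f x \<ge> 0"
proof -
  have *: "real_polynomial_function f" "convex_on UNIV f" "\<forall>l>0. \<forall>x. f (l *\<^sub>R x) = l ^ d * f x" "\<forall>x. x \<noteq> 0 \<longrightarrow> f x > 0"
    using f by (auto simp: pos_hom_convex_polynomials_def)
  show "continuous_on UNIV f" using *(1) by (intro continuous_at_imp_continuous_on ballI continuous_real_polymonial_function)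
  show "convex_on UNIV f" by (rule *(2))
  show "l > 0 \<Longrightarrow> f (l *\<^sub>R x) = l ^ d * f x" using *(3) by blast
  show pos: "x \<noteq> 0 \<Longrightarrow> f x > 0" for x using *(4) by blast
  have "f 0 = 2 ^ d * f 0" using *(3)[rule_format, of 2 0] by simp
  moreover have "(2::real) ^ d > 1" using d by (simp add: one_less_power)
  ultimately show 0: "f 0 = 0" by (metis mult_cancel_right1 less_irrefl)
  show "f x \<ge> 0" using pos[of x] 0 by (cases "x = 0") auto
qed

text \<open>\<open>m\<close> is the minimum of \<open>f\<close> on the unit sphere. The bound makes
  sublevel sets compact and keeps the quotient \<open>norm x ^ d / f x\<close> bounded.\<close>

lemma pos_hom_lower_bound:
  fixes f :: "real^'n \<Rightarrow> real"
  assumes f: "f \<in> pos_hom_convex_polynomials d" and d: "d \<ge> 1"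
  obtains m where "m > 0" "\<And>x. m * norm x ^ d \<le> f x"
proof -
  have "sphere (0 :: real^'n) 1 \<noteq> {}" by simp
  then obtain u where u: "u \<in> sphere 0 1" "\<And>x. x \<in> sphere 0 1 \<Longrightarrow> f u \<le> f x"
    using continuous_attains_inf[OF compact_sphere, of 0 1 f] continuous_on_subset[OF pos_hom_continuous[OF f d] subset_UNIV]
    by metis
  show thesis
  proof (rule that)
    show "f u > 0" using u by (intro pos_hom_pos[OF f d]) auto
    fix x
    show "f u * norm x ^ d \<le> f x"
    proof (cases "x = 0")
      case True
      then show ?thesis using d pos_hom_0[OF f d] by (simp add: power_0_left)
    next
      case False
      then have "f x = f (norm x *\<^sub>R (x /\<^sub>R norm x))" by simp
      also have "\<dots> = norm x ^ d * f (x /\<^sub>R norm x)" using False by (intro pos_hom_scale[OF f d]) simp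
      finally have "f x = norm x ^ d * f (x /\<^sub>R norm x)" .
      moreover have "f u \<le> f (x /\<^sub>R norm x)" using False by (intro u(2)) simp
      ultimately show ?thesis using mult_left_mono[of "f u" "f (x /\<^sub>R norm x)" "norm x ^ d"] by (simp add: mult.commute)
    qed
  qed
qed

lemma sublevel_ccn:
  fixes f :: "real^'n \<Rightarrow> real"
  assumes f: "f \<in> pos_hom_convex_polynomials d" and d: "d \<ge> 1"
  shows compact_sublevel: "compact {x. f x \<le> \<alpha>}"
    and convex_sublevel_pos_hom: "convex {x. f x \<le> \<alpha>}"
    and sublevel_nonempty: "\<alpha> \<ge> 0 \<Longrightarrow> {x. f x \<le> \<alpha>} \<noteq> {}"
proof -
  obtain m where m: "m > 0" "\<And>x. m * norm x ^ d \<le> f x" using pos_hom_lower_bound[OF f d] by blast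
  have "norm x \<le> max 1 (\<alpha> / m)" if "f x \<le> \<alpha>" for x
  proof (cases "norm x \<le> 1")
    case False
    then have "norm x \<le> norm x ^ d" using d by (simp add: self_le_power)
    moreover have "norm x ^ d \<le> \<alpha> / m" using m(2)[of x] that m(1) by (simp add: le_divide_eq mult.commute)
    ultimately show ?thesis by linarith
  qed simp
  then have "bounded {x. f x \<le> \<alpha>}" unfolding bounded_iff by blast
  moreover have "closed {x. f x \<le> \<alpha>}"
    by (intro closed_Collect_le pos_hom_continuous[OF f d] continuous_on_const)
  ultimately show "compact {x. f x \<le> \<alpha>}" by (simp add: compact_eq_bounded_closed)
  show "convex {x. f x \<le> \<alpha>}"
  proof (rule convexI)
    fix x y and u v :: real assume *: "x \<in> {x. f x \<le> \<alpha>}" "y \<in> {x. f x \<le> \<alpha>}" "0 \<le> u" "0 \<le> v" "u + v = 1"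
    have "f (u *\<^sub>R x + v *\<^sub>R y) \<le> u * f x + v * f y"
      using pos_hom_convex[OF f d] * unfolding convex_on_def by blast
    also have "\<dots> \<le> u * \<alpha> + v * \<alpha>" using * by (intro add_mono mult_left_mono) auto
    also have "\<dots> = \<alpha>" using *(5) by (simp add: distrib_right[symmetric])
    finally show "u *\<^sub>R x + v *\<^sub>R y \<in> {x. f x \<le> \<alpha>}" by simp
  qed
  show "{x. f x \<le> \<alpha>} \<noteq> {}" if "\<alpha> \<ge> 0"
  proof -
    have "0 \<in> {x. f x \<le> \<alpha>}" using that pos_hom_0[OF f d] by simp
    then show ?thesis by blast
  qed
qed

text \<open>Points with \<open>f (y + z) > f y\<close> lose against \<open>z = 0\<close>, so the
  search is confined to a compact set. Attainment is what makes the projected sublevel sets equal to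
  the sublevel sets of the infimum, without passing to larger levels.\<close>

lemma inf_projection_attained:
  fixes f :: "real^'n \<Rightarrow> real"
  assumes f: "f \<in> pos_hom_convex_polynomials d" and d: "d \<ge> 1"
  obtains z where "z \<in> orthogonal_comp E" "f (y + z) = inf_projection E f y"
    "\<And>z'. z' \<in> orthogonal_comp E \<Longrightarrow> inf_projection E f y \<le> f (y + z')"
proof -
  let ?F = "orthogonal_comp E"
  have F: "subspace ?F" by (rule subspace_orthogonal_comp)
  let ?S = "?F \<inter> (+) (- y) ` {x. f x \<le> f y}"
  have S: "z \<in> ?S \<longleftrightarrow> z \<in> ?F \<and> f (y + z) \<le> f y" for z
    by (auto simp: image_iff intro!: exI[of _ "y + z"])
  have "compact ?S" by (intro closed_Int_compact closed_subspace[OF F] compact_translation compact_sublevel[OF f d])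
  moreover have "?S \<noteq> {}" using S[of 0] subspace_0[OF F] by auto
  moreover have "continuous_on ?S (\<lambda>z. f (y + z))"
    by (rule continuous_on_compose2[OF pos_hom_continuous[OF f d]]) (auto intro: continuous_intros)
  ultimately obtain z where z: "z \<in> ?S" "\<And>z'. z' \<in> ?S \<Longrightarrow> f (y + z) \<le> f (y + z')"
    using continuous_attains_inf by metis
  have min: "f (y + z) \<le> f (y + z')" if "z' \<in> ?F" for z'
  proof (cases "z' \<in> ?S")
    case False
    then have "\<not> f (y + z') \<le> f y" using S[of z'] that by blast
    then have "f y < f (y + z')" by simp
    moreover have "f (y + z) \<le> f y" using z(1) S by blast
    ultimately show ?thesis by simp
  qed (rule z(2))
  have zF: "z \<in> ?F" using z(1) by blast
  have "inf_projection E f y = f (y + z)"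
    unfolding inf_projection_def by (rule cInf_eq_minimum) (use zF min in auto)
  then show thesis using that zF min by simp
qed

lemma inf_projection_sublevel:
  fixes f :: "real^'n \<Rightarrow> real"
  assumes f: "f \<in> pos_hom_convex_polynomials d" and d: "d \<ge> 1" and E: "subspace E"
  shows "{y \<in> E. inf_projection E f y \<le> a} = closest_point E ` {x. f x \<le> a}"
proof (intro equalityI subsetI)
  fix y assume y: "y \<in> {y \<in> E. inf_projection E f y \<le> a}"
  obtain z where z: "z \<in> orthogonal_comp E" "f (y + z) = inf_projection E f y"
    using inf_projection_attained[OF f d] by metis
  have "closest_point E (y + z) = y" using y z(1) by (intro closest_point_subspace_eq[OF E]) auto
  then show "y \<in> closest_point E ` {x. f x \<le> a}" using y z(2) by (intro image_eqI[of _ _ "y + z"]) auto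
next
  fix y assume "y \<in> closest_point E ` {x. f x \<le> a}"
  then obtain x where x: "f x \<le> a" "y = closest_point E x" by blast
  have yE: "y \<in> E" and xy: "x - y \<in> orthogonal_comp E"
    unfolding x(2) by (rule closest_point_subspace_in[OF E], rule closest_point_subspace_compl[OF E])
  have "inf_projection E f y \<le> f (y + (x - y))"
    using inf_projection_attained[OF f d, of E y] xy by metis
  then show "y \<in> {y \<in> E. inf_projection E f y \<le> a}" using x(1) yE by simp
qed

lemma inf_projection_properties:
  fixes f :: "real^'n \<Rightarrow> real"
  assumes f: "f \<in> pos_hom_convex_polynomials d" and d: "d \<ge> 1" and E: "subspace E"
  shows inf_projection_measurable: "inf_projection E f \<in> borel_measurable (subspace_lborel E)"
    and inf_projection_scale: "t > 0 \<Longrightarrow> inf_projection E f (t *\<^sub>R y) = t ^ d * inf_projection E f y"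
    and inf_projection_pos: "y \<in> E \<Longrightarrow> y \<noteq> 0 \<Longrightarrow> inf_projection E f y > 0"
proof -
  show "inf_projection E f \<in> borel_measurable (subspace_lborel E)"
    unfolding borel_measurable_iff_le
  proof
    fix a
    show "{y \<in> space (subspace_lborel E). inf_projection E f y \<le> a} \<in> sets (subspace_lborel E)"
      unfolding space_subspace_lborel inf_projection_sublevel[OF f d E]
      by (intro sets_subspace_lborelI borel_compact closest_point_image compact_sublevel[OF f d] E)
  qed
  have le: "inf_projection E f (t *\<^sub>R y) \<le> t ^ d * inf_projection E f y" if t: "t > 0" for t y
  proof -
    obtain z where z: "z \<in> orthogonal_comp E" "f (y + z) = inf_projection E f y"
      using inf_projection_attained[OF f d] by metis
    have "t *\<^sub>R z \<in> orthogonal_comp E" by (rule subspace_scale[OF subspace_orthogonal_comp z(1)])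
    then have "inf_projection E f (t *\<^sub>R y) \<le> f (t *\<^sub>R y + t *\<^sub>R z)"
      using inf_projection_attained[OF f d, of E "t *\<^sub>R y"] by metis
    also have "\<dots> = f (t *\<^sub>R (y + z))" by (simp add: scaleR_add_right)
    finally show ?thesis using z(2) pos_hom_scale[OF f d t] by simp
  qed
  show "inf_projection E f (t *\<^sub>R y) = t ^ d * inf_projection E f y" if t: "t > 0"
  proof (rule antisym[OF le[OF t]])
    \<comment> \<open>The reverse inequality is the first one, applied to the point
      \<open>t *\<^sub>R y\<close> and the factor \<open>inverse t\<close>.\<close>
    have "inf_projection E f (inverse t *\<^sub>R (t *\<^sub>R y)) \<le> inverse t ^ d * inf_projection E f (t *\<^sub>R y)"
      using t by (intro le) simp
    then show "t ^ d * inf_projection E f y \<le> inf_projection E f (t *\<^sub>R y)"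
      using t by (simp add: power_inverse field_simps)
  qed
  show "inf_projection E f y > 0" if y: "y \<in> E" "y \<noteq> 0"
  proof -
    obtain z where z: "z \<in> orthogonal_comp E" "f (y + z) = inf_projection E f y"
      using inf_projection_attained[OF f d] by metis
    have "closest_point E (y + z) = y" by (rule closest_point_subspace_eq[OF E y(1) z(1)])
    moreover have "closest_point E 0 = 0" by (rule closest_point_self[OF subspace_0[OF E]])
    ultimately have "y + z \<noteq> 0" using y(2) by metis
    then show ?thesis using pos_hom_pos[OF f d] z(2) by metis
  qed
qed

text \<open>In \<open>integral_exp_homogeneous\<close> the choice \<open>H = h / \<alpha>\<close>
  makes the quotient \<open>H / h\<close> the constant \<open>1 / \<alpha>\<close>, and the
  condition \<open>H \<le> 1\<close> describes the projected sublevel set.\<close>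

lemma integral_exp_inf_projection:
  fixes f :: "real^'n \<Rightarrow> real"
  assumes f: "f \<in> pos_hom_convex_polynomials d" and d: "d \<ge> 1" and \<alpha>: "\<alpha> > 0"
    and E: "subspace E" and j: "dim E = j" "j \<ge> 1"
  shows "(\<integral>y. exp (- inf_projection E f y) \<partial>subspace_lborel E)
    = Gamma (1 + real j / real d) * (\<alpha> powr (- (real j / real d)) * proj_vol E {x. f x \<le> \<alpha>})"
proof -
  let ?h = "inf_projection E f" and ?S = "subspace_lborel E" and ?p = "real j / real d"
  let ?X = "closest_point E ` {x. f x \<le> \<alpha>}"
  note P = inf_projection_properties[OF f d E]
  have p: "?p > 0" using j d by simp
  note c = closest_point_image[OF E compact_sublevel[OF f d, of \<alpha>]]
  have X: "?X \<in> sets ?S" by (intro sets_subspace_lborelI borel_compact c)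
  note [measurable] = P(1)
  have "(\<integral>\<^sup>+y. ennreal (exp (- ?h y)) \<partial>?S)
    = ennreal (Gamma (1 + ?p)) * (\<integral>\<^sup>+y. ennreal (((?h y / \<alpha>) / ?h y) powr ?p) * indicator {y. ?h y / \<alpha> \<le> 1} y \<partial>?S)"
    unfolding j(1)[symmetric]
  proof (rule integral_exp_homogeneous[OF E _ d])
    show "1 \<le> dim E" using j by simp
    show "(\<lambda>y. ?h y / \<alpha>) \<in> borel_measurable ?S" by measurable
    show "\<And>t y. y \<in> E \<Longrightarrow> 0 < t \<Longrightarrow> ?h (t *\<^sub>R y) / \<alpha> = t ^ d * (?h y / \<alpha>)" using P(2) by simp
    show "\<And>y. y \<in> E \<Longrightarrow> y \<noteq> 0 \<Longrightarrow> 0 < ?h y / \<alpha>" using P(3) \<alpha> by simp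
  qed (use P in auto)
  also have "(\<integral>\<^sup>+y. ennreal (((?h y / \<alpha>) / ?h y) powr ?p) * indicator {y. ?h y / \<alpha> \<le> 1} y \<partial>?S)
    = (\<integral>\<^sup>+y. ennreal (\<alpha> powr (- ?p)) * indicator ?X y \<partial>?S)"
  proof (rule nn_integral_cong_AE)
    have "AE y in ?S. y \<in> E" using AE_space[of ?S] by simp
    moreover have "AE y in ?S. y \<noteq> 0" using j by (intro AE_subspace_lborel_nonzero E) simp
    ultimately show "AE y in ?S. ennreal (((?h y / \<alpha>) / ?h y) powr ?p) * indicator {y. ?h y / \<alpha> \<le> 1} y = ennreal (\<alpha> powr (- ?p)) * indicator ?X y"
    proof eventually_elim
      case (elim y)
      have hy: "?h y > 0" using P(3) elim by blast
      have "((?h y / \<alpha>) / ?h y) powr ?p = \<alpha> powr (- ?p)"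
        using hy \<alpha> by (simp add: powr_divide powr_minus_divide)
      moreover have "?h y / \<alpha> \<le> 1 \<longleftrightarrow> y \<in> ?X"
        unfolding inf_projection_sublevel[OF f d E, symmetric] using \<alpha> elim by simp
      ultimately show ?case by (simp add: indicator_def)
    qed
  qed
  also have "\<dots> = ennreal (\<alpha> powr (- ?p)) * emeasure ?S ?X" by (rule nn_integral_cmult_indicator[OF X])
  also have "emeasure ?S ?X = ennreal (proj_vol E {x. f x \<le> \<alpha>})"
    unfolding proj_vol_def by (rule emeasure_subspace_compact[OF E c])
  finally have *: "(\<integral>\<^sup>+y. ennreal (exp (- ?h y)) \<partial>?S) = ennreal (Gamma (1 + ?p)) * (ennreal (\<alpha> powr (- ?p)) * ennreal (proj_vol E {x. f x \<le> \<alpha>}))" .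
  have "(\<integral>y. exp (- ?h y) \<partial>?S) = enn2real (\<integral>\<^sup>+y. ennreal (exp (- ?h y)) \<partial>?S)"
    by (rule integral_eq_nn_integral) auto
  also have "\<dots> = Gamma (1 + ?p) * (\<alpha> powr (- ?p) * proj_vol E {x. f x \<le> \<alpha>})"
    unfolding * using p by (simp add: enn2real_mult proj_vol_nonneg Gamma_real_nonneg)
  finally show ?thesis .
qed

section \<open>Means over rotations and dual volumes\<close>

lemma borel_measurable_indicator_cball:
  fixes f :: "'p \<Rightarrow> 'a::euclidean_space"
  assumes "f \<in> borel_measurable M"
  shows "(\<lambda>x. indicator (cball 0 1) (f x) :: ennreal) \<in> borel_measurable M"
  by (rule measurable_compose[OF assms borel_measurable_indicator]) simp

text \<open>In dimension at least \<open>2\<close> this is the mean of \<open>q\<close> over the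
  unit sphere, written as a mean over rotations of one coordinate vector; the choice of the
  coordinate is immaterial.\<close>

definition rotation_mean :: "(real^'n \<Rightarrow> ennreal) \<Rightarrow> ennreal" where
  "rotation_mean q = (\<integral>\<^sup>+Q. q (transpose Q *v axis undefined 1) \<partial>rotation_haar)"

text \<open>Multiplying \<open>Q\<close> from the left by a rotation acts on the vector inside
  \<open>transpose Q *v y\<close>, which is the reason for the transpose. Left invariance then moves
  \<open>y\<close> to a multiple of the coordinate vector, and homogeneity removes the
  factor.\<close>

lemma rotation_mean_eq:
  fixes q :: "real^'n \<Rightarrow> ennreal"
  assumes n: "CARD('n) \<ge> 2" and q: "q \<in> borel_measurable borel"
    and hom: "\<And>t x. t > 0 \<Longrightarrow> q (t *\<^sub>R x) = q x" and y: "y \<noteq> 0"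
  shows "(\<integral>\<^sup>+Q. q (transpose Q *v y) \<partial>rotation_haar) = rotation_mean q"
proof -
  have "norm (y /\<^sub>R norm y) = 1" using y by simp
  then obtain R where R: "rotation_matrix R" "R *v axis undefined 1 = y /\<^sub>R norm y"
    using rotation_matrix_exists_basis[OF n, of _ undefined] by blast
  have eq: "q (transpose Q *v y) = q (transpose (transpose R ** Q) *v axis undefined 1)" for Q
  proof -
    have "transpose (transpose R ** Q) *v axis undefined 1 = transpose Q *v (R *v axis undefined 1)"
      by (simp only: matrix_transpose_mul transpose_transpose matrix_vector_mul_assoc)
    also have "\<dots> = inverse (norm y) *\<^sub>R (transpose Q *v y)"
      unfolding R(2) by (rule linear_scale[OF matrix_vector_mul_linear])
    finally show ?thesis using hom[of "inverse (norm y)"] y by simp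
  qed
  have m: "(\<lambda>Q. q (transpose Q *v axis undefined 1)) \<in> borel_measurable borel"
    by (rule measurable_compose[OF borel_measurable_continuous_onI q])
       (intro continuous_on_matrix_vector_mult continuous_on_transpose continuous_on_id continuous_on_const)
  show ?thesis
    unfolding eq rotation_mean_def by (rule nn_integral_rotation_haar_left[OF rotation_matrix_transpose[OF R(1)] m])
qed

lemma nn_integral_orthogonal:
  fixes g :: "real^'n \<Rightarrow> ennreal"
  assumes Q: "orthogonal_matrix Q" and g: "g \<in> borel_measurable borel"
  shows "(\<integral>\<^sup>+x. g (Q *v x) \<partial>lborel) = (\<integral>\<^sup>+x. g x \<partial>lborel)"
proof -
  have "(\<lambda>x. Q *v x) \<in> borel_measurable borel"
    by (rule borel_measurable_linear[OF matrix_vector_mul_linear])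
  then have m: "(\<lambda>x. Q *v x) \<in> borel_measurable lborel" by simp
  have "(\<integral>\<^sup>+x. g x \<partial>lborel) = (\<integral>\<^sup>+x. g x \<partial>distr lborel borel (\<lambda>x. Q *v x))"
    by (simp only: distr_lborel_orthogonal_transformation[OF orthogonal_matrix_transformation[OF Q]])
  also have "\<dots> = (\<integral>\<^sup>+x. g (Q *v x) \<partial>lborel)" using g by (intro nn_integral_distr[OF m]) simp
  finally show ?thesis ..
qed

text \<open>Only the rotations are averaged, so \<open>M\<close> may be quite general: it will be
  Lebesgue measure on a subspace and on the whole space. Tonelli brings the mean over rotations
  inside, where it is constant off the origin.\<close>

lemma nn_integral_ball_rotation_mean:
  fixes q :: "real^'n \<Rightarrow> ennreal"
  assumes n: "CARD('n) \<ge> 2" and q: "q \<in> borel_measurable borel"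
    and hom: "\<And>t x. t > 0 \<Longrightarrow> q (t *\<^sub>R x) = q x"
    and M: "sigma_finite_measure M" "id \<in> borel_measurable M" "AE x in M. x \<noteq> 0"
  shows "(\<integral>\<^sup>+Q. (\<integral>\<^sup>+x. q (transpose Q *v x) * indicator (cball 0 1) x \<partial>M) \<partial>rotation_haar)
    = rotation_mean q * (\<integral>\<^sup>+x. indicator (cball 0 1) x \<partial>M)"
proof -
  interpret H: prob_space "rotation_haar :: (real^'n^'n) measure" by (rule prob_space_rotation_haar)
  interpret M: sigma_finite_measure M by (rule M(1))
  interpret MH: pair_sigma_finite M "rotation_haar :: (real^'n^'n) measure" ..
  have c: "continuous_on UNIV (\<lambda>p :: (real^'n) \<times> (real^'n^'n). transpose (snd p) *v fst p)"
    by (intro continuous_on_matrix_vector_mult continuous_on_transpose continuous_on_fst continuous_on_snd continuous_on_id)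
  have pr: "(\<lambda>p. (fst p, snd p)) \<in> measurable (M \<Otimes>\<^sub>M rotation_haar) (borel \<Otimes>\<^sub>M (borel :: (real^'n^'n) measure))"
  proof (rule measurable_Pair)
    show "fst \<in> borel_measurable (M \<Otimes>\<^sub>M (rotation_haar :: (real^'n^'n) measure))"
      using measurable_compose[OF measurable_fst M(2)] by simp
    show "snd \<in> borel_measurable (M \<Otimes>\<^sub>M (rotation_haar :: (real^'n^'n) measure))"
      using measurable_snd[of M "rotation_haar :: (real^'n^'n) measure"] by (simp cong: measurable_cong_sets)
  qed
  have "(\<lambda>p. q (transpose (snd p) *v fst p) * indicator (cball 0 1) (fst p)) \<in> borel_measurable (borel \<Otimes>\<^sub>M (borel :: (real^'n^'n) measure))"
  proof (rule borel_measurable_times_ennreal)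
    show "(\<lambda>p. q (transpose (snd p) *v fst p)) \<in> borel_measurable (borel \<Otimes>\<^sub>M (borel :: (real^'n^'n) measure))"
      using measurable_compose[OF borel_measurable_continuous_onI[OF c] q] by (simp add: borel_prod)
    show "(\<lambda>p. indicator (cball 0 1) (fst p) :: ennreal) \<in> borel_measurable ((borel :: (real^'n) measure) \<Otimes>\<^sub>M (borel :: (real^'n^'n) measure))"
      by (rule borel_measurable_indicator_cball) simp
  qed
  from measurable_compose[OF pr this]
  have joint: "(\<lambda>(x, Q). q (transpose Q *v x) * indicator (cball 0 1) x) \<in> borel_measurable (M \<Otimes>\<^sub>M rotation_haar)"
    by (simp add: split_beta)
  have ind: "(\<lambda>x. indicator (cball 0 1) x :: ennreal) \<in> borel_measurable M"
    using borel_measurable_indicator_cball[OF M(2)] by simp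
  have mq: "(\<lambda>Q. q (transpose Q *v x)) \<in> borel_measurable rotation_haar" for x
  proof -
    have "(\<lambda>Q. q (transpose Q *v x)) \<in> borel_measurable borel"
      by (rule measurable_compose[OF borel_measurable_continuous_onI q])
         (intro continuous_on_matrix_vector_mult continuous_on_transpose continuous_on_id continuous_on_const)
    then show ?thesis by (simp cong: measurable_cong_sets)
  qed
  have "(\<integral>\<^sup>+Q. (\<integral>\<^sup>+x. q (transpose Q *v x) * indicator (cball 0 1) x \<partial>M) \<partial>rotation_haar)
    = (\<integral>\<^sup>+x. (\<integral>\<^sup>+Q. q (transpose Q *v x) * indicator (cball 0 1) x \<partial>rotation_haar) \<partial>M)"
    by (rule MH.Fubini'[OF joint])
  also have "\<dots> = (\<integral>\<^sup>+x. rotation_mean q * indicator (cball 0 1) x \<partial>M)"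
    using M(3) by (intro nn_integral_cong_AE) (auto elim!: eventually_mono simp: nn_integral_multc[OF mq] rotation_mean_eq[OF n q hom] simp del: transpose_matrix_vector)
  also have "\<dots> = rotation_mean q * (\<integral>\<^sup>+x. indicator (cball 0 1) x \<partial>M)"
    by (rule nn_integral_cmult[OF ind])
  finally show ?thesis .
qed

text \<open>Thickening by the unit ball of the complement rewrites an integral over \<open>E\<close>
  as an integral over the whole space in which \<open>E\<close> occurs only through its projection.
  Measurability in \<open>E\<close> can then be read off.\<close>

lemma nn_integral_closest_point:
  fixes g :: "real^'n \<Rightarrow> ennreal"
  assumes E: "subspace E" and g: "g \<in> borel_measurable borel"
  shows "(\<integral>\<^sup>+x. g (closest_point E x) * indicator (cball 0 1) (x - closest_point E x) \<partial>lborel)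
    = ennreal (unit_ball_vol (real (CARD('n) - dim E))) * (\<integral>\<^sup>+y. g y \<partial>subspace_lborel E)"
proof -
  let ?F = "orthogonal_comp E"
  have F: "subspace ?F" by (rule subspace_orthogonal_comp)
  interpret sF: sigma_finite_measure "subspace_lborel ?F" by (rule sigma_finite_subspace_lborel[OF F])
  have [measurable]: "closest_point E \<in> borel_measurable borel"
    by (rule borel_measurable_linear[OF linear_closest_point_subspace[OF E]])
  note [measurable] = g
  let ?G = "\<lambda>x. g (closest_point E x) * indicator (cball 0 1) (x - closest_point E x)"
  have mG: "?G \<in> borel_measurable borel"
  proof (rule borel_measurable_times_ennreal)
    show "(\<lambda>x. g (closest_point E x)) \<in> borel_measurable borel" by measurable
    show "(\<lambda>x. indicator (cball 0 1) (x - closest_point E x) :: ennreal) \<in> borel_measurable borel"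
      by (rule borel_measurable_indicator_cball) measurable
  qed
  have m1: "fst \<in> borel_measurable (subspace_lborel E \<Otimes>\<^sub>M subspace_lborel ?F)"
    by (rule measurable_compose[OF measurable_fst measurable_subspace_lborelI]) simp
  have m2: "snd \<in> borel_measurable (subspace_lborel E \<Otimes>\<^sub>M subspace_lborel ?F)"
    by (rule measurable_compose[OF measurable_snd measurable_subspace_lborelI]) simp
  have m: "(\<lambda>(x, y). x + y) \<in> measurable (subspace_lborel E \<Otimes>\<^sub>M subspace_lborel ?F) (borel :: (real^'n) measure)"
    unfolding split_beta by (rule borel_measurable_add[OF m1 m2])
  have ind: "(\<lambda>z. indicator (cball 0 1) z :: ennreal) \<in> borel_measurable (subspace_lborel ?F)"
    by (intro measurable_subspace_lborelI borel_measurable_indicator_cball) simp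
  have "(\<integral>\<^sup>+x. ?G x \<partial>lborel) = (\<integral>\<^sup>+x. ?G x \<partial>distr (subspace_lborel E \<Otimes>\<^sub>M subspace_lborel ?F) borel (\<lambda>(x, y). x + y))"
    by (simp only: distr_subspace_lborel_sum[OF E])
  also have "\<dots> = (\<integral>\<^sup>+p. ?G (case p of (x, y) \<Rightarrow> x + y) \<partial>(subspace_lborel E \<Otimes>\<^sub>M subspace_lborel ?F))"
    using mG by (intro nn_integral_distr[OF m]) simp
  also have "\<dots> = (\<integral>\<^sup>+p. g (fst p) * indicator (cball 0 1) (snd p) \<partial>(subspace_lborel E \<Otimes>\<^sub>M subspace_lborel ?F))"
    by (intro nn_integral_cong) (auto simp: space_pair_measure closest_point_subspace_eq[OF E])
  also have "\<dots> = (\<integral>\<^sup>+y. (\<integral>\<^sup>+z. g (fst (y, z)) * indicator (cball 0 1) (snd (y, z)) \<partial>subspace_lborel ?F) \<partial>subspace_lborel E)"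
  proof (rule sF.nn_integral_fst[symmetric], rule borel_measurable_times_ennreal)
    show "(\<lambda>p. g (fst p)) \<in> borel_measurable (subspace_lborel E \<Otimes>\<^sub>M subspace_lborel ?F)" by (rule measurable_compose[OF m1 g])
    show "(\<lambda>p. indicator (cball 0 1) (snd p) :: ennreal) \<in> borel_measurable (subspace_lborel E \<Otimes>\<^sub>M subspace_lborel ?F)"
      by (rule borel_measurable_indicator_cball[OF m2])
  qed
  also have "\<dots> = (\<integral>\<^sup>+y. g y * (\<integral>\<^sup>+z. indicator (cball 0 1) z \<partial>subspace_lborel ?F) \<partial>subspace_lborel E)"
    by (intro nn_integral_cong) (simp add: nn_integral_cmult[OF ind])
  also have "(\<integral>\<^sup>+z. indicator (cball 0 1) z \<partial>subspace_lborel ?F) = (\<integral>\<^sup>+z. indicator (?F \<inter> cball 0 1) z \<partial>subspace_lborel ?F)"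
    by (intro nn_integral_cong) (auto simp: indicator_def)
  also have "\<dots> = emeasure (subspace_lborel ?F) (?F \<inter> cball 0 1)"
    by (intro nn_integral_indicator sets_subspace_lborelI borel_closed closed_Int closed_subspace[OF F] closed_cball Int_lower1)
  also have "\<dots> = ennreal (unit_ball_vol (real (CARD('n) - dim E)))"
    using emeasure_subspace_cball[OF F, of 1] dim_orthogonal_comp[OF E] by (simp add: of_nat_diff[symmetric] del: of_nat_diff)
      (metis add_diff_cancel_right')
  also have "(\<integral>\<^sup>+y. g y * ennreal (unit_ball_vol (real (CARD('n) - dim E))) \<partial>subspace_lborel E)
    = ennreal (unit_ball_vol (real (CARD('n) - dim E))) * (\<integral>\<^sup>+y. g y \<partial>subspace_lborel E)"
    by (subst nn_integral_multc[OF measurable_subspace_lborelI[OF g]]) (rule mult.commute)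
  finally show ?thesis .
qed

lemma nn_integral_cball_subspace:
  fixes E :: "(real^'n) set"
  assumes E: "subspace E"
  shows "(\<integral>\<^sup>+y. indicator (cball 0 1) y \<partial>subspace_lborel E) = ennreal (unit_ball_vol (real (dim E)))"
proof -
  have "(\<integral>\<^sup>+y. indicator (cball 0 1) y \<partial>subspace_lborel E) = (\<integral>\<^sup>+y. indicator (E \<inter> cball 0 1) y \<partial>subspace_lborel E)"
    by (intro nn_integral_cong) (auto simp: indicator_def)
  also have "\<dots> = emeasure (subspace_lborel E) (E \<inter> cball 0 1)"
    by (intro nn_integral_indicator sets_subspace_lborelI borel_closed closed_Int closed_subspace[OF E] closed_cball Int_lower1)
  finally show ?thesis using emeasure_subspace_cball[OF E, of 1] by simp
qed

lemma AE_rotation_cball: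
  "AE Q in rotation_haar. \<forall>x. indicator (cball 0 1) (transpose Q *v x) = (indicator (cball 0 1) (x :: real^'n) :: ennreal)"
  using AE_rotation_haar
proof eventually_elim
  case (elim Q)
  have "orthogonal_matrix (transpose Q)" using elim by (simp add: rotation_matrix_def)
  then have "norm (transpose Q *v x) = norm x" for x
    using orthogonal_matrix_transformation orthogonal_transformation by blast
  then show ?case by (simp add: indicator_def del: transpose_matrix_vector)
qed

text \<open>Averaging over the rotations turns \<open>q\<close> into a constant away from the origin.\<close>

lemma grassmannian_mean_homogeneous:
  fixes q :: "real^'n \<Rightarrow> ennreal" and \<nu> :: "(real^'n) set measure"
  assumes n: "CARD('n) \<ge> 2" and j: "1 \<le> j" and \<nu>: "is_grassmannian_haar j \<nu>" and q: "q \<in> borel_measurable borel"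
    and hom: "\<And>t x. t > 0 \<Longrightarrow> q (t *\<^sub>R x) = q x"
  shows "(\<lambda>E. \<integral>\<^sup>+y. q y * indicator (cball 0 1) y \<partial>subspace_lborel E) \<in> borel_measurable \<nu>"
    and "(\<integral>\<^sup>+E. (\<integral>\<^sup>+y. q y * indicator (cball 0 1) y \<partial>subspace_lborel E) \<partial>\<nu>) = ennreal (unit_ball_vol (real j)) * rotation_mean q"
    and "(\<integral>\<^sup>+x. q x * indicator (cball 0 1) x \<partial>lborel) = ennreal (unit_ball_vol (real CARD('n))) * rotation_mean q"
proof -
  let ?\<kappa> = "unit_ball_vol (real (CARD('n) - j))"
  let ?W = "\<lambda>E. \<integral>\<^sup>+y. q y * indicator (cball 0 1) y \<partial>subspace_lborel E"
  have sp: "space \<nu> = grassmannian j" by (rule space_grassmannian_haar[OF \<nu>])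
  have mP: "proj_matrix \<in> measurable \<nu> borel" by (rule measurable_proj_matrix[OF \<nu>])
  interpret \<nu>: prob_space \<nu> using \<nu> by (simp add: is_grassmannian_haar_def)
  obtain F :: "(real^'n) set" where F: "F \<in> grassmannian j" using \<nu>.not_empty unfolding sp by blast
  have sF: "subspace F" "dim F = j" using F by (auto simp: grassmannian_def)
  define g where "g x = q x * indicator (cball 0 1) x" for x
  have g[measurable]: "g \<in> borel_measurable borel"
    unfolding g_def by (intro borel_measurable_times_ennreal q borel_measurable_indicator_cball) simp
  \<comment> \<open>Defined for every matrix, so that it is Borel by Tonelli; at projection matrices
    it is a constant multiple of the integral over the subspace.\<close>
  define \<Psi> where "\<Psi> P = (\<integral>\<^sup>+x. g (P *v x) * indicator (cball 0 1) (x - P *v x) \<partial>lborel)" for P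
  have \<Psi>: "\<Psi> \<in> borel_measurable borel"
    unfolding \<Psi>_def
  proof (rule lborel.borel_measurable_nn_integral)
    have c: "continuous_on UNIV (\<lambda>p :: (real^'n^'n) \<times> (real^'n). fst p *v snd p)"
      by (intro continuous_on_matrix_vector_mult continuous_on_fst continuous_on_snd continuous_on_id)
    have m: "(\<lambda>p :: (real^'n^'n) \<times> (real^'n). fst p *v snd p) \<in> borel_measurable (borel \<Otimes>\<^sub>M borel)"
      using borel_measurable_continuous_onI[OF c] by (simp add: borel_prod)
    have "(\<lambda>p :: (real^'n^'n) \<times> (real^'n). g (fst p *v snd p) * indicator (cball 0 1) (snd p - fst p *v snd p)) \<in> borel_measurable (borel \<Otimes>\<^sub>M borel)"
      by (intro borel_measurable_times_ennreal measurable_compose[OF m g] borel_measurable_indicator_cball borel_measurable_diff m) simp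
    then show "(\<lambda>(P :: real^'n^'n, x). g (P *v x) * indicator (cball 0 1) (x - P *v x)) \<in> borel_measurable (borel \<Otimes>\<^sub>M lborel)"
      by (simp add: split_beta cong: measurable_cong_sets)
  qed
  have \<Psi>E: "\<Psi> (proj_matrix E) = ennreal ?\<kappa> * ?W E" if "E \<in> grassmannian j" for E
  proof -
    have "subspace E" "dim E = j" using that by (auto simp: grassmannian_def)
    then have "\<Psi> (proj_matrix E) = ennreal ?\<kappa> * (\<integral>\<^sup>+y. g y \<partial>subspace_lborel E)"
      using nn_integral_closest_point[of E g] g by (simp add: \<Psi>_def proj_matrix_vector)
    then show ?thesis unfolding g_def .
  qed
  have cancel: "ennreal (1 / ?\<kappa>) * (ennreal ?\<kappa> * X) = X" for X
    by (simp add: mult.assoc[symmetric] ennreal_mult[symmetric])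
  have W: "?W E = ennreal (1 / ?\<kappa>) * \<Psi> (proj_matrix E)" if "E \<in> grassmannian j" for E
    unfolding \<Psi>E[OF that] cancel ..
  have m\<Psi>P: "(\<lambda>E. \<Psi> (proj_matrix E)) \<in> borel_measurable \<nu>" by (rule measurable_compose[OF mP \<Psi>])
  have "(\<lambda>E. ennreal (1 / ?\<kappa>) * \<Psi> (proj_matrix E)) \<in> borel_measurable \<nu>" using m\<Psi>P by measurable
  then show "?W \<in> borel_measurable \<nu>"
    by (rule measurable_cong[THEN iffD1, rotated]) (simp only: W sp)
  \<comment> \<open>Substituting \<open>Q *v x\<close> for \<open>x\<close> replaces the conjugated
    projection by the fixed one onto \<open>F\<close> and moves the rotation into the argument of
    \<open>q\<close>.\<close>
  have rot: "AE Q in rotation_haar. \<Psi> (transpose Q ** proj_matrix F ** Q)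
      = ennreal ?\<kappa> * (\<integral>\<^sup>+y. q (transpose Q *v y) * indicator (cball 0 1) y \<partial>subspace_lborel F)"
    using AE_rotation_haar AE_rotation_cball
  proof eventually_elim
    case (elim Q)
    have Q: "orthogonal_matrix Q" using elim by (simp add: rotation_matrix_def)
    have T: "orthogonal_matrix (transpose Q)" using Q by simp
    have normT: "norm (transpose Q *v x) = norm x" for x
      using T orthogonal_matrix_transformation orthogonal_transformation by blast
    let ?P = "proj_matrix F"
    have mT: "(\<lambda>x. transpose Q *v x) \<in> borel_measurable borel"
      by (rule borel_measurable_linear[OF matrix_vector_mul_linear])
    have mP: "(\<lambda>x. ?P *v x) \<in> borel_measurable borel"
      by (rule borel_measurable_linear[OF matrix_vector_mul_linear])
    have gT: "(\<lambda>x. g (transpose Q *v x)) \<in> borel_measurable borel" by (rule measurable_compose[OF mT g])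
    have "(\<lambda>x. g (transpose Q *v (?P *v x)) * indicator (cball 0 1) (x - ?P *v x)) \<in> borel_measurable borel"
    proof (rule borel_measurable_times_ennreal)
      show "(\<lambda>x. g (transpose Q *v (?P *v x))) \<in> borel_measurable borel" by (rule measurable_compose[OF mP gT])
      show "(\<lambda>x. indicator (cball 0 1) (x - ?P *v x) :: ennreal) \<in> borel_measurable borel"
        by (intro borel_measurable_indicator_cball borel_measurable_diff mP) simp
    qed
    from nn_integral_orthogonal[OF Q this]
    have "(\<integral>\<^sup>+x. g (transpose Q *v (?P *v x)) * indicator (cball 0 1) (x - ?P *v x) \<partial>lborel)
      = (\<integral>\<^sup>+x. g (transpose Q *v (?P *v (Q *v x))) * indicator (cball 0 1) (Q *v x - ?P *v (Q *v x)) \<partial>lborel)" ..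
    also have "\<dots> = \<Psi> (transpose Q ** ?P ** Q)"
      unfolding \<Psi>_def
    proof (rule nn_integral_cong)
      fix x
      have "x - (transpose Q ** ?P ** Q) *v x = transpose Q *v (Q *v x - ?P *v (Q *v x))"
        by (simp only: linear_diff[OF matrix_vector_mul_linear] orthogonal_matrix_inverse[OF Q] matrix_vector_mul_assoc[symmetric])
      then have "norm (x - (transpose Q ** ?P ** Q) *v x) = norm (Q *v x - ?P *v (Q *v x))" by (simp only: normT)
      then have "(indicator (cball 0 1) (x - (transpose Q ** ?P ** Q) *v x) :: ennreal) = indicator (cball 0 1) (Q *v x - ?P *v (Q *v x))"
        by (simp only: indicator_def mem_cball dist_0_norm)
      then show "g (transpose Q *v (?P *v (Q *v x))) * indicator (cball 0 1) (Q *v x - ?P *v (Q *v x))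
        = g ((transpose Q ** ?P ** Q) *v x) * indicator (cball 0 1) (x - (transpose Q ** ?P ** Q) *v x)"
        by (simp only: matrix_vector_mul_assoc[symmetric])
    qed
    also have "(\<integral>\<^sup>+x. g (transpose Q *v (?P *v x)) * indicator (cball 0 1) (x - ?P *v x) \<partial>lborel)
      = ennreal ?\<kappa> * (\<integral>\<^sup>+y. g (transpose Q *v y) \<partial>subspace_lborel F)"
      using nn_integral_closest_point[OF sF(1) gT] unfolding proj_matrix_vector[OF sF(1)] sF(2) .
    finally show ?case unfolding g_def elim(2)[rule_format] by (rule sym)
  qed
  have "(\<integral>\<^sup>+E. \<Psi> (proj_matrix E) \<partial>\<nu>) = (\<integral>\<^sup>+Q. \<Psi> (transpose Q ** proj_matrix F ** Q) \<partial>rotation_haar)"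
    by (rule nn_integral_grassmannian_haar[OF n j \<nu> \<Psi> F])
  also have "\<dots> = (\<integral>\<^sup>+Q. ennreal ?\<kappa> * (\<integral>\<^sup>+y. q (transpose Q *v y) * indicator (cball 0 1) y \<partial>subspace_lborel F) \<partial>rotation_haar)"
    by (rule nn_integral_cong_AE[OF rot])
  also have "\<dots> = ennreal ?\<kappa> * (\<integral>\<^sup>+Q. (\<integral>\<^sup>+y. q (transpose Q *v y) * indicator (cball 0 1) y \<partial>subspace_lborel F) \<partial>rotation_haar)"
  proof (rule nn_integral_cmult)
    interpret sF': sigma_finite_measure "subspace_lborel F" by (rule sigma_finite_subspace_lborel[OF sF(1)])
    have c: "continuous_on UNIV (\<lambda>p :: (real^'n^'n) \<times> (real^'n). transpose (fst p) *v snd p)"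
      by (intro continuous_on_matrix_vector_mult continuous_on_transpose continuous_on_fst continuous_on_snd continuous_on_id)
    have m: "(\<lambda>p :: (real^'n^'n) \<times> (real^'n). q (transpose (fst p) *v snd p)) \<in> borel_measurable (borel \<Otimes>\<^sub>M borel)"
      using measurable_compose[OF borel_measurable_continuous_onI[OF c] q] by (simp add: borel_prod)
    have A: "(\<lambda>p :: (real^'n^'n) \<times> (real^'n). q (transpose (fst p) *v snd p) * indicator (cball 0 1) (snd p)) \<in> borel_measurable (borel \<Otimes>\<^sub>M borel)"
      by (intro borel_measurable_times_ennreal m borel_measurable_indicator_cball) simp
    have B: "(\<lambda>p. (fst p, snd p)) \<in> measurable (rotation_haar \<Otimes>\<^sub>M subspace_lborel F) (borel \<Otimes>\<^sub>M borel :: ((real^'n^'n) \<times> (real^'n)) measure)"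
    proof (rule measurable_Pair)
      show "fst \<in> borel_measurable ((rotation_haar :: (real^'n^'n) measure) \<Otimes>\<^sub>M subspace_lborel F)"
        using measurable_fst[of "rotation_haar :: (real^'n^'n) measure" "subspace_lborel F"] by (simp cong: measurable_cong_sets)
      show "snd \<in> borel_measurable ((rotation_haar :: (real^'n^'n) measure) \<Otimes>\<^sub>M subspace_lborel F)"
        by (rule measurable_compose[OF measurable_snd measurable_subspace_lborelI]) simp
    qed
    have "(\<lambda>p. q (transpose (fst p) *v snd p) * indicator (cball 0 1) (snd p)) \<in> borel_measurable ((rotation_haar :: (real^'n^'n) measure) \<Otimes>\<^sub>M subspace_lborel F)"
      using measurable_compose[OF B A] unfolding fst_conv snd_conv .
    then show "(\<lambda>Q. \<integral>\<^sup>+y. q (transpose Q *v y) * indicator (cball 0 1) y \<partial>subspace_lborel F) \<in> borel_measurable (rotation_haar :: (real^'n^'n) measure)"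
      by (intro sF'.borel_measurable_nn_integral) (simp add: split_beta)
  qed
  also have "(\<integral>\<^sup>+Q. (\<integral>\<^sup>+y. q (transpose Q *v y) * indicator (cball 0 1) y \<partial>subspace_lborel F) \<partial>rotation_haar)
    = rotation_mean q * ennreal (unit_ball_vol (real j))"
  proof -
    have "id \<in> borel_measurable (subspace_lborel F)" by (rule measurable_subspace_lborelI) (simp add: id_def)
    moreover have "AE x in subspace_lborel F. x \<noteq> 0" using j sF by (intro AE_subspace_lborel_nonzero) auto
    ultimately show ?thesis
      using nn_integral_ball_rotation_mean[OF n q hom sigma_finite_subspace_lborel[OF sF(1)]] nn_integral_cball_subspace[OF sF(1)] sF(2) by simp
  qed
  finally have \<Psi>_int: "(\<integral>\<^sup>+E. \<Psi> (proj_matrix E) \<partial>\<nu>) = ennreal ?\<kappa> * (rotation_mean q * ennreal (unit_ball_vol (real j)))" .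
  have "(\<integral>\<^sup>+E. ?W E \<partial>\<nu>) = (\<integral>\<^sup>+E. ennreal (1 / ?\<kappa>) * \<Psi> (proj_matrix E) \<partial>\<nu>)"
    by (intro nn_integral_cong) (simp only: W sp)
  also have "\<dots> = ennreal (1 / ?\<kappa>) * (\<integral>\<^sup>+E. \<Psi> (proj_matrix E) \<partial>\<nu>)" by (rule nn_integral_cmult[OF m\<Psi>P])
  finally show "(\<integral>\<^sup>+E. ?W E \<partial>\<nu>) = ennreal (unit_ball_vol (real j)) * rotation_mean q"
    unfolding \<Psi>_int cancel by (simp add: mult.commute)
  interpret H: prob_space "rotation_haar :: (real^'n^'n) measure" by (rule prob_space_rotation_haar)
  \<comment> \<open>The integral over the whole space is already invariant under rotations, so
    averaging leaves it unchanged and brings in the same constant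
    \<open>rotation_mean q\<close>.\<close>
  have "(\<integral>\<^sup>+x. q x * indicator (cball 0 1) x \<partial>lborel) = (\<integral>\<^sup>+Q. (\<integral>\<^sup>+x. g x \<partial>lborel) \<partial>(rotation_haar :: (real^'n^'n) measure))"
    using H.emeasure_space_1 by (simp add: g_def)
  also have "\<dots> = (\<integral>\<^sup>+Q. (\<integral>\<^sup>+x. q (transpose Q *v x) * indicator (cball 0 1) x \<partial>lborel) \<partial>rotation_haar)"
  proof (rule nn_integral_cong_AE)
    show "AE Q in rotation_haar. (\<integral>\<^sup>+x. g x \<partial>lborel) = (\<integral>\<^sup>+x. q (transpose Q *v x) * indicator (cball 0 1) x \<partial>lborel)"
      using AE_rotation_haar AE_rotation_cball
    proof eventually_elim
      case (elim Q)
      have T: "orthogonal_matrix (transpose Q)" using elim by (simp add: rotation_matrix_def)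
      show ?case using nn_integral_orthogonal[OF T g, symmetric] unfolding g_def elim(2)[rule_format] .
    qed
  qed
  also have "\<dots> = rotation_mean q * (\<integral>\<^sup>+x. indicator (cball (0 :: real^'n) 1) x \<partial>lborel)"
  proof (rule nn_integral_ball_rotation_mean[OF n q hom sigma_finite_lborel])
    show "AE x in lborel. x \<noteq> (0 :: real^'n)" using AE_lborel_singleton by blast
  qed (unfold id_def, measurable)
  also have "(\<integral>\<^sup>+x. indicator (cball (0 :: real^'n) 1) x \<partial>lborel) = ennreal (unit_ball_vol (real CARD('n)))"
    by (simp add: emeasure_unit_cball)
  finally show "(\<integral>\<^sup>+x. q x * indicator (cball 0 1) x \<partial>lborel) = ennreal (unit_ball_vol (real CARD('n))) * rotation_mean q"
    by (simp add: mult.commute)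
qed

lemma radial_function_sublevel:
  fixes f :: "real^'n \<Rightarrow> real"
  assumes f: "f \<in> pos_hom_convex_polynomials d" and d: "d \<ge> 1" and \<alpha>: "\<alpha> > 0" and u: "u \<noteq> 0"
  shows "radial_function {x. f x \<le> \<alpha>} u = (\<alpha> / f u) powr (1 / real d)"
  unfolding radial_function_def
proof (rule Greatest_equality)
  have fu: "f u > 0" by (rule pos_hom_pos[OF f d u])
  let ?r = "(\<alpha> / f u) powr (1 / real d)"
  have r: "?r > 0" using \<alpha> fu by simp
  have rd: "?r ^ d = \<alpha> / f u" using \<alpha> fu d by (simp add: powr_realpow[symmetric] powr_powr)
  show "?r > 0 \<and> ?r *\<^sub>R u \<in> {x. f x \<le> \<alpha>}"
    using r rd fu by (simp add: pos_hom_scale[OF f d])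
  fix l assume l: "l > 0 \<and> l *\<^sub>R u \<in> {x. f x \<le> \<alpha>}"
  then have "l ^ d * f u \<le> \<alpha>" using pos_hom_scale[OF f d, of l u] by simp
  then have "l ^ d \<le> ?r ^ d" unfolding rd using fu by (simp add: le_divide_eq)
  moreover have "?r ^ d < l ^ d" if "?r < l" using that r d by (intro power_strict_mono) auto
  ultimately show "l \<le> ?r" by (meson not_le)
qed

lemma nn_integral_sphere_measure:
  fixes g :: "real^'n \<Rightarrow> ennreal"
  assumes g: "g \<in> borel_measurable borel"
  shows "(\<integral>\<^sup>+u. g u \<partial>sphere_measure) = of_nat CARD('n) * (\<integral>\<^sup>+x. g (sgn x) * indicator (cball 0 1 - {0}) x \<partial>lborel)"
proof -
  let ?D = "restrict_space lborel (cball 0 1 - {0}) :: (real^'n) measure"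
  have m: "sgn \<in> measurable ?D (restrict_space borel (sphere 0 1))"
  proof (rule measurable_restrict_space2)
    show "sgn \<in> space ?D \<rightarrow> sphere (0 :: real^'n) 1" by (auto simp: space_restrict_space norm_sgn)
    have "(sgn :: real^'n \<Rightarrow> real^'n) \<in> borel_measurable borel" unfolding sgn_div_norm[abs_def] by measurable
    then show "sgn \<in> borel_measurable ?D" by (intro measurable_restrict_space1) simp
  qed
  have g': "g \<in> borel_measurable (distr ?D (restrict_space borel (sphere 0 1)) sgn)"
    using measurable_restrict_space1[OF g, of "sphere 0 1"] by simp
  have "(\<integral>\<^sup>+u. g u \<partial>sphere_measure) = of_nat CARD('n) * (\<integral>\<^sup>+u. g u \<partial>distr ?D (restrict_space borel (sphere 0 1)) sgn)"
    unfolding sphere_measure_def by (rule nn_integral_scale_measure[OF g'])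
  also have "(\<integral>\<^sup>+u. g u \<partial>distr ?D (restrict_space borel (sphere 0 1)) sgn) = (\<integral>\<^sup>+x. g (sgn x) \<partial>?D)"
    by (rule nn_integral_distr[OF m g'])
  also have "\<dots> = (\<integral>\<^sup>+x. g (sgn x) * indicator (cball 0 1 - {0}) x \<partial>lborel)"
    by (rule nn_integral_restrict_space) simp
  finally show ?thesis .
qed

text \<open>Surface measure is \<open>n\<close> times the volume of cones, so the factor
  \<open>1 / n\<close> cancels and the sphere is replaced by the ball. The power of the radial
  function extends from the sphere to a function that is homogeneous of degree
  \<open>0\<close>.\<close>

lemma dual_volume_sublevel:
  fixes f :: "real^'n \<Rightarrow> real"
  assumes f: "f \<in> pos_hom_convex_polynomials d" and d: "d \<ge> 1" and \<alpha>: "\<alpha> > 0"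
  shows "dual_volume j {x. f x \<le> \<alpha>} = \<alpha> powr (real j / real d) *
    enn2real (\<integral>\<^sup>+x. ennreal ((norm x ^ d / f x) powr (real j / real d)) * indicator (cball 0 1) x \<partial>lborel)"
proof -
  let ?p = "real j / real d" and ?K = "{x. f x \<le> \<alpha>}"
  have [measurable]: "f \<in> borel_measurable borel" by (rule borel_measurable_continuous_onI[OF pos_hom_continuous[OF f d]])
  have sp: "space sphere_measure = sphere (0 :: real^'n) 1"
    by (simp add: sphere_measure_def space_restrict_space space_scale_measure)
  have sets: "sets (sphere_measure :: (real^'n) measure) = sets (restrict_space borel (sphere 0 1))"
    by (simp add: sphere_measure_def)
  have rad: "radial_function ?K u ^ j = (\<alpha> / f u) powr ?p" if "u \<in> sphere 0 1" for u
  proof -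
    have u0: "u \<noteq> 0" using that by auto
    then have "f u > 0" by (rule pos_hom_pos[OF f d])
    then have "(\<alpha> / f u) powr (1 / real d) > 0" using \<alpha> by simp
    then show ?thesis unfolding radial_function_sublevel[OF f d \<alpha> u0]
      by (simp add: powr_realpow[symmetric] powr_powr)
  qed
  have g: "(\<lambda>u. ennreal ((\<alpha> / f u) powr ?p)) \<in> borel_measurable borel" by measurable
  have gr: "(\<lambda>u. (\<alpha> / f u) powr ?p) \<in> borel_measurable (sphere_measure :: (real^'n) measure)"
    by (subst measurable_cong_sets[OF sets refl], rule measurable_restrict_space1) measurable
  have "(\<integral>u. radial_function ?K u ^ j \<partial>sphere_measure) = (\<integral>u. (\<alpha> / f u) powr ?p \<partial>sphere_measure)"
    by (rule Bochner_Integration.integral_cong[OF refl]) (simp only: rad sp)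
  also have "\<dots> = enn2real (\<integral>\<^sup>+u. ennreal ((\<alpha> / f u) powr ?p) \<partial>sphere_measure)"
    by (rule integral_eq_nn_integral[OF gr]) simp
  also have "(\<integral>\<^sup>+u. ennreal ((\<alpha> / f u) powr ?p) \<partial>sphere_measure)
    = of_nat CARD('n) * (\<integral>\<^sup>+x. ennreal ((\<alpha> / f (sgn x)) powr ?p) * indicator (cball 0 1 - {0}) x \<partial>lborel)"
    by (rule nn_integral_sphere_measure[OF g])
  also have "(\<integral>\<^sup>+x. ennreal ((\<alpha> / f (sgn x)) powr ?p) * indicator (cball 0 1 - {0}) x \<partial>lborel)
    = (\<integral>\<^sup>+x. ennreal (\<alpha> powr ?p) * (ennreal ((norm x ^ d / f x) powr ?p) * indicator (cball 0 1) x) \<partial>lborel)"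
  proof (rule nn_integral_cong)
    fix x :: "real^'n"
    show "ennreal ((\<alpha> / f (sgn x)) powr ?p) * indicator (cball 0 1 - {0}) x
      = ennreal (\<alpha> powr ?p) * (ennreal ((norm x ^ d / f x) powr ?p) * indicator (cball 0 1) x)"
    proof (cases "x = 0")
      \<comment> \<open>The indicators differ at the origin, but there
        \<open>norm x ^ d / f x\<close> is a division by zero, hence \<open>0\<close>, and so is its
        \<open>powr\<close>.\<close>
      case True
      then show ?thesis using pos_hom_0[OF f d] by simp
    next
      case False
      then have fx: "f x > 0" by (rule pos_hom_pos[OF f d])
      have "f (sgn x) = inverse (norm x) ^ d * f x" unfolding sgn_div_norm using False by (intro pos_hom_scale[OF f d]) simp
      then have "\<alpha> / f (sgn x) = \<alpha> * (norm x ^ d / f x)" by (simp add: power_inverse field_simps)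
      then have "(\<alpha> / f (sgn x)) powr ?p = \<alpha> powr ?p * (norm x ^ d / f x) powr ?p"
        using \<alpha> fx by (simp only:) (simp add: powr_mult del: times_divide_eq_right)
      then show ?thesis using False by (simp add: ennreal_mult mult.assoc indicator_def)
    qed
  qed
  also have "\<dots> = ennreal (\<alpha> powr ?p) * (\<integral>\<^sup>+x. ennreal ((norm x ^ d / f x) powr ?p) * indicator (cball 0 1) x \<partial>lborel)"
    by (intro nn_integral_cmult borel_measurable_times_ennreal borel_measurable_indicator_cball) measurable
  finally show ?thesis
    unfolding dual_volume_def by (simp add: enn2real_mult)
qed

text \<open>With \<open>H y = norm y ^ d\<close> in \<open>integral_exp_homogeneous\<close>, each
  inner integral is a multiple of an integral of \<open>q\<close> over the unit ball of
  \<open>E\<close>. The mean over the Grassmannian and the dual volume are then both multiples of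
  \<open>rotation_mean q\<close>, with unit ball volumes of dimension \<open>j\<close> and
  \<open>n\<close> as factors; their quotient is \<sigma>.\<close>

lemma dual_kubota:
  fixes f :: "real^'n \<Rightarrow> real" and \<nu> :: "(real^'n) set measure"
  assumes n: "CARD('n) \<ge> 2" and j: "1 \<le> j" and \<nu>: "is_grassmannian_haar j \<nu>"
    and f: "f \<in> pos_hom_convex_polynomials d" and d: "d \<ge> 1" and \<alpha>: "\<alpha> > 0"
  shows "dual_volume j {x. f x \<le> \<alpha>} = \<alpha> powr (real j / real d) *
     ((unit_ball_vol (real CARD('n)) / unit_ball_vol (real j)) / Gamma (1 + real j / real d)) *
     (\<integral>E. (\<integral>y. exp (- restrict f E y) \<partial>subspace_lborel E) \<partial>\<nu>)"
proof -
  let ?p = "real j / real d"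
  have p: "?p > 0" using j d by simp
  have G: "Gamma (1 + ?p) > 0" using p by (intro Gamma_real_pos) simp
  define q where "q x = ennreal ((norm x ^ d / f x) powr ?p)" for x
  have fm[measurable]: "f \<in> borel_measurable borel" by (rule borel_measurable_continuous_onI[OF pos_hom_continuous[OF f d]])
  have q: "q \<in> borel_measurable borel" unfolding q_def by measurable
  have hom: "q (t *\<^sub>R x) = q x" if "t > 0" for t x
    using that by (simp add: q_def pos_hom_scale[OF f d] power_mult_distrib)
  let ?W = "\<lambda>E. \<integral>\<^sup>+y. q y * indicator (cball 0 1) y \<partial>subspace_lborel E"
  note mean = grassmannian_mean_homogeneous[OF n j \<nu> q hom]
  have sp: "space \<nu> = grassmannian j" by (rule space_grassmannian_haar[OF \<nu>])
  have inner: "(\<integral>y. exp (- restrict f E y) \<partial>subspace_lborel E) = enn2real (ennreal (Gamma (1 + ?p)) * ?W E)"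
    if E: "E \<in> grassmannian j" for E
  proof -
    have sE: "subspace E" "dim E = j" using E by (auto simp: grassmannian_def)
    have mf: "f \<in> borel_measurable (subspace_lborel E)" by (rule measurable_subspace_lborelI[OF fm])
    \<comment> \<open>The space of \<open>subspace_lborel E\<close> is \<open>E\<close> itself, so
      the default value of \<open>restrict\<close> outside \<open>E\<close> is never met.\<close>
    have "(\<integral>y. exp (- restrict f E y) \<partial>subspace_lborel E) = (\<integral>y. exp (- f y) \<partial>subspace_lborel E)"
      by (rule Bochner_Integration.integral_cong[OF refl]) simp
    also have "\<dots> = enn2real (\<integral>\<^sup>+y. ennreal (exp (- f y)) \<partial>subspace_lborel E)"
      using mf by (intro integral_eq_nn_integral) auto
    also have "(\<integral>\<^sup>+y. ennreal (exp (- f y)) \<partial>subspace_lborel E)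
      = ennreal (Gamma (1 + ?p)) * (\<integral>\<^sup>+y. ennreal ((norm y ^ d / f y) powr ?p) * indicator {y. norm y ^ d \<le> 1} y \<partial>subspace_lborel E)"
      unfolding sE(2)[symmetric]
    proof (rule integral_exp_homogeneous[OF sE(1) _ d mf])
      show "1 \<le> dim E" using sE j by simp
      show "(\<lambda>y. norm y ^ d) \<in> borel_measurable (subspace_lborel E)" by (rule measurable_subspace_lborelI) measurable
    qed (auto simp: pos_hom_scale[OF f d] pos_hom_pos[OF f d] power_mult_distrib)
    also have "{y :: real^'n. norm y ^ d \<le> 1} = cball 0 1"
      using d by (auto simp: power_le_one_iff)
    finally show ?thesis unfolding q_def .
  qed
  obtain m where m: "m > 0" "\<And>x. m * norm x ^ d \<le> f x" using pos_hom_lower_bound[OF f d] by blast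
  have qb: "q x \<le> ennreal ((1 / m) powr ?p)" for x
  proof -
    have "norm x ^ d / f x \<le> 1 / m"
      using m(1) m(2)[of x] pos_hom_nonneg[OF f d, of x] by (cases "f x = 0") (auto simp: field_simps)
    then show ?thesis unfolding q_def using p pos_hom_nonneg[OF f d, of x] by (intro ennreal_leI powr_mono2) auto
  qed
  \<comment> \<open>The inner integral is \<open>enn2real\<close> of an extended integral, and
    \<open>enn2real\<close> sends an infinite value to \<open>0\<close>. Finiteness allows it to be
    undone before integrating over \<nu>.\<close>
  have Wfin: "?W E < top" if E: "E \<in> grassmannian j" for E
  proof -
    have sE: "subspace E" using E by (auto simp: grassmannian_def)
    have "?W E \<le> (\<integral>\<^sup>+y. ennreal ((1 / m) powr ?p) * indicator (cball 0 1) y \<partial>subspace_lborel E)"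
      by (intro nn_integral_mono mult_right_mono qb) auto
    also have "\<dots> = ennreal ((1 / m) powr ?p) * (\<integral>\<^sup>+y. indicator (cball 0 1) y \<partial>subspace_lborel E)"
      by (intro nn_integral_cmult measurable_subspace_lborelI borel_measurable_indicator_cball) simp
    also have "\<dots> < top" unfolding nn_integral_cball_subspace[OF sE] by (simp add: ennreal_mult[symmetric])
    finally show ?thesis .
  qed
  have "(\<integral>E. (\<integral>y. exp (- restrict f E y) \<partial>subspace_lborel E) \<partial>\<nu>) = (\<integral>E. enn2real (ennreal (Gamma (1 + ?p)) * ?W E) \<partial>\<nu>)"
    by (rule Bochner_Integration.integral_cong[OF refl]) (simp only: inner sp)
  also have "\<dots> = enn2real (\<integral>\<^sup>+E. ennreal (enn2real (ennreal (Gamma (1 + ?p)) * ?W E)) \<partial>\<nu>)"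
    using mean(1) by (intro integral_eq_nn_integral) auto
  also have "(\<integral>\<^sup>+E. ennreal (enn2real (ennreal (Gamma (1 + ?p)) * ?W E)) \<partial>\<nu>) = (\<integral>\<^sup>+E. ennreal (Gamma (1 + ?p)) * ?W E \<partial>\<nu>)"
    using Wfin by (intro nn_integral_cong) (simp add: sp ennreal_mult_less_top)
  also have "\<dots> = ennreal (Gamma (1 + ?p)) * (ennreal (unit_ball_vol (real j)) * rotation_mean q)"
    using nn_integral_cmult[OF mean(1), of "ennreal (Gamma (1 + ?p))"] by (simp only: mean(2))
  finally have R: "(\<integral>E. (\<integral>y. exp (- restrict f E y) \<partial>subspace_lborel E) \<partial>\<nu>) = Gamma (1 + ?p) * (unit_ball_vol (real j) * enn2real (rotation_mean q))"
    using G by (simp add: enn2real_mult)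
  have "dual_volume j {x. f x \<le> \<alpha>} = \<alpha> powr ?p * (unit_ball_vol (real CARD('n)) * enn2real (rotation_mean q))"
    unfolding dual_volume_sublevel[OF f d \<alpha>] q_def[symmetric] using mean(3) by (simp add: enn2real_mult)
  then show ?thesis unfolding R using G by simp
qed

theorem theorem3p5:
  fixes f :: "real ^ 'n \<Rightarrow> real" and d j :: nat and \<alpha> :: real
    and \<nu> :: "(real ^ 'n) set measure"
  assumes n: "CARD('n) \<ge> 2"
    and d: "d \<ge> 2" "even d"
    and f: "f \<in> pos_hom_convex_polynomials d"
    and \<alpha>: "\<alpha> > 0"
    and j: "1 \<le> j" "j \<le> CARD('n) - 1"
    and \<nu>: "is_grassmannian_haar j \<nu>"
  shows "intrinsic_volume j {x. f x \<le> \<alpha>} =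
           \<alpha> powr (real j / real d) *
           ((real (CARD('n) choose j) * unit_ball_vol (real CARD('n)) /
              (unit_ball_vol (real j) * unit_ball_vol (real (CARD('n) - j)))) /
            Gamma (1 + real j / real d)) *
           (\<integral>E. (\<integral>y. exp (- inf_projection E f y) \<partial>subspace_lborel E) \<partial>\<nu>)
       \<and> dual_volume j {x. f x \<le> \<alpha>} =
           \<alpha> powr (real j / real d) *
           ((unit_ball_vol (real CARD('n)) / unit_ball_vol (real j)) /
            Gamma (1 + real j / real d)) *
           (\<integral>E. (\<integral>y. exp (- restrict f E y) \<partial>subspace_lborel E) \<partial>\<nu>)"
proof
  have d1: "d \<ge> 1" using d by simp
  have jn: "j \<le> CARD('n)" using j by simp
  let ?p = "real j / real d" and ?K = "{x. f x \<le> \<alpha>}"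
  have G: "Gamma (1 + ?p) > 0" using j d1 by (intro Gamma_real_pos) (simp add: add_pos_nonneg)
  have K: "compact ?K" "convex ?K" "?K \<noteq> {}" using sublevel_ccn[OF f d1, of \<alpha>] \<alpha> by auto
  have sp: "space \<nu> = grassmannian j" by (rule space_grassmannian_haar[OF \<nu>])
  have "(\<integral>E. (\<integral>y. exp (- inf_projection E f y) \<partial>subspace_lborel E) \<partial>\<nu>)
    = (\<integral>E. Gamma (1 + ?p) * (\<alpha> powr (- ?p) * proj_vol E ?K) \<partial>\<nu>)"
    by (rule Bochner_Integration.integral_cong[OF refl])
       (use integral_exp_inf_projection[OF f d1 \<alpha> _ _ j(1)] in \<open>simp add: sp grassmannian_def\<close>)
  also have "\<dots> = Gamma (1 + ?p) * (\<alpha> powr (- ?p) * (\<integral>E. proj_vol E ?K \<partial>\<nu>))" by simp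
  finally have R: "(\<integral>E. (\<integral>y. exp (- inf_projection E f y) \<partial>subspace_lborel E) \<partial>\<nu>)
    = Gamma (1 + ?p) * (\<alpha> powr (- ?p) * (\<integral>E. proj_vol E ?K \<partial>\<nu>))" .
  have cancel: "\<alpha> powr ?p * (c / Gamma (1 + ?p)) * (Gamma (1 + ?p) * (\<alpha> powr (- ?p) * I)) = c * I" for c I
    using G \<alpha> by (simp add: powr_minus)
  show "intrinsic_volume j ?K = \<alpha> powr ?p *
           ((real (CARD('n) choose j) * unit_ball_vol (real CARD('n)) /
              (unit_ball_vol (real j) * unit_ball_vol (real (CARD('n) - j)))) / Gamma (1 + ?p)) *
           (\<integral>E. (\<integral>y. exp (- inf_projection E f y) \<partial>subspace_lborel E) \<partial>\<nu>)"
    unfolding R kubota[OF n j(1) jn \<nu> K] by (rule cancel[symmetric])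
  show "dual_volume j ?K = \<alpha> powr ?p *
           ((unit_ball_vol (real CARD('n)) / unit_ball_vol (real j)) / Gamma (1 + ?p)) *
           (\<integral>E. (\<integral>y. exp (- restrict f E y) \<partial>subspace_lborel E) \<partial>\<nu>)"
    by (rule dual_kubota[OF n j(1) \<nu> f d1 \<alpha>])
qed

end
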